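(* Let $G$ be a finite group, $\mathcal{O}$ a conjugacy class in $G$, and $p$ an odd prime. Let $(\mu,\nu)=(\mu_i)_{i\in\mathbb{Z}/p}\cup(\nu_i)_{i\in\mathbb{Z}/p}$ be a family of elements in $G$ with $\mu_0\in\mathcal{O}$. Let $(\rho,V)$ be an irreducible complex representation of the centralizer $G^{\mu_0}$. Assume that (H1) $(\mu,\nu)$ is of type $\mathcal{D}_p^{(2)}$; (H2) all $\mu_i$ and $\nu_i$ lie in $\mathcal{O}$, and $g_\infty\in G$ is an element such that $g_\infty\mu_0g_\infty^{-1}=\nu_0$; (H3) $q_{\mu_0\mu_0}=-1$; (H4) there exist $v,w\in V\setminus\{0\}$ such that $\rho(g_\infty^{-1}\mu_0g_\infty)w=-w$ and $\rho(\nu_0)v=-v$. Then $\dim\mathfrak{B}(\mathcal{O},\rho)=\infty$.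
   Context: The base field is $\mathbb{C}$. For $x,y\in G$ write $x\triangleright y=xyx^{-1}$; $G^s$ is the centralizer of $s$ in $G$. Type $\mathcal{D}_p$: for an integer $p>1$, a family $(\mu_i)_{i\in\mathbb{Z}/p}$ of distinct elements of $G$ is of type $\mathcal{D}_p$ if $\mu_i\triangleright\mu_j=\mu_{2i-j}$ for all $i,j\in\mathbb{Z}/p$. Type $\mathcal{D}_p^{(2)}$: if $(\mu_i)_{i\in\mathbb{Z}/p}$ and $(\nu_i)_{i\in\mathbb{Z}/p}$ are two families of type $\mathcal{D}_p$ in $G$ with $\mu_i\neq\nu_j$ for all $i,j$, then $(\mu,\nu)$ is of type $\mathcal{D}_p^{(2)}$ if $\mu_i\triangleright\nu_j=\nu_{2i-j}$ and $\nu_i\triangleright\mu_j=\mu_{2i-j}$ for all $i,j\in\mathbb{Z}/p$. Yetter-Drinfeld module $M(\mathcal{O},\rho)$: let $s\in\mathcal{O}$ (here $s=\mu_0$) and let $(\rho,V)$ be an irreducible complex representation of $G^s$. Enumerate $\mathcal{O}=\{t_1=s,\dots,t_M\}$ and choose $g_i\in G$ with $g_i\triangleright s=t_i$. Then $M(\mathcal{O},\rho)=\bigoplus_{1\le i\le M}g_i\otimes V$, with $g_iv:=g_i\otimes v$, is a braided vector space with braiding $c(g_iv\otimes g_jw)=g_h(\rho(\gamma)w)\otimes g_iv$, where $t_ig_j=g_h\gamma$ with unique $h$ and $\gamma\in G^s$. Up to isomorphism it does not depend on the choices. Since $s$ is central in $G^s$, $\rho(s)$ is a scalar, denoted $q_{ss}$.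 Nichols algebra: for a braided vector space $(U,c)$, $\mathfrak{B}(U)=T(U)/\bigoplus_{n\ge2}\ker\mathfrak{S}_n$, where $\mathfrak{S}_n=\sum_{\pi\in\mathbb{S}_n}c_\pi$ acts on $U^{\otimes n}$, with $c_\pi=c_{i_1}\cdots c_{i_r}$ for a reduced expression $\pi=s_{i_1}\cdots s_{i_r}$ in simple transpositions, and $c_i$ is $c$ applied to the tensor factors $i,i+1$. Write $\mathfrak{B}(\mathcal{O},\rho)=\mathfrak{B}(M(\mathcal{O},\rho))$. *)

theory Defs
  imports
    Complex_Main
    "HOL-Library.Poly_Mapping"
    "HOL-Library.Function_Algebras"
    "HOL-Combinatorics.Permutations"
    "HOL-Algebra.QuotRing"
    "HOL-Algebra.Embedded_Algebras"
    "HOL-Computational_Algebra.Primes"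
begin

section \<open>Conjugation and families of dihedral type\<close>

definition conj_by :: "('g, 'm) monoid_scheme \<Rightarrow> 'g \<Rightarrow> 'g \<Rightarrow> 'g"
  where "conj_by G x y = x \<otimes>\<^bsub>G\<^esub> y \<otimes>\<^bsub>G\<^esub> inv\<^bsub>G\<^esub> x"

definition centralizer :: "('g, 'm) monoid_scheme \<Rightarrow> 'g \<Rightarrow> 'g set"
  where "centralizer G s = {x \<in> carrier G. x \<otimes>\<^bsub>G\<^esub> s = s \<otimes>\<^bsub>G\<^esub> x}"

definition is_conjugacy_class :: "('g, 'm) monoid_scheme \<Rightarrow> 'g set \<Rightarrow> bool"
  where "is_conjugacy_class G C \<longleftrightarrow>
    (\<exists>y \<in> carrier G. C = {conj_by G x y | x. x \<in> carrier G})"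

text \<open>
  A family indexed by the integers modulo \<open>p\<close> is a function on \<^typ>\<open>int\<close> of which only
  the values on the residues \<open>{0..<int p}\<close> matter; indices are reduced with \<open>mod\<close>.
\<close>

definition type_D :: "('g, 'm) monoid_scheme \<Rightarrow> nat \<Rightarrow> (int \<Rightarrow> 'g) \<Rightarrow> bool"
  where "type_D G p \<mu> \<longleftrightarrow>
    p > 1 \<and> \<mu> ` {0..<int p} \<subseteq> carrier G \<and> inj_on \<mu> {0..<int p} \<and>
    (\<forall>i \<in> {0..<int p}. \<forall>j \<in> {0..<int p}.
       conj_by G (\<mu> i) (\<mu> j) = \<mu> ((2 * i - j) mod int p))"

definition type_D2 :: "('g, 'm) monoid_scheme \<Rightarrow> nat \<Rightarrow> (int \<Rightarrow> 'g) \<Rightarrow> (int \<Rightarrow> 'g) \<Rightarrow> bool"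
  where "type_D2 G p \<mu> \<nu> \<longleftrightarrow>
    type_D G p \<mu> \<and> type_D G p \<nu> \<and>
    (\<forall>i \<in> {0..<int p}. \<forall>j \<in> {0..<int p}. \<mu> i \<noteq> \<nu> j) \<and>
    (\<forall>i \<in> {0..<int p}. \<forall>j \<in> {0..<int p}.
       conj_by G (\<mu> i) (\<nu> j) = \<nu> ((2 * i - j) mod int p) \<and>
       conj_by G (\<nu> i) (\<mu> j) = \<mu> ((2 * i - j) mod int p))"


section \<open>Irreducible complex representations\<close>

definition GL :: "(complex \<Rightarrow> 'v \<Rightarrow> 'v) \<Rightarrow> ('v::ab_group_add \<Rightarrow> 'v) monoid"
  where "GL scale =
    \<lparr>carrier = {f. Vector_Spaces.linear scale scale f \<and> bij f}, mult = (\<circ>), one = id\<rparr>"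

definition irreducible_representation ::
    "('g, 'm) monoid_scheme \<Rightarrow> (complex \<Rightarrow> 'v \<Rightarrow> 'v) \<Rightarrow> ('g \<Rightarrow> 'v::ab_group_add \<Rightarrow> 'v) \<Rightarrow> bool"
  where "irreducible_representation H scale \<rho> \<longleftrightarrow>
    vector_space scale \<and> \<rho> \<in> hom H (GL scale) \<and> (UNIV :: 'v set) \<noteq> {0} \<and>
    (\<forall>W. module.subspace scale W \<and> (\<forall>h \<in> carrier H. \<rho> h ` W \<subseteq> W) \<longrightarrow> W = {0} \<or> W = UNIV)"

text \<open>
  The scalar \<open>q_ss\<close> by which \<open>\<rho>(s)\<close> acts; for an irreducible \<open>\<rho>\<close> and \<open>s\<close> central
  it exists by Schur's lemma, and it is unique because the space is nonzero.
\<close>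

definition central_scalar :: "(complex \<Rightarrow> 'v \<Rightarrow> 'v) \<Rightarrow> ('g \<Rightarrow> 'v \<Rightarrow> 'v) \<Rightarrow> 'g \<Rightarrow> complex"
  where "central_scalar scale \<rho> s = (THE q. \<forall>v. \<rho> s v = scale q v)"


section \<open>The tensor algebra\<close>

text \<open>
  Throughout, \<open>U\<close> is a subspace of a complex vector space with scalar multiplication
  \<open>scale\<close>.  The free algebra on the set \<open>U\<close> has the words over \<open>U\<close> as a basis; the word
  \<open>[u\<^sub>1, \<dots>, u\<^sub>n]\<close> represents the tensor product of its letters, and the tensor algebra is the
  quotient by the ideal that makes words linear in every letter.
\<close>

definition smult_fin :: "complex \<Rightarrow> ('a \<Rightarrow>\<^sub>0 complex) \<Rightarrow> ('a \<Rightarrow>\<^sub>0 complex)"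
  where "smult_fin a f = Poly_Mapping.map ((*) a) f"

definition lin_ext :: "('a \<Rightarrow> ('b \<Rightarrow>\<^sub>0 complex)) \<Rightarrow> ('a \<Rightarrow>\<^sub>0 complex) \<Rightarrow> ('b \<Rightarrow>\<^sub>0 complex)"
  where "lin_ext \<phi> f = (\<Sum>x \<in> Poly_Mapping.keys f. smult_fin (Poly_Mapping.lookup f x) (\<phi> x))"

definition word :: "'u list \<Rightarrow> ('u list \<Rightarrow>\<^sub>0 complex)"
  where "word xs = Poly_Mapping.single xs 1"

definition free_algebra :: "'u set \<Rightarrow> ('u list \<Rightarrow>\<^sub>0 complex) ring"
  where "free_algebra U =
    \<lparr>carrier = {f. Poly_Mapping.keys f \<subseteq> lists U},
     mult = (\<lambda>f g. lin_ext (\<lambda>xs. lin_ext (\<lambda>ys. word (xs @ ys)) g) f),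
     one = word [],
     zero = 0,
     add = (+)\<rparr>"

definition tensor_relations ::
    "(complex \<Rightarrow> 'u \<Rightarrow> 'u) \<Rightarrow> 'u::ab_group_add set \<Rightarrow> ('u list \<Rightarrow>\<^sub>0 complex) set"
  where "tensor_relations scale U =
    {word [u + v] - word [u] - word [v] | u v. u \<in> U \<and> v \<in> U} \<union>
    {word [scale a u] - smult_fin a (word [u]) | a u. u \<in> U}"

definition tensor_ideal ::
    "(complex \<Rightarrow> 'u \<Rightarrow> 'u) \<Rightarrow> 'u::ab_group_add set \<Rightarrow> ('u list \<Rightarrow>\<^sub>0 complex) set"
  where "tensor_ideal scale U = Idl\<^bsub>free_algebra U\<^esub> (tensor_relations scale U)"

definition tensor_algebra ::
    "(complex \<Rightarrow> 'u \<Rightarrow> 'u) \<Rightarrow> 'u::ab_group_add set \<Rightarrow> ('u list \<Rightarrow>\<^sub>0 complex) set ring"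
  where "tensor_algebra scale U = free_algebra U Quot tensor_ideal scale U"


section \<open>Quantum symmetrizers and the Nichols algebra\<close>

text \<open>
  A linear endomorphism \<open>c\<close> of the tensor square of \<open>U\<close> is given as a function that sends
  \<open>u\<close> and \<open>v\<close> to a combination of words of length two representing \<open>c(u \<otimes> v)\<close>.
  The operators below act on representatives in the free algebra; as \<open>c\<close> is linear on the
  tensor square, they preserve the tensor ideal and so induce operators on the tensor powers.
\<close>

text \<open>\<open>c\<close> applied to the letters at positions \<open>i\<close> and \<open>i + 1\<close>, counting from \<open>0\<close>\<close>

definition braid_at ::
    "('u \<Rightarrow> 'u \<Rightarrow> ('u list \<Rightarrow>\<^sub>0 complex)) \<Rightarrow> nat \<Rightarrow> ('u list \<Rightarrow>\<^sub>0 complex) \<Rightarrow> ('u list \<Rightarrow>\<^sub>0 complex)"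
  where "braid_at c i =
    lin_ext (\<lambda>xs. lin_ext (\<lambda>ys. word (take i xs @ ys @ drop (i + 2) xs))
                          (c (xs ! i) (xs ! (i + 1))))"

definition transposition_product :: "nat list \<Rightarrow> nat \<Rightarrow> nat"
  where "transposition_product is = foldr (\<lambda>i \<pi>. Transposition.transpose i (Suc i) \<circ> \<pi>) is id"

definition reduced_expression :: "nat \<Rightarrow> (nat \<Rightarrow> nat) \<Rightarrow> nat list \<Rightarrow> bool"
  where "reduced_expression n \<pi> is \<longleftrightarrow>
    set is \<subseteq> {i. Suc i < n} \<and> transposition_product is = \<pi> \<and>
    (\<forall>js. set js \<subseteq> {i. Suc i < n} \<and> transposition_product js = \<pi> \<longrightarrow> length is \<le> length js)"

text \<open>By the braid equation the operator does not depend on the reduced expression chosen.\<close>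

definition braid_perm ::
    "('u \<Rightarrow> 'u \<Rightarrow> ('u list \<Rightarrow>\<^sub>0 complex)) \<Rightarrow> nat \<Rightarrow> (nat \<Rightarrow> nat) \<Rightarrow>
     ('u list \<Rightarrow>\<^sub>0 complex) \<Rightarrow> ('u list \<Rightarrow>\<^sub>0 complex)"
  where "braid_perm c n \<pi> =
    foldr (\<lambda>i f. braid_at c i \<circ> f) (SOME is. reduced_expression n \<pi> is) id"

definition quantum_symmetrizer ::
    "('u \<Rightarrow> 'u \<Rightarrow> ('u list \<Rightarrow>\<^sub>0 complex)) \<Rightarrow> nat \<Rightarrow> ('u list \<Rightarrow>\<^sub>0 complex) \<Rightarrow> ('u list \<Rightarrow>\<^sub>0 complex)"
  where "quantum_symmetrizer c n f = (\<Sum>\<pi> | \<pi> permutes {..<n}. braid_perm c n \<pi> f)"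

text \<open>The kernel of the \<open>n\<close>-th quantum symmetrizer on the \<open>n\<close>-th tensor power of \<open>U\<close>\<close>

definition symmetrizer_kernel ::
    "(complex \<Rightarrow> 'u \<Rightarrow> 'u) \<Rightarrow> 'u::ab_group_add set \<Rightarrow> ('u \<Rightarrow> 'u \<Rightarrow> ('u list \<Rightarrow>\<^sub>0 complex)) \<Rightarrow>
     nat \<Rightarrow> ('u list \<Rightarrow>\<^sub>0 complex) set set"
  where "symmetrizer_kernel scale U c n =
    {tensor_ideal scale U +>\<^bsub>free_algebra U\<^esub> f | f.
       Poly_Mapping.keys f \<subseteq> {xs \<in> lists U. length xs = n} \<and>
       quantum_symmetrizer c n f \<in> tensor_ideal scale U}"

definition nichols_ideal ::
    "(complex \<Rightarrow> 'u \<Rightarrow> 'u) \<Rightarrow> 'u::ab_group_add set \<Rightarrow> ('u \<Rightarrow> 'u \<Rightarrow> ('u list \<Rightarrow>\<^sub>0 complex)) \<Rightarrow>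
     ('u list \<Rightarrow>\<^sub>0 complex) set set"
  where "nichols_ideal scale U c =
    {finsum (tensor_algebra scale U) x {2..m} | x m.
       x \<in> (\<Pi> n \<in> {2..m}. symmetrizer_kernel scale U c n)}"

definition nichols_algebra ::
    "(complex \<Rightarrow> 'u \<Rightarrow> 'u) \<Rightarrow> 'u::ab_group_add set \<Rightarrow> ('u \<Rightarrow> 'u \<Rightarrow> ('u list \<Rightarrow>\<^sub>0 complex)) \<Rightarrow>
     ('u list \<Rightarrow>\<^sub>0 complex) set set ring"
  where "nichols_algebra scale U c = tensor_algebra scale U Quot nichols_ideal scale U c"

text \<open>The image of the complex numbers, over which dimensions are taken\<close>

definition nichols_scalars ::
    "(complex \<Rightarrow> 'u \<Rightarrow> 'u) \<Rightarrow> 'u::ab_group_add set \<Rightarrow> ('u \<Rightarrow> 'u \<Rightarrow> ('u list \<Rightarrow>\<^sub>0 complex)) \<Rightarrow>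
     ('u list \<Rightarrow>\<^sub>0 complex) set set set"
  where "nichols_scalars scale U c =
    {nichols_ideal scale U c +>\<^bsub>tensor_algebra scale U\<^esub>
       (tensor_ideal scale U +>\<^bsub>free_algebra U\<^esub> smult_fin a (word [])) | a. True}"


section \<open>The Yetter-Drinfeld module of a conjugacy class and a representation\<close>

text \<open>
  The class \<open>C\<close> itself is the index set, and \<open>g t\<close> conjugates \<open>s\<close> to \<open>t\<close> for \<open>t \<in> C\<close>.  The
  element \<open>\<Sum>\<^sub>t g\<^sub>t v\<^sub>t\<close> of \<open>M(C, \<rho>)\<close> is the function \<open>t \<mapsto> v\<^sub>t\<close>, which vanishes outside \<open>C\<close>.
\<close>

definition coset_reps :: "('g, 'm) monoid_scheme \<Rightarrow> 'g set \<Rightarrow> 'g \<Rightarrow> ('g \<Rightarrow> 'g) \<Rightarrow> bool"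
  where "coset_reps G C s g \<longleftrightarrow> (\<forall>t \<in> C. g t \<in> carrier G \<and> conj_by G (g t) s = t)"

definition YD_space :: "'g set \<Rightarrow> ('g \<Rightarrow> 'v::zero) set"
  where "YD_space C = {u. \<forall>t. t \<notin> C \<longrightarrow> u t = 0}"

definition YD_scale :: "(complex \<Rightarrow> 'v \<Rightarrow> 'v) \<Rightarrow> complex \<Rightarrow> ('g \<Rightarrow> 'v) \<Rightarrow> ('g \<Rightarrow> 'v)"
  where "YD_scale scale a u = (\<lambda>t. scale a (u t))"

definition YD_elem :: "'g \<Rightarrow> 'v::zero \<Rightarrow> ('g \<Rightarrow> 'v)"
  where "YD_elem t v = (\<lambda>x. if x = t then v else 0)"

text \<open>The pair \<open>(h, \<gamma>)\<close> with \<open>t g\<^sub>r = g\<^sub>h \<gamma>\<close>\<close>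

definition YD_factor ::
    "('g, 'm) monoid_scheme \<Rightarrow> 'g set \<Rightarrow> 'g \<Rightarrow> ('g \<Rightarrow> 'g) \<Rightarrow> 'g \<Rightarrow> 'g \<Rightarrow> 'g \<times> 'g"
  where "YD_factor G C s g t r =
    (THE (h, \<gamma>). h \<in> C \<and> \<gamma> \<in> centralizer G s \<and> t \<otimes>\<^bsub>G\<^esub> g r = g h \<otimes>\<^bsub>G\<^esub> \<gamma>)"

definition YD_braiding ::
    "('g, 'm) monoid_scheme \<Rightarrow> 'g set \<Rightarrow> 'g \<Rightarrow> ('g \<Rightarrow> 'g) \<Rightarrow> ('g \<Rightarrow> 'v::zero \<Rightarrow> 'v) \<Rightarrow>
     ('g \<Rightarrow> 'v) \<Rightarrow> ('g \<Rightarrow> 'v) \<Rightarrow> (('g \<Rightarrow> 'v) list \<Rightarrow>\<^sub>0 complex)"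
  where "YD_braiding G C s g \<rho> u u' =
    (\<Sum>t \<in> C. \<Sum>r \<in> C.
       let (h, \<gamma>) = YD_factor G C s g t r
       in word [YD_elem h (\<rho> \<gamma> (u' r)), YD_elem t (u t)])"

definition YD_nichols_algebra ::
    "('g, 'm) monoid_scheme \<Rightarrow> 'g set \<Rightarrow> 'g \<Rightarrow> ('g \<Rightarrow> 'g) \<Rightarrow>
     (complex \<Rightarrow> 'v \<Rightarrow> 'v) \<Rightarrow> ('g \<Rightarrow> 'v::ab_group_add \<Rightarrow> 'v) \<Rightarrow>
     (('g \<Rightarrow> 'v) list \<Rightarrow>\<^sub>0 complex) set set ring"
  where "YD_nichols_algebra G C s g scale \<rho> =
    nichols_algebra (YD_scale scale) (YD_space C) (YD_braiding G C s g \<rho>)"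

definition YD_nichols_scalars ::
    "('g, 'm) monoid_scheme \<Rightarrow> 'g set \<Rightarrow> 'g \<Rightarrow> ('g \<Rightarrow> 'g) \<Rightarrow>
     (complex \<Rightarrow> 'v \<Rightarrow> 'v) \<Rightarrow> ('g \<Rightarrow> 'v::ab_group_add \<Rightarrow> 'v) \<Rightarrow>
     (('g \<Rightarrow> 'v) list \<Rightarrow>\<^sub>0 complex) set set set"
  where "YD_nichols_scalars G C s g scale \<rho> =
    nichols_scalars (YD_scale scale) (YD_space C) (YD_braiding G C s g \<rho>)"

end

theory Submission
  imports Defs
begin

text \<open>
  Write \<open>\<mu>\<^sub>i\<close>, \<open>\<nu>\<^sub>i\<close> for the two families and let the group act on \<open>M(C, \<rho>)\<close>. Because
  \<open>p\<close> is odd, the relations of type \<open>D\<close> force \<open>\<mu>\<^sub>i = T\<^sup>i \<mu>\<^sub>0\<close> and \<open>\<nu>\<^sub>i = T\<^sup>i \<nu>\<^sub>0\<close> for one and the same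
  element \<open>T\<close> with \<open>T\<^sup>p = 1\<close>, and \<open>\<mu>\<^sub>0\<close>, \<open>\<nu>\<^sub>0\<close> invert \<open>T\<close> (locale \<open>dihedral_pair\<close>). Moving the
  vectors \<open>1 \<otimes> v\<close> and \<open>g_inf \<otimes> w\<close> by powers of \<open>T\<close> gives vectors \<open>a\<^sub>i\<close> of degree \<open>\<mu>\<^sub>i\<close> and \<open>b\<^sub>i\<close> of
  degree \<open>\<nu>\<^sub>i\<close>, and the hypotheses on \<open>v\<close>, \<open>w\<close> and \<open>q\<^sub>s\<^sub>s\<close> imply that every \<open>\<mu>\<^sub>i\<close> and every \<open>\<nu>\<^sub>i\<close> sends
  \<open>a\<^sub>j\<close> to \<open>- a\<^bsub>2i-j\<^esub>\<close> and \<open>b\<^sub>j\<close> to \<open>- b\<^bsub>2i-j\<^esub>\<close>. So the span of these \<open>2p\<close> vectors is a braided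
  subspace that only depends on \<open>p\<close> (locale \<open>dihedral_yd\<close>), and it suffices to find, in arbitrarily high
  degrees, words in these letters that the quantum symmetrizer does not annihilate.

  The quantum symmetrizer of degree \<open>n + 1\<close> is the sum of those obtained by moving one letter to the end and
  symmetrizing the other \<open>n\<close> letters. Moving the letter \<open>x\<close> to the end and deleting it is a skew derivation
  \<open>\<partial>\<^sub>x\<close>. Hence the symmetrizer kills an element only if it kills all its skew derivatives
  (\<open>sym_skew_deriv\<close>), and an element survives once some sequence of skew derivations takes it to
  a nonzero number.

  Let \<open>\<zeta>\<close> be a primitive \<open>p\<close>-th root of unity. The braided commutators
  \<open>a\<^bsub>k+s\<^esub> b\<^sub>k + b\<^bsub>k+2s\<^esub> a\<^bsub>k+s\<^esub>\<close> with \<open>s = 1\<close> or \<open>s = -1\<close> are permuted cyclically by the rotations, and their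
  Fourier components \<open>Y\<^sub>s = \<Sum>\<^sub>k \<zeta>\<^bsup>sk\<^esup> (a\<^bsub>k+s\<^esub> b\<^sub>k + b\<^bsub>k+2s\<^esub> a\<^bsub>k+s\<^esub>)\<close> span a braided vector space of
  diagonal type with \<open>q\<^sub>1\<^sub>1 = q\<^sub>2\<^sub>2 = \<zeta>\<^sup>-\<^sup>2\<close> and \<open>q\<^sub>1\<^sub>2 q\<^sub>2\<^sub>1 = \<zeta>\<^sup>4\<close>. This is the affine Cartan type
  \<open>A\<^sub>1\<^sup>(\<^sup>1\<^sup>)\<close>; its imaginary root vector \<open>u = Y\<^sub>1 Y\<^sub>-\<^sub>1 - \<zeta>\<^sup>2 Y\<^sub>-\<^sub>1 Y\<^sub>1\<close> commutes with itself under the braiding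
  without a scalar, so its powers behave as in a polynomial ring. Concretely, the second order skew derivations
  \<open>F\<^sub>s = \<partial>\<^bsub>a(s)\<^esub> \<partial>\<^bsub>b(0)\<^esub>\<close> satisfy \<open>F\<^sub>1 F\<^sub>-\<^sub>1 u\<^bsup>n+1\<^esup> = (n + 1) c u\<^sup>n\<close> with a constant \<open>c \<noteq> 0\<close>
  (\<open>double_deriv_double_deriv_power\<close>), and so no power of \<open>u\<close> vanishes (\<open>power_detected\<close>).

  To draw the conclusion about the Nichols algebra as it is defined, two general facts are proved on the way.
  The operator attached to a permutation does not depend on the reduced expression: on words of homogeneous
  vectors it is given by an explicit formula (\<open>swaps_eq_braid_result\<close>, \<open>quantum_symmetrizer_E\<close>). And the kernels of
  the quantum symmetrizers form an ideal (\<open>ideal_kernel\<close>), so the Nichols algebra is a ring graded by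
  degree, every finite-dimensional subspace of which has bounded degree
  (\<open>infinite_dimension_criterion\<close>).
\<close>

section \<open>Linear maps between free modules and the free algebra\<close>

text \<open>
  The finitely supported functions on a monoid form a ring under convolution. With concatenation as the
  monoid law on lists this ring is the free algebra, so its ring laws come from type classes.
\<close>

instantiation list :: (type) monoid_add begin
definition zero_list :: "'a list" where "zero_list = []"
definition plus_list :: "'a list \<Rightarrow> 'a list \<Rightarrow> 'a list" where "plus_list = (@)"
instance by standard (auto simp: zero_list_def plus_list_def)
end

lemma lookup_smult_fin [simp]: "Poly_Mapping.lookup (smult_fin a f) k = a * Poly_Mapping.lookup f k"
  by (simp add: smult_fin_def Poly_Mapping.map.rep_eq when_def)

lemma smult_fin_add: "smult_fin a (f + g) = smult_fin a f + smult_fin a g"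
  by (rule poly_mapping_eqI) (simp add: lookup_add algebra_simps)
lemma smult_fin_add_left: "smult_fin (a + b) f = smult_fin a f + smult_fin b f"
  by (rule poly_mapping_eqI) (simp add: lookup_add algebra_simps)
lemma smult_fin_diff: "smult_fin a (f - g) = smult_fin a f - smult_fin a g"
  by (rule poly_mapping_eqI) (simp add: lookup_minus algebra_simps)
lemma smult_fin_smult_fin [simp]: "smult_fin a (smult_fin b f) = smult_fin (a * b) f"
  by (rule poly_mapping_eqI) simp
lemma smult_fin_simps [simp]: "smult_fin 1 f = f" "smult_fin 0 f = 0" "smult_fin a 0 = 0"
  by (rule poly_mapping_eqI, simp)+
lemma smult_fin_minus_one: "smult_fin (-1) f = - f"
  by (rule poly_mapping_eqI) simp
lemma smult_fin_minus: "smult_fin a (- f) = - smult_fin a f" "smult_fin (- a) f = - smult_fin a f"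
  by (rule poly_mapping_eqI, simp)+
lemma smult_fin_sum: "smult_fin a (sum f S) = (\<Sum>x\<in>S. smult_fin a (f x))"
  by (induction S rule: infinite_finite_induct) (auto simp: smult_fin_add)
lemma smult_fin_single: "smult_fin a (Poly_Mapping.single x b) = Poly_Mapping.single x (a * b)"
  by (rule poly_mapping_eqI) (simp add: lookup_single when_def)
lemma smult_fin_word: "smult_fin a (word x) = Poly_Mapping.single x a"
  by (simp add: word_def smult_fin_single)
lemma smult_fin_conv_mult: "smult_fin a f = Poly_Mapping.single [] a * f" for f :: "'u list \<Rightarrow>\<^sub>0 complex"
  using mult_map_scale_conv_mult[of a f] by (simp add: smult_fin_def zero_list_def)

lemma keys_diff_subset: "Poly_Mapping.keys (f - g) \<subseteq> Poly_Mapping.keys f \<union> Poly_Mapping.keys (g :: 'a \<Rightarrow>\<^sub>0 complex)"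
  by (auto simp: in_keys_iff lookup_minus)
lemma keys_smult_fin: "Poly_Mapping.keys (smult_fin a f) \<subseteq> Poly_Mapping.keys f"
  by (auto simp: in_keys_iff)
lemma keys_word [simp]: "Poly_Mapping.keys (word x) = {x}"
  by (simp add: word_def)
lemma word_Nil: "word [] = 1"
  by (simp add: word_def single_one[symmetric] zero_list_def)
lemma word_mult: "word xs * word ys = word (xs @ ys)"
  by (simp add: word_def mult_single plus_list_def)

lemma poly_mapping_eq_sum:
  fixes f :: "'a \<Rightarrow>\<^sub>0 complex"
  assumes "finite S" "Poly_Mapping.keys f \<subseteq> S"
  shows "(\<Sum>x\<in>S. Poly_Mapping.single x (Poly_Mapping.lookup f x)) = f"
proof (rule poly_mapping_eqI)
  fix k
  have "Poly_Mapping.lookup (\<Sum>x\<in>S. Poly_Mapping.single x (Poly_Mapping.lookup f x)) k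
      = (\<Sum>x\<in>S. Poly_Mapping.lookup f x when x = k)"
    by (simp add: lookup_sum lookup_single)
  also have "\<dots> = Poly_Mapping.lookup f k"
    using assms by (auto simp: when_def sum.delta' in_keys_iff)
  finally show "Poly_Mapping.lookup (\<Sum>x\<in>S. Poly_Mapping.single x (Poly_Mapping.lookup f x)) k
      = Poly_Mapping.lookup f k" .
qed

lemma poly_mapping_span_induct [consumes 1, case_names zero add single]:
  fixes f :: "'a \<Rightarrow>\<^sub>0 complex"
  assumes "Poly_Mapping.keys f \<subseteq> S" "P 0" "\<And>f g. P f \<Longrightarrow> P g \<Longrightarrow> P (f + g)"
    "\<And>x a. x \<in> S \<Longrightarrow> P (Poly_Mapping.single x a)"
  shows "P f"
proof -
  have "P (\<Sum>x\<in>K. Poly_Mapping.single x (Poly_Mapping.lookup f x))" if "finite K" "K \<subseteq> S" for K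
    using that by (induction K) (auto intro: assms)
  from this[OF _ assms(1)] show ?thesis by (simp add: poly_mapping_eq_sum)
qed

lemma lin_ext_superset:
  assumes "finite S" "Poly_Mapping.keys f \<subseteq> S"
  shows "lin_ext \<phi> f = (\<Sum>x\<in>S. smult_fin (Poly_Mapping.lookup f x) (\<phi> x))"
  unfolding lin_ext_def by (rule sum.mono_neutral_left) (use assms in \<open>auto simp: in_keys_iff\<close>)

lemma lin_ext_add: "lin_ext \<phi> (f + g) = lin_ext \<phi> f + lin_ext \<phi> g"
proof -
  let ?S = "Poly_Mapping.keys f \<union> Poly_Mapping.keys g"
  show ?thesis
    by (simp add: lin_ext_superset[of ?S] keys_add lookup_add smult_fin_add_left sum.distrib)
qed
lemma lin_ext_zero [simp]: "lin_ext \<phi> 0 = 0" by (simp add: lin_ext_def)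
lemma lin_ext_smult: "lin_ext \<phi> (smult_fin a f) = smult_fin a (lin_ext \<phi> f)"
  by (simp add: lin_ext_superset[of "Poly_Mapping.keys f"] keys_smult_fin smult_fin_sum)
lemma lin_ext_single: "lin_ext \<phi> (Poly_Mapping.single x a) = smult_fin a (\<phi> x)"
  by (simp add: lin_ext_superset[of "{x}"])
lemma lin_ext_word [simp]: "lin_ext \<phi> (word x) = \<phi> x"
  by (simp add: word_def lin_ext_single)

definition fin_linear :: "(('a \<Rightarrow>\<^sub>0 complex) \<Rightarrow> ('b \<Rightarrow>\<^sub>0 complex)) \<Rightarrow> bool"
  where "fin_linear L \<longleftrightarrow> (\<forall>f g. L (f + g) = L f + L g) \<and> (\<forall>a f. L (smult_fin a f) = smult_fin a (L f))"

lemma fin_linear_lin_ext [simp, intro]: "fin_linear (lin_ext \<phi>)"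
  by (simp add: fin_linear_def lin_ext_add lin_ext_smult)
lemma fin_linear_add: "fin_linear L \<Longrightarrow> L (f + g) = L f + L g"
  by (simp add: fin_linear_def)
lemma fin_linear_smult: "fin_linear L \<Longrightarrow> L (smult_fin a f) = smult_fin a (L f)"
  by (simp add: fin_linear_def)
lemma fin_linear_zero: "fin_linear L \<Longrightarrow> L 0 = 0"
  using fin_linear_smult[of L 0 0] by simp
lemma fin_linear_minus: "fin_linear L \<Longrightarrow> L (- f) = - L f"
  using fin_linear_smult[of L "-1" f] by (simp add: smult_fin_minus_one)
lemma fin_linear_diff: "fin_linear L \<Longrightarrow> L (f - g) = L f - L g"
  using fin_linear_add[of L f "- g"] fin_linear_minus[of L g] by simp
lemma fin_linear_sum:
  assumes "fin_linear L"
  shows "L (sum f S) = (\<Sum>x\<in>S. L (f x))"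
  by (induction S rule: infinite_finite_induct) (simp_all add: fin_linear_zero[OF assms] fin_linear_add[OF assms])
lemma fin_linear_compose: "fin_linear L \<Longrightarrow> fin_linear M \<Longrightarrow> fin_linear (\<lambda>f. L (M f))"
  by (simp add: fin_linear_def)
lemma fin_linear_plus: "fin_linear L \<Longrightarrow> fin_linear M \<Longrightarrow> fin_linear (\<lambda>f. L f + M f)"
  by (simp add: fin_linear_def smult_fin_add algebra_simps)
lemma fin_linear_sum_map: "(\<And>i. i \<in> S \<Longrightarrow> fin_linear (L i)) \<Longrightarrow> fin_linear (\<lambda>f. \<Sum>i\<in>S. L i f)"
  by (simp add: fin_linear_def smult_fin_sum sum.distrib)
lemma fin_linear_id: "fin_linear (\<lambda>f. f)"
  by (simp add: fin_linear_def)
lemma fin_linear_single: "fin_linear L \<Longrightarrow> L (Poly_Mapping.single x a) = smult_fin a (L (word x))"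
  using fin_linear_smult[of L a "word x"] by (simp add: smult_fin_word)

lemma fin_linear_eqI:
  assumes "fin_linear L" "fin_linear M" "Poly_Mapping.keys f \<subseteq> S" "\<And>x. x \<in> S \<Longrightarrow> L (word x) = M (word x)"
  shows "L f = M f"
  using assms(3)
proof (induction rule: poly_mapping_span_induct)
  case zero
  show ?case by (simp add: fin_linear_zero[OF assms(1)] fin_linear_zero[OF assms(2)])
next
  case (add f g)
  then show ?case by (simp add: fin_linear_add[OF assms(1)] fin_linear_add[OF assms(2)])
next
  case (single x a)
  then show ?case by (simp add: fin_linear_single[OF assms(1)] fin_linear_single[OF assms(2)] assms(4))
qed

lemma smult_fin_mult_left: "smult_fin a f * g = smult_fin a (f * g)" for f g :: "'u list \<Rightarrow>\<^sub>0 complex"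
  by (simp add: smult_fin_conv_mult mult.assoc)
lemma single_Nil_commute:
  fixes f :: "'u list \<Rightarrow>\<^sub>0 complex"
  shows "f * Poly_Mapping.single [] a = Poly_Mapping.single [] a * f"
  using subset_UNIV[of "Poly_Mapping.keys f"]
  by (induction rule: poly_mapping_span_induct) (auto simp: algebra_simps mult_single plus_list_def)
lemma smult_fin_mult_right: "f * smult_fin a g = smult_fin a (f * g)" for f g :: "'u list \<Rightarrow>\<^sub>0 complex"
  by (simp add: smult_fin_conv_mult mult.assoc[symmetric] single_Nil_commute)

lemma fin_linear_mult_left: "fin_linear (\<lambda>f. (g :: 'u list \<Rightarrow>\<^sub>0 complex) * f)"
  by (simp add: fin_linear_def distrib_left smult_fin_mult_right)
lemma fin_linear_mult_right: "fin_linear (\<lambda>f. f * (g :: 'u list \<Rightarrow>\<^sub>0 complex))"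
  by (simp add: fin_linear_def distrib_right smult_fin_mult_left)

lemma keys_mult_lists:
  assumes "Poly_Mapping.keys f \<subseteq> A" "Poly_Mapping.keys g \<subseteq> B" "\<And>x y. x \<in> A \<Longrightarrow> y \<in> B \<Longrightarrow> x @ y \<in> D"
  shows "Poly_Mapping.keys (f * g) \<subseteq> D"
  using keys_mult[of f g] assms by (fastforce simp: plus_list_def)

lemma keys_sum_subset:
  assumes "\<And>x. x \<in> S \<Longrightarrow> Poly_Mapping.keys (f x) \<subseteq> A"
  shows "Poly_Mapping.keys (sum f S) \<subseteq> A"
  using keys_sum[of f S] assms by blast
lemma keys_lin_ext:
  assumes "\<And>x. x \<in> Poly_Mapping.keys f \<Longrightarrow> Poly_Mapping.keys (\<phi> x) \<subseteq> A"
  shows "Poly_Mapping.keys (lin_ext \<phi> f) \<subseteq> A"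
  unfolding lin_ext_def by (rule keys_sum_subset, rule subset_trans[OF keys_smult_fin], rule assms)

text \<open>
  The product of the free algebra is defined by extending concatenation bilinearly, which is convolution.
\<close>

lemma free_algebra_mult: "mult (free_algebra U) f g = f * g"
proof -
  have 1: "lin_ext (\<lambda>ys. word (xs @ ys)) g = word xs * g" for xs
    by (rule fin_linear_eqI[OF fin_linear_lin_ext fin_linear_mult_left subset_UNIV]) (simp add: word_mult)
  have "lin_ext (\<lambda>xs. word xs * g) f = f * g"
    by (rule fin_linear_eqI[OF fin_linear_lin_ext fin_linear_mult_right subset_UNIV]) simp
  with 1 show ?thesis by (simp add: free_algebra_def)
qed

lemma free_algebra_simps [simp]:
  "carrier (free_algebra U) = {f. Poly_Mapping.keys f \<subseteq> lists U}"
  "one (free_algebra U) = 1" "zero (free_algebra U) = 0" "add (free_algebra U) f g = f + g"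
  by (simp_all add: free_algebra_def word_Nil)

lemma ring_free_algebra: "ring (free_algebra U)"
proof (rule ringI)
  have add: "Poly_Mapping.keys (f + g) \<subseteq> lists U"
    if "Poly_Mapping.keys f \<subseteq> lists U" "Poly_Mapping.keys g \<subseteq> lists U" for f g :: "'a list \<Rightarrow>\<^sub>0 complex"
    using keys_add[of f g] that by blast
  have mul: "Poly_Mapping.keys (f * g) \<subseteq> lists U"
    if "Poly_Mapping.keys f \<subseteq> lists U" "Poly_Mapping.keys g \<subseteq> lists U" for f g :: "'a list \<Rightarrow>\<^sub>0 complex"
    using keys_mult_lists[OF that] by (simp add: append_in_lists_conv)
  show "abelian_group (free_algebra U)"
  proof (rule abelian_groupI)
    fix x assume "x \<in> carrier (free_algebra U)"
    then have "- x \<in> carrier (free_algebra U)" "- x \<oplus>\<^bsub>free_algebra U\<^esub> x = \<zero>\<^bsub>free_algebra U\<^esub>" by simp_all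
    then show "\<exists>y\<in>carrier (free_algebra U). y \<oplus>\<^bsub>free_algebra U\<^esub> x = \<zero>\<^bsub>free_algebra U\<^esub>" by blast
  qed (simp_all add: add add.assoc add.commute)
  show "Group.monoid (free_algebra U)"
    by (rule monoidI) (simp_all add: mul free_algebra_mult mult.assoc zero_list_def)
qed (simp_all add: free_algebra_mult distrib_left distrib_right)


section \<open>Reduced expressions and inversions\<close>

abbreviation pinv :: "(nat \<Rightarrow> nat) \<Rightarrow> nat \<Rightarrow> nat" where "pinv \<equiv> inv_into UNIV"
abbreviation tprod :: "nat list \<Rightarrow> nat \<Rightarrow> nat" where "tprod \<equiv> transposition_product"

definition simple_word :: "nat \<Rightarrow> nat list \<Rightarrow> bool"
  where "simple_word n is \<longleftrightarrow> (\<forall>i \<in> set is. Suc i < n)"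

lemma simple_word_simps [simp]:
  "simple_word n []" "simple_word n (i # is) \<longleftrightarrow> Suc i < n \<and> simple_word n is"
  "simple_word n (is @ js) \<longleftrightarrow> simple_word n is \<and> simple_word n js"
  by (auto simp: simple_word_def)

lemma tprod_simps:
  "tprod [] = id" "tprod (i # is) = Transposition.transpose i (Suc i) \<circ> tprod is"
  by (simp_all add: transposition_product_def)

lemma tprod_append: "tprod (is @ js) = tprod is \<circ> tprod js"
  by (induction "is") (simp_all add: tprod_simps comp_assoc)

lemma tprod_permutes: "simple_word n is \<Longrightarrow> tprod is permutes {..<n}"
  by (induction "is") (auto intro!: permutes_compose permutes_swap_id simp: permutes_id tprod_simps)

lemma inv_transpose_comp:
  assumes "\<pi> permutes S"
  shows "pinv (Transposition.transpose a b \<circ> \<pi>) = pinv \<pi> \<circ> Transposition.transpose a b"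
  using assms by (simp add: o_inv_distrib permutes_bij)

text \<open>
  The word is read from the right, as the transpositions are composed: every letter exchanges two values that
  are still in their natural order. Such words are the reduced ones.
\<close>

fun ascending :: "nat list \<Rightarrow> bool" where
  "ascending [] \<longleftrightarrow> True"
| "ascending (k # is) \<longleftrightarrow> ascending is \<and> pinv (tprod is) k < pinv (tprod is) (Suc k)"

definition inversions :: "nat \<Rightarrow> (nat \<Rightarrow> nat) \<Rightarrow> (nat \<times> nat) set"
  where "inversions n \<pi> = {(i, j). i < j \<and> j < n \<and> \<pi> j < \<pi> i}"

lemma finite_inversions [simp]: "finite (inversions n \<pi>)"
  by (rule finite_subset[of _ "{..<n} \<times> {..<n}"]) (auto simp: inversions_def)

lemma inversions_id [simp]: "inversions n id = {}" "inversions n (\<lambda>x. x) = {}"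
  by (auto simp: inversions_def)

lemma transpose_less_iff:
  assumes "x \<noteq> y"
  shows "Transposition.transpose k (Suc k) x < Transposition.transpose k (Suc k) y \<longleftrightarrow>
    x < y \<and> \<not> (x = k \<and> y = Suc k) \<or> x = Suc k \<and> y = k"
  using assms by (auto simp: Transposition.transpose_def)

lemma card_inversions_transpose_less:
  assumes \<pi>: "\<pi> permutes {..<n}" and k: "Suc k < n" and less: "pinv \<pi> k < pinv \<pi> (Suc k)"
  shows "card (inversions n (Transposition.transpose k (Suc k) \<circ> \<pi>)) = Suc (card (inversions n \<pi>))"
proof -
  define a b where "a = pinv \<pi> k" and "b = pinv \<pi> (Suc k)"
  have \<pi>_iff: "\<pi> x = k \<longleftrightarrow> x = a" "\<pi> x = Suc k \<longleftrightarrow> x = b" for x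
    unfolding a_def b_def by (metis permutes_inv_eq[OF \<pi>])+
  have "b < n"
    using permutes_in_image[OF permutes_inv[OF \<pi>], of "Suc k"] k by (simp add: b_def)
  have inj: "\<pi> x = \<pi> y \<longleftrightarrow> x = y" for x y
    using \<pi> by (auto dest: permutes_inj injD)
  have "inversions n (Transposition.transpose k (Suc k) \<circ> \<pi>) = insert (a, b) (inversions n \<pi>)"
  proof (rule Set.set_eqI)
    fix z :: "nat \<times> nat"
    obtain i j where z: "z = (i, j)" by (cases z)
    have "\<not> (\<pi> j = k \<and> \<pi> i = Suc k)" if "i < j"
      using that less \<pi>_iff unfolding a_def b_def by (metis order_less_asym)
    moreover have "\<pi> j = Suc k \<and> \<pi> i = k \<longleftrightarrow> (i, j) = (a, b)"
      using \<pi>_iff by auto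
    moreover have "a < b" using less by (simp add: a_def b_def)
    ultimately have "i < j \<and> j < n \<and> Transposition.transpose k (Suc k) (\<pi> j) < Transposition.transpose k (Suc k) (\<pi> i)
        \<longleftrightarrow> (i, j) = (a, b) \<or> i < j \<and> j < n \<and> \<pi> j < \<pi> i"
      using transpose_less_iff[of "\<pi> j" "\<pi> i" k] inj[of j i] \<open>b < n\<close> by auto
    then show "z \<in> inversions n (Transposition.transpose k (Suc k) \<circ> \<pi>) \<longleftrightarrow> z \<in> insert (a, b) (inversions n \<pi>)"
      by (auto simp: z inversions_def)
  qed
  moreover have "(a, b) \<notin> inversions n \<pi>"
    using \<pi>_iff(1)[of a] \<pi>_iff(2)[of b] by (auto simp: inversions_def)
  ultimately show ?thesis by simp
qed

lemma card_inversions_transpose_greater: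
  assumes \<pi>: "\<pi> permutes {..<n}" and k: "Suc k < n" and gt: "pinv \<pi> (Suc k) < pinv \<pi> k"
  shows "card (inversions n \<pi>) = Suc (card (inversions n (Transposition.transpose k (Suc k) \<circ> \<pi>)))"
proof -
  let ?s = "Transposition.transpose k (Suc k)"
  have "?s \<circ> \<pi> permutes {..<n}"
    using \<pi> k by (intro permutes_compose permutes_swap_id) auto
  moreover have "pinv (?s \<circ> \<pi>) k < pinv (?s \<circ> \<pi>) (Suc k)"
    using gt by (simp add: inv_transpose_comp[OF \<pi>])
  ultimately have "card (inversions n (?s \<circ> (?s \<circ> \<pi>))) = Suc (card (inversions n (?s \<circ> \<pi>)))"
    using k by (intro card_inversions_transpose_less)
  then show ?thesis by (simp add: o_assoc)
qed

lemma inv_tprod_neq: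
  assumes "\<pi> permutes S" shows "pinv \<pi> k \<noteq> pinv \<pi> (Suc k)"
  using permutes_inj[OF permutes_inv[OF assms]] by (metis injD n_not_Suc_n)

text \<open>
  A letter changes the number of inversions by one, so a word is at least as long as there are
  inversions, and equality forces every letter to create one.
\<close>

lemma inversions_le_length:
  assumes "simple_word n is"
  shows "card (inversions n (tprod is)) \<le> length is"
    and "length is \<le> card (inversions n (tprod is)) \<Longrightarrow> ascending is"
proof -
  have "card (inversions n (tprod is)) \<le> length is \<and>
      (length is \<le> card (inversions n (tprod is)) \<longrightarrow> ascending is)"
    using assms
  proof (induction "is")
    case Nil
    then show ?case by (simp add: tprod_simps)
  next
    case (Cons k "is")
    then have p: "tprod is permutes {..<n}" by (simp add: tprod_permutes)
    then consider "pinv (tprod is) k < pinv (tprod is) (Suc k)" | "pinv (tprod is) (Suc k) < pinv (tprod is) k"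
      using inv_tprod_neq[of "tprod is" _ k] by (meson linorder_neqE_nat)
    then show ?case
    proof cases
      case 1
      then show ?thesis using card_inversions_transpose_less[OF p, of k] Cons unfolding tprod_simps(2) by (simp del: o_apply)
    next
      case 2
      then show ?thesis using card_inversions_transpose_greater[OF p, of k] Cons unfolding tprod_simps(2) by (simp del: o_apply)
    qed
  qed
  then show "card (inversions n (tprod is)) \<le> length is"
    "length is \<le> card (inversions n (tprod is)) \<Longrightarrow> ascending is" by auto
qed

lemma increasing_permutation_id:
  assumes \<sigma>: "\<sigma> permutes {..<n}" and inc: "\<And>k. Suc k < n \<Longrightarrow> \<sigma> k < \<sigma> (Suc k)"
  shows "\<sigma> = id"
proof (rule permutes_natset_ge[OF \<sigma>])
  have "k < n \<Longrightarrow> k \<le> \<sigma> k" for k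
  proof (induction k)
    case (Suc k)
    then show ?case using inc[of k] by simp
  qed simp
  then show "\<forall>i\<in>{..<n}. i \<le> \<sigma> i" by simp
qed

text \<open>
  Bubble sort: while the inverse permutation has a descent, exchanging the two values removes an inversion;
  without descents it is increasing, hence the identity.
\<close>

lemma exists_expression_of_inversion_length:
  assumes "\<pi> permutes {..<n}"
  shows "\<exists>is. simple_word n is \<and> tprod is = \<pi> \<and> length is = card (inversions n \<pi>)"
  using assms
proof (induction "card (inversions n \<pi>)" arbitrary: \<pi> rule: less_induct)
  case less
  show ?case
  proof (cases "\<exists>k. Suc k < n \<and> pinv \<pi> (Suc k) < pinv \<pi> k")
    case True
    then obtain k where k: "Suc k < n" "pinv \<pi> (Suc k) < pinv \<pi> k" by blast
    let ?s = "Transposition.transpose k (Suc k)"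
    have c: "card (inversions n \<pi>) = Suc (card (inversions n (?s \<circ> \<pi>)))"
      using card_inversions_transpose_greater[OF less.prems k] .
    moreover have "?s \<circ> \<pi> permutes {..<n}"
      using less.prems k by (intro permutes_compose permutes_swap_id) auto
    ultimately obtain "is" where "is": "simple_word n is" "tprod is = ?s \<circ> \<pi>"
      "length is = card (inversions n (?s \<circ> \<pi>))"
      using less.hyps[of "?s \<circ> \<pi>"] by auto
    then show ?thesis using c k by (intro exI[of _ "k # is"]) (simp add: tprod_simps o_assoc)
  next
    case False
    then have "pinv \<pi> k < pinv \<pi> (Suc k)" if "Suc k < n" for k
      using that inv_tprod_neq[OF less.prems, of k] by (meson linorder_neqE_nat)
    then have "pinv \<pi> = id"
      by (rule increasing_permutation_id[OF permutes_inv[OF less.prems]])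
    then have "\<pi> = id" using permutes_inv_inv[OF less.prems] by (metis inv_id)
    then show ?thesis by (intro exI[of _ "[]"]) (simp add: tprod_simps)
  qed
qed

text \<open>
  The expression selected in \<^const>\<open>braid_perm\<close> is only known to be of minimal length; this turns
  minimality into the step-by-step condition on which inductions run.
\<close>

lemma chosen_reduced_expression:
  assumes \<pi>: "\<pi> permutes {..<n}"
  defines "w \<equiv> (SOME is. reduced_expression n \<pi> is)"
  shows "simple_word n w" "tprod w = \<pi>" "ascending w"
proof -
  have sw: "set is \<subseteq> {i. Suc i < n} \<longleftrightarrow> simple_word n is" for "is"
    by (auto simp: simple_word_def)
  obtain v where v: "simple_word n v" "tprod v = \<pi>" "length v = card (inversions n \<pi>)"
    using exists_expression_of_inversion_length[OF \<pi>] by blast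
  then have "reduced_expression n \<pi> v"
    using inversions_le_length(1) by (force simp: reduced_expression_def sw)
  then have w: "reduced_expression n \<pi> w"
    unfolding w_def by (rule someI)
  then show "simple_word n w" "tprod w = \<pi>" by (auto simp: reduced_expression_def sw)
  moreover have "length w \<le> length v"
    using w v by (auto simp: reduced_expression_def sw)
  ultimately show "ascending w"
    using inversions_le_length(2)[of n w] v by simp
qed


section \<open>Set-theoretic braidings from self-distributive operations\<close>

text \<open>
  Self-distributivity is the braid equation for the exchange \<open>(x, y) \<mapsto> (x \<rhd> y, x)\<close>. In a Yetter-Drinfeld
  module the homogeneous vectors carry such an operation, \<open>y\<close> being moved by the degree of \<open>x\<close>.
\<close>

locale shelf =
  fixes op :: "'x \<Rightarrow> 'x \<Rightarrow> 'x" (infixr "\<rhd>" 70) and S :: "'x set"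
  assumes op_closed: "x \<in> S \<Longrightarrow> y \<in> S \<Longrightarrow> x \<rhd> y \<in> S"
    and op_distrib: "x \<in> S \<Longrightarrow> y \<in> S \<Longrightarrow> z \<in> S \<Longrightarrow> x \<rhd> (y \<rhd> z) = (x \<rhd> y) \<rhd> (x \<rhd> z)"
begin

definition swap_at :: "nat \<Rightarrow> 'x list \<Rightarrow> 'x list"
  where "swap_at i xs = xs[i := xs ! i \<rhd> xs ! Suc i, Suc i := xs ! i]"

definition swaps :: "nat list \<Rightarrow> 'x list \<Rightarrow> 'x list"
  where "swaps is xs = foldr swap_at is xs"

text \<open>
  When \<open>j\<close> is the letter that ends at position \<open>k\<close>, these are the strands that cross over it, in their
  original order.
\<close>

definition crossed :: "(nat \<Rightarrow> nat) \<Rightarrow> 'x list \<Rightarrow> nat \<Rightarrow> nat \<Rightarrow> 'x list"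
  where "crossed \<pi> xs k j = map ((!) xs) (filter (\<lambda>i. k < \<pi> i) [0..<j])"

text \<open>
  The effect of the positive braid over \<open>\<pi>\<close>, without reference to a word for it: a letter arrives at the
  position given by \<open>\<pi>\<close>, acted upon by the letters that cross over it, taken as they were at the start.
\<close>

definition braid_result :: "(nat \<Rightarrow> nat) \<Rightarrow> 'x list \<Rightarrow> 'x list"
  where "braid_result \<pi> xs =
    map (\<lambda>k. foldr (\<rhd>) (crossed \<pi> xs k (pinv \<pi> k)) (xs ! pinv \<pi> k)) [0..<length xs]"

lemma swaps_simps: "swaps [] xs = xs" "swaps (i # is) xs = swap_at i (swaps is xs)"
  by (simp_all add: swaps_def)

lemma swaps_append: "swaps (is @ js) xs = swaps is (swaps js xs)"
  by (simp add: swaps_def)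

lemma length_swap_at [simp]: "length (swap_at i xs) = length xs"
  by (simp add: swap_at_def)
lemma length_swaps [simp]: "length (swaps is xs) = length xs"
  by (induction "is") (simp_all add: swaps_simps)
lemma length_braid_result [simp]: "length (braid_result \<pi> xs) = length xs"
  by (simp add: braid_result_def)

lemma set_swap_at: "set xs \<subseteq> S \<Longrightarrow> Suc i < length xs \<Longrightarrow> set (swap_at i xs) \<subseteq> S"
  unfolding swap_at_def
  by (intro subset_trans[OF set_update_subset_insert] insert_subsetI op_closed) (auto intro: op_closed)
lemma set_swaps: "set xs \<subseteq> S \<Longrightarrow> simple_word (length xs) is \<Longrightarrow> set (swaps is xs) \<subseteq> S"
  by (induction "is") (simp_all add: swaps_simps set_swap_at)

lemma foldr_op_closed: "set ys \<subseteq> S \<Longrightarrow> x \<in> S \<Longrightarrow> foldr (\<rhd>) ys x \<in> S"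
  by (induction ys) (auto intro: op_closed)

lemma foldr_op_distrib:
  "set ys \<subseteq> S \<Longrightarrow> x \<in> S \<Longrightarrow> z \<in> S \<Longrightarrow> foldr (\<rhd>) ys (x \<rhd> z) = foldr (\<rhd>) ys x \<rhd> foldr (\<rhd>) ys z"
  by (induction ys) (simp_all add: op_distrib foldr_op_closed)

text \<open>
  Let \<open>a < b\<close> be the letters that sit at \<open>k\<close> and \<open>k + 1\<close>. The letters \<open>A\<close> that have crossed \<open>a\<close> are
  a prefix of those that have crossed \<open>b\<close>, say \<open>A B\<close>, and the exchange puts \<open>a\<close> between \<open>A\<close> and \<open>B\<close>.
  Self-distributivity gives \<open>(A \<rhd> a) \<rhd> (A \<rhd> (B \<rhd> b)) = A \<rhd> (a \<rhd> (B \<rhd> b))\<close>, which is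
  the required letter.
\<close>

lemma swap_at_braid_result:
  assumes \<pi>: "\<pi> permutes {..<length xs}" and xs: "set xs \<subseteq> S" and k: "Suc k < length xs"
    and less: "pinv \<pi> k < pinv \<pi> (Suc k)"
  shows "swap_at k (braid_result \<pi> xs) = braid_result (Transposition.transpose k (Suc k) \<circ> \<pi>) xs"
proof -
  let ?s = "Transposition.transpose k (Suc k)"
  define a b where "a = pinv \<pi> k" and "b = pinv \<pi> (Suc k)"
  have ab: "a < b" using less by (simp add: a_def b_def)
  have \<pi>_iff: "\<pi> x = k \<longleftrightarrow> x = a" "\<pi> x = Suc k \<longleftrightarrow> x = b" for x
    unfolding a_def b_def by (metis permutes_inv_eq[OF \<pi>])+
  have b: "b < length xs"
    using permutes_in_image[OF permutes_inv[OF \<pi>], of "Suc k"] k by (simp add: b_def)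
  have mem: "xs ! i \<in> S" if "i < length xs" for i using xs that by auto
  have inv: "pinv (?s \<circ> \<pi>) l = pinv \<pi> (?s l)" for l
    by (simp add: inv_transpose_comp[OF \<pi>])
  have crossed_b: "crossed (?s \<circ> \<pi>) xs k b = crossed \<pi> xs k a @ xs ! a # map ((!) xs) (filter (\<lambda>i. Suc k < \<pi> i) [Suc a..<b])"
  proof -
    have "[0..<b] = [0..<a] @ a # [Suc a..<b]"
      using upt_add_eq_append[of 0 a "b - a"] ab by (simp add: upt_conv_Cons)
    moreover have "filter (\<lambda>i. k < ?s (\<pi> i)) [0..<a] = filter (\<lambda>i. k < \<pi> i) [0..<a]"
    proof (rule filter_cong[OF refl])
      fix i assume "i \<in> set [0..<a]"
      then show "k < ?s (\<pi> i) \<longleftrightarrow> k < \<pi> i"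
        using ab \<pi>_iff[of i] by (auto simp: Transposition.transpose_def)
    qed
    moreover have "filter (\<lambda>i. k < ?s (\<pi> i)) [Suc a..<b] = filter (\<lambda>i. Suc k < \<pi> i) [Suc a..<b]"
    proof (rule filter_cong[OF refl])
      fix i assume "i \<in> set [Suc a..<b]"
      then show "k < ?s (\<pi> i) \<longleftrightarrow> Suc k < \<pi> i"
        using \<pi>_iff[of i] by (auto simp: Transposition.transpose_def)
    qed
    moreover have "k < ?s (\<pi> a)"
      using \<pi>_iff(1)[of a] by simp
    ultimately show ?thesis
      by (simp add: crossed_def)
  qed
  have crossed_b': "crossed \<pi> xs (Suc k) b = crossed \<pi> xs k a @ map ((!) xs) (filter (\<lambda>i. Suc k < \<pi> i) [Suc a..<b])"
  proof -
    have "[0..<b] = [0..<a] @ a # [Suc a..<b]"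
      using upt_add_eq_append[of 0 a "b - a"] ab by (simp add: upt_conv_Cons)
    moreover have "filter (\<lambda>i. Suc k < \<pi> i) [0..<a] = filter (\<lambda>i. k < \<pi> i) [0..<a]"
    proof (rule filter_cong[OF refl])
      fix i assume "i \<in> set [0..<a]"
      then show "Suc k < \<pi> i \<longleftrightarrow> k < \<pi> i" using ab \<pi>_iff[of i] by auto
    qed
    moreover have "\<not> Suc k < \<pi> a"
      using \<pi>_iff(1)[of a] by simp
    ultimately show ?thesis
      by (simp add: crossed_def)
  qed
  have crossed_a: "crossed (?s \<circ> \<pi>) xs (Suc k) a = crossed \<pi> xs k a"
  proof -
    have "filter (\<lambda>i. Suc k < ?s (\<pi> i)) [0..<a] = filter (\<lambda>i. k < \<pi> i) [0..<a]"
    proof (rule filter_cong[OF refl])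
      fix i assume "i \<in> set [0..<a]"
      then show "Suc k < ?s (\<pi> i) \<longleftrightarrow> k < \<pi> i"
        using ab \<pi>_iff[of i] by (auto simp: Transposition.transpose_def)
    qed
    then show ?thesis by (simp add: crossed_def)
  qed
  have crossed_l: "crossed (?s \<circ> \<pi>) xs l j = crossed \<pi> xs l j" if "l \<noteq> k" "l \<noteq> Suc k" for l j
  proof -
    have "l < ?s m \<longleftrightarrow> l < m" for m
      using that by (auto simp: Transposition.transpose_def)
    then show ?thesis by (simp add: crossed_def)
  qed
  let ?A = "crossed \<pi> xs k a"
  let ?B = "map ((!) xs) (filter (\<lambda>i. Suc k < \<pi> i) [Suc a..<b])"
  have A: "set ?A \<subseteq> S" and B: "set ?B \<subseteq> S"
    using xs ab b by (auto simp: crossed_def)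
  show ?thesis
  proof (rule nth_equalityI)
    fix l assume l: "l < length (swap_at k (braid_result \<pi> xs))"
    then have l: "l < length xs" by simp
    consider "l = k" | "l = Suc k" | "l \<noteq> k" "l \<noteq> Suc k" by blast
    then show "swap_at k (braid_result \<pi> xs) ! l = braid_result (?s \<circ> \<pi>) xs ! l"
    proof cases
      case 1
      have "swap_at k (braid_result \<pi> xs) ! l = foldr (\<rhd>) ?A (xs ! a) \<rhd> foldr (\<rhd>) (?A @ ?B) (xs ! b)"
        using k 1 by (simp add: swap_at_def braid_result_def a_def[symmetric] b_def[symmetric] crossed_b' del: map_map)
      also have "\<dots> = foldr (\<rhd>) ?A (xs ! a \<rhd> foldr (\<rhd>) ?B (xs ! b))"
        using A B mem ab b by (simp add: foldr_op_distrib foldr_op_closed)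
      finally show ?thesis
        using k 1 by (simp add: braid_result_def inv b_def[symmetric] crossed_b)
    next
      case 2
      then show ?thesis
        using k by (simp add: swap_at_def braid_result_def inv a_def[symmetric] crossed_a)
    next
      case 3
      then show ?thesis
        using l k by (simp add: swap_at_def braid_result_def inv crossed_l Transposition.transpose_def)
    qed
  qed simp
qed

lemma braid_result_id: "braid_result id xs = xs"
  by (rule nth_equalityI) (auto simp: braid_result_def crossed_def filter_empty_conv inv_id)

text \<open>
  The right-hand side depends on the permutation only: all reduced expressions act in the same way.
\<close>

proposition swaps_eq_braid_result:
  assumes "simple_word (length xs) is" "ascending is" "set xs \<subseteq> S"
  shows "swaps is xs = braid_result (tprod is) xs"
  using assms(1,2)
proof (induction "is")
  case Nil
  show ?case unfolding tprod_simps(1) swaps_simps braid_result_id ..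
next
  case (Cons k "is")
  then show ?case
    using swap_at_braid_result[of "tprod is" xs k] tprod_permutes[of "length xs" "is"] assms(3)
    unfolding tprod_simps(2) by (simp add: swaps_simps del: o_apply)
qed

lemma swap_at_append: "Suc i < length xs \<Longrightarrow> swap_at i (xs @ ys) = swap_at i xs @ ys"
  by (simp add: swap_at_def nth_append list_update_append)
lemma swaps_append_right:
  "simple_word (length xs) is \<Longrightarrow> swaps is (xs @ ys) = swaps is xs @ ys"
  by (induction "is") (simp_all add: swaps_simps swap_at_append)
lemma swap_at_Cons: "swap_at (Suc i) (x # xs) = x # swap_at i xs"
  by (simp add: swap_at_def)
lemma swaps_Cons: "swaps (map Suc is) (x # xs) = x # swaps is xs"
  by (induction "is") (simp_all add: swaps_simps swap_at_Cons)

lemma swaps_move_right: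
  "swaps (rev [length ps..<length ps + length qs]) (ps @ x # qs) = ps @ map (\<lambda>q. x \<rhd> q) qs @ [x]"
proof (induction qs rule: rev_induct)
  case Nil
  then show ?case by (simp add: swaps_simps)
next
  case (snoc q qs)
  have "simple_word (length (ps @ x # qs)) (rev [length ps..<length ps + length qs])"
    by (auto simp: simple_word_def)
  then have "swaps (rev [length ps..<length ps + length qs]) ((ps @ x # qs) @ [q]) = (ps @ map (\<lambda>q. x \<rhd> q) qs @ [x]) @ [q]"
    by (simp only: swaps_append_right snoc.IH)
  moreover have "rev [length ps..<length ps + length (qs @ [q])] = (length ps + length qs) # rev [length ps..<length ps + length qs]"
    by simp
  ultimately show ?case
    by (simp add: swaps_simps swap_at_def nth_append list_update_append)
qed
end

definition cycle_up :: "nat \<Rightarrow> nat \<Rightarrow> nat \<Rightarrow> nat"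
  where "cycle_up j n x = (if x = j then n else if j < x \<and> x \<le> n then x - 1 else x)"
definition cycle_down :: "nat \<Rightarrow> nat \<Rightarrow> nat \<Rightarrow> nat"
  where "cycle_down j n x = (if x = n then j else if j \<le> x \<and> x < n then Suc x else x)"

lemma tprod_rev_upt: "j \<le> n \<Longrightarrow> tprod (rev [j..<n]) = cycle_up j n"
proof (induction n rule: dec_induct)
  case base
  show ?case by (auto simp: tprod_simps cycle_up_def fun_eq_iff)
next
  case (step n)
  then have e: "rev [j..<Suc n] = n # rev [j..<n]" by simp
  show ?case unfolding e tprod_simps(2) step.IH using step.hyps
    by (auto simp: cycle_up_def fun_eq_iff Transposition.transpose_def)
qed

lemma tprod_upt: "j \<le> n \<Longrightarrow> tprod [j..<n] = cycle_down j n"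
proof (induction j rule: inc_induct)
  case base
  show ?case by (auto simp: tprod_simps cycle_down_def fun_eq_iff)
next
  case (step m)
  then have e: "[m..<n] = m # [Suc m..<n]" by (simp add: upt_conv_Cons)
  show ?case unfolding e tprod_simps(2) step.IH using step.hyps
    by (auto simp: cycle_down_def fun_eq_iff Transposition.transpose_def)
qed

lemma cycle_up_down: "j \<le> n \<Longrightarrow> cycle_up j n \<circ> cycle_down j n = id" "j \<le> n \<Longrightarrow> cycle_down j n \<circ> cycle_up j n = id"
  by (auto simp: cycle_up_def cycle_down_def fun_eq_iff)

lemma inv_cycle_up: "j \<le> n \<Longrightarrow> pinv (cycle_up j n) = cycle_down j n"
  and inv_cycle_down: "j \<le> n \<Longrightarrow> pinv (cycle_down j n) = cycle_up j n"
  using cycle_up_down by (blast intro: inv_unique_comp)+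

lemma simple_word_upt: "simple_word (Suc n) [j..<n]" "simple_word (Suc n) (rev [j..<n])"
  "j \<le> n \<Longrightarrow> simple_word (Suc n) (rev [0..<j])"
  by (auto simp: simple_word_def)
lemma simple_word_mono: "simple_word n is \<Longrightarrow> n \<le> m \<Longrightarrow> simple_word m is"
  by (auto simp: simple_word_def)
lemma simple_word_map_Suc: "simple_word n is \<Longrightarrow> simple_word (Suc n) (map Suc is)"
  by (auto simp: simple_word_def)

lemma bij_tprod: "bij (tprod is)"
proof -
  have "simple_word (Suc (Suc (Max (insert 0 (set is))))) is" 
    unfolding simple_word_def by (auto simp: less_Suc_eq_le)
  then show ?thesis by (metis tprod_permutes permutes_bij)
qed

lemma inv_tprod_append: "pinv (tprod (is @ js)) = pinv (tprod js) \<circ> pinv (tprod is)"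
  unfolding tprod_append by (rule o_inv_distrib[OF bij_tprod bij_tprod])

text \<open>
  Exchanges among the first \<open>n\<close> values stay ascending after a permutation whose inverse is increasing
  on these values.
\<close>

lemma ascending_append:
  assumes "simple_word n is" "ascending is" "ascending js"
    "\<And>x y. x < y \<Longrightarrow> y < n \<Longrightarrow> pinv (tprod js) x < pinv (tprod js) y"
  shows "ascending (is @ js)"
  using assms(1,2)
proof (induction "is")
  case Nil
  then show ?case using assms(3) by simp
next
  case (Cons k "is")
  have p: "pinv (tprod is) permutes {..<n}"
    using Cons.prems by (intro permutes_inv tprod_permutes) simp
  have "pinv (tprod is) (Suc k) < n"
    using permutes_in_image[OF p, of "Suc k"] Cons.prems by simp
  then have "pinv (tprod (is @ js)) k < pinv (tprod (is @ js)) (Suc k)"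
    using Cons.prems unfolding inv_tprod_append by (simp add: assms(4))
  then show ?case using Cons by simp
qed

lemma ascending_rev_upt: "j \<le> n \<Longrightarrow> ascending (rev [j..<n])"
proof (induction n rule: dec_induct)
  case (step n)
  then have "pinv (tprod (rev [j..<n])) n < pinv (tprod (rev [j..<n])) (Suc n)"
    by (simp add: tprod_rev_upt inv_cycle_up cycle_down_def)
  then show ?case using step by simp
qed simp

lemma ascending_move_last_first:
  assumes "simple_word n is" "ascending is" "j \<le> n"
  shows "ascending (is @ rev [j..<n])"
  by (rule ascending_append[OF assms(1,2) ascending_rev_upt[OF assms(3)]])
    (use assms(3) in \<open>auto simp: tprod_rev_upt inv_cycle_up cycle_down_def\<close>)

lemma ascending_insert_last:
  assumes "simple_word n is" "ascending is" "j \<le> n"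
  shows "ascending ([j..<n] @ is)"
  using assms(3)
proof (induction j rule: inc_induct)
  case base
  then show ?case using assms by simp
next
  case (step k)
  have p: "pinv (tprod is) permutes {..<n}"
    using assms by (intro permutes_inv tprod_permutes)
  have "pinv (tprod is) k < n" using permutes_in_image[OF p, of k] step by simp
  moreover have "pinv (tprod is) n = n" using permutes_not_in[OF p] by simp
  ultimately have "pinv (tprod ([Suc k..<n] @ is)) k < pinv (tprod ([Suc k..<n] @ is)) (Suc k)"
    using step unfolding inv_tprod_append by (simp add: tprod_upt inv_cycle_down cycle_up_def)
  moreover have "[k..<n] = k # [Suc k..<n]" using step by (simp add: upt_conv_Cons)
  ultimately show ?case using step.IH by simp
qed

definition shift_perm :: "(nat \<Rightarrow> nat) \<Rightarrow> nat \<Rightarrow> nat"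
  where "shift_perm \<pi> x = (case x of 0 \<Rightarrow> 0 | Suc y \<Rightarrow> Suc (\<pi> y))"

lemma shift_perm_simps [simp]: "shift_perm \<pi> 0 = 0" "shift_perm \<pi> (Suc x) = Suc (\<pi> x)"
  by (simp_all add: shift_perm_def)

lemma tprod_map_Suc: "tprod (map Suc is) = shift_perm (tprod is)"
proof (induction "is")
  case Nil
  show ?case by (auto simp: tprod_simps shift_perm_def fun_eq_iff split: nat.split)
next
  case (Cons k "is")
  show ?case unfolding list.map tprod_simps(2) Cons
    by (auto simp: shift_perm_def fun_eq_iff Transposition.transpose_def split: nat.split)
qed

lemma shift_perm_compose: "shift_perm f \<circ> shift_perm h = shift_perm (f \<circ> h)"
  by (auto simp: shift_perm_def fun_eq_iff split: nat.split)
lemma shift_perm_id: "shift_perm id = id"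
  by (auto simp: shift_perm_def fun_eq_iff split: nat.split)

lemma inv_shift_perm: 
  assumes "bij \<pi>" shows "pinv (shift_perm \<pi>) = shift_perm (pinv \<pi>)"
proof -
  have "\<pi> \<circ> pinv \<pi> = id" "pinv \<pi> \<circ> \<pi> = id"
    using assms by (auto simp: fun_eq_iff bij_is_surj surj_f_inv_f bij_is_inj)
  then show ?thesis
    by (intro inv_unique_comp) (simp_all only: shift_perm_compose shift_perm_id)
qed

lemma ascending_map_Suc: "ascending is \<Longrightarrow> ascending (map Suc is)"
  by (induction "is") (simp_all add: tprod_map_Suc inv_shift_perm[OF bij_tprod])

lemma ascending_insert_first:
  assumes "ascending is"
  shows "ascending (rev [0..<j] @ map Suc is)"
proof (induction j)
  case 0
  then show ?case using assms by (simp add: ascending_map_Suc)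
next
  case (Suc k)
  have "pinv (tprod (rev [0..<k] @ map Suc is)) k < pinv (tprod (rev [0..<k] @ map Suc is)) (Suc k)"
    unfolding inv_tprod_append tprod_map_Suc inv_shift_perm[OF bij_tprod]
    by (simp add: tprod_rev_upt inv_cycle_up cycle_down_def)
  then show ?case using Suc by simp
qed

text \<open>
  Both sides have \<open>(n + 1)!\<close> terms, so it suffices that \<open>h\<close> is injective.
\<close>

lemma sum_permutations_Suc:
  fixes g :: "(nat \<Rightarrow> nat) \<Rightarrow> 'b::comm_monoid_add"
  assumes h: "\<And>j \<pi>. j \<le> n \<Longrightarrow> \<pi> permutes {..<n} \<Longrightarrow> h j \<pi> permutes {..<Suc n}"
    and inj: "\<And>j j' \<pi> \<pi>'. j \<le> n \<Longrightarrow> j' \<le> n \<Longrightarrow> \<pi> permutes {..<n} \<Longrightarrow> \<pi>' permutes {..<n} \<Longrightarrow>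
      h j \<pi> = h j' \<pi>' \<Longrightarrow> j = j' \<and> \<pi> = \<pi>'"
  shows "(\<Sum>\<pi> | \<pi> permutes {..<Suc n}. g \<pi>) = (\<Sum>j\<le>n. \<Sum>\<pi> | \<pi> permutes {..<n}. g (h j \<pi>))"
proof -
  let ?P = "\<lambda>m. {\<pi>. \<pi> permutes {..<m :: nat}}"
  let ?X = "{..n} \<times> ?P n"
  have inj': "inj_on (case_prod h) ?X"
    by (auto simp: inj_on_def dest: inj)
  have "card ?X = fact (Suc n)"
    using card_permutations[of "{..<n}" n] by (simp add: card_cartesian_product)
  then have "card (case_prod h ` ?X) = card (?P (Suc n))"
    using card_image[OF inj'] card_permutations[of "{..<Suc n}" "Suc n"] by simp
  moreover have "case_prod h ` ?X \<subseteq> ?P (Suc n)"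
    using h by auto
  ultimately have "case_prod h ` ?X = ?P (Suc n)"
    by (intro card_subset_eq finite_permutations) auto
  then have "(\<Sum>\<pi>\<in>?P (Suc n). g \<pi>) = (\<Sum>z\<in>?X. g (case_prod h z))"
    using sum.reindex[OF inj', of g] by simp
  also have "\<dots> = (\<Sum>j\<le>n. \<Sum>\<pi>\<in>?P n. g (h j \<pi>))"
    by (simp add: sum.cartesian_product split_def)
  finally show ?thesis .
qed

lemma exists_ascending_word:
  assumes "\<pi> permutes {..<n}"
  obtains "is" where "simple_word n is" "tprod is = \<pi>" "ascending is"
  using chosen_reduced_expression[OF assms] by blast

lemma cycle_up_permutes: "j \<le> n \<Longrightarrow> cycle_up j n permutes {..<Suc n}"
  using tprod_permutes[OF simple_word_upt(2)[of n j]] by (simp add: tprod_rev_upt)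
lemma cycle_down_permutes: "j \<le> n \<Longrightarrow> cycle_down j n permutes {..<Suc n}"
  using tprod_permutes[OF simple_word_upt(1)[of n j]] by (simp add: tprod_upt)
lemma cycle_up_0_permutes: "j \<le> n \<Longrightarrow> cycle_up 0 j permutes {..<Suc n}"
  using tprod_permutes[OF simple_word_upt(3)[of j n]] by (simp add: tprod_rev_upt)
lemma shift_perm_permutes:
  assumes "\<pi> permutes {..<n}" shows "shift_perm \<pi> permutes {..<Suc n}"
proof -
  obtain "is" where "simple_word n is" "tprod is = \<pi>"
    using exists_ascending_word[OF assms] by blast
  then show ?thesis
    using tprod_permutes[OF simple_word_map_Suc, of n "is"] by (simp add: tprod_map_Suc)
qed

context shelf
begin

text \<open>
  A permutation of \<open>n + 1\<close> letters first moves one letter to the end and then permutes the others.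
  This decomposition is what the skew derivations below come from.
\<close>

lemma sum_braid_result_move_last:
  fixes f :: "'x list \<Rightarrow> 'b::comm_monoid_add"
  assumes xs: "set xs \<subseteq> S" and n: "length xs = Suc n"
  shows "(\<Sum>\<pi> | \<pi> permutes {..<Suc n}. f (braid_result \<pi> xs)) =
    (\<Sum>j\<le>n. \<Sum>\<pi> | \<pi> permutes {..<n}.
       f (braid_result \<pi> (take j xs @ map (\<lambda>y. xs ! j \<rhd> y) (drop (Suc j) xs)) @ [xs ! j]))"
proof -
  have "(\<Sum>\<pi> | \<pi> permutes {..<Suc n}. f (braid_result \<pi> xs)) =
      (\<Sum>j\<le>n. \<Sum>\<pi> | \<pi> permutes {..<n}. f (braid_result (\<pi> \<circ> cycle_up j n) xs))"
  proof (rule sum_permutations_Suc)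
    show "\<pi> \<circ> cycle_up j n permutes {..<Suc n}" if "j \<le> n" "\<pi> permutes {..<n}" for j \<pi>
      using that by (intro permutes_compose cycle_up_permutes) (auto intro: permutes_subset)
    fix j j' \<pi> \<pi>'
    assume A: "j \<le> n" "j' \<le> n" "\<pi> permutes {..<n}" "\<pi>' permutes {..<n}"
      "\<pi> \<circ> cycle_up j n = \<pi>' \<circ> cycle_up j' n"
    have "(\<pi> \<circ> cycle_up j n) j = n" "(\<pi>' \<circ> cycle_up j' n) j' = n"
      using permutes_not_in[OF A(3), of n] permutes_not_in[OF A(4), of n] by (simp_all add: cycle_up_def)
    moreover have "inj (\<pi> \<circ> cycle_up j n)"
      using A by (metis cycle_up_permutes permutes_inj inj_compose)
    ultimately have j: "j = j'" using A(5) by (metis injD)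
    have "\<pi> \<circ> cycle_up j n \<circ> cycle_down j n = \<pi>' \<circ> cycle_up j n \<circ> cycle_down j n"
      using A(5) j by simp
    then have "\<pi> = \<pi>'"
      using cycle_up_down(1)[OF A(1)] by (metis comp_assoc comp_id)
    with j show "j = j' \<and> \<pi> = \<pi>'" ..
  qed
  also have "\<dots> = (\<Sum>j\<le>n. \<Sum>\<pi> | \<pi> permutes {..<n}.
       f (braid_result \<pi> (take j xs @ map (\<lambda>y. xs ! j \<rhd> y) (drop (Suc j) xs)) @ [xs ! j]))"
  proof (intro sum.cong refl)
    fix j \<pi> assume j: "j \<in> {..n}" and \<pi>: "\<pi> \<in> {\<pi>. \<pi> permutes {..<n}}"
    then obtain "is" where w: "simple_word n is" "tprod is = \<pi>" "ascending is"
      using exists_ascending_word by blast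
    let ?ys = "take j xs @ map (\<lambda>y. xs ! j \<rhd> y) (drop (Suc j) xs)"
    have j': "j < length xs" using j n by simp
    have "xs ! j \<in> S" "set (take j xs) \<subseteq> S" "set (drop (Suc j) xs) \<subseteq> S"
      using xs nth_mem[OF j'] by (auto dest: in_set_takeD in_set_dropD)
    then have ys: "set ?ys \<subseteq> S" "length ?ys = n"
      using j n by (auto intro: op_closed)
    have "braid_result (\<pi> \<circ> cycle_up j n) xs = swaps (is @ rev [j..<n]) xs"
      using swaps_eq_braid_result[of xs "is @ rev [j..<n]"] w j n xs
        simple_word_mono[OF w(1), of "Suc n"] simple_word_upt(2)[of n j]
        ascending_move_last_first[of n "is" j]
      by (simp add: tprod_append tprod_rev_upt del: o_apply)
    also have "\<dots> = swaps is (?ys @ [xs ! j])"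
      using swaps_move_right[of "take j xs" "drop (Suc j) xs" "xs ! j"] id_take_nth_drop[OF j'] j n
      by (simp add: swaps_append min_absorb2)
    also have "\<dots> = braid_result \<pi> ?ys @ [xs ! j]"
      using swaps_append_right[of ?ys "is"] swaps_eq_braid_result[of ?ys "is"] w ys by simp
    finally show "f (braid_result (\<pi> \<circ> cycle_up j n) xs) = f (braid_result \<pi> ?ys @ [xs ! j])" by simp
  qed
  finally show ?thesis .
qed

text \<open>
  Alternatively the first \<open>n\<close> letters are permuted and the last letter is inserted afterwards. This and the mirror
  image below show that the kernels of the symmetrizers are stable under multiplication by letters.
\<close>

lemma sum_braid_result_snoc:
  fixes f :: "'x list \<Rightarrow> 'b::comm_monoid_add"
  assumes xs: "set xs \<subseteq> S" "x \<in> S" and n: "length xs = n"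
  shows "(\<Sum>\<pi> | \<pi> permutes {..<Suc n}. f (braid_result \<pi> (xs @ [x]))) =
    (\<Sum>j\<le>n. \<Sum>\<pi> | \<pi> permutes {..<n}. f (swaps [j..<n] (braid_result \<pi> xs @ [x])))"
proof -
  have "(\<Sum>\<pi> | \<pi> permutes {..<Suc n}. f (braid_result \<pi> (xs @ [x]))) =
      (\<Sum>j\<le>n. \<Sum>\<pi> | \<pi> permutes {..<n}. f (braid_result (cycle_down j n \<circ> \<pi>) (xs @ [x])))"
  proof (rule sum_permutations_Suc)
    show "cycle_down j n \<circ> \<pi> permutes {..<Suc n}" if "j \<le> n" "\<pi> permutes {..<n}" for j \<pi>
      using that by (intro permutes_compose cycle_down_permutes) (auto intro: permutes_subset)
    fix j j' \<pi> \<pi>'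
    assume A: "j \<le> n" "j' \<le> n" "\<pi> permutes {..<n}" "\<pi>' permutes {..<n}"
      "cycle_down j n \<circ> \<pi> = cycle_down j' n \<circ> \<pi>'"
    have "(cycle_down j n \<circ> \<pi>) n = j" "(cycle_down j' n \<circ> \<pi>') n = j'"
      using permutes_not_in[OF A(3), of n] permutes_not_in[OF A(4), of n] by (simp_all add: cycle_down_def)
    then have j: "j = j'" using A(5) by metis
    have "cycle_up j n \<circ> (cycle_down j n \<circ> \<pi>) = cycle_up j n \<circ> (cycle_down j n \<circ> \<pi>')"
      using A(5) j by simp
    then have "\<pi> = \<pi>'"
      using cycle_up_down(1)[OF A(1)] by (metis comp_assoc id_comp)
    with j show "j = j' \<and> \<pi> = \<pi>'" ..
  qed
  also have "\<dots> = (\<Sum>j\<le>n. \<Sum>\<pi> | \<pi> permutes {..<n}. f (swaps [j..<n] (braid_result \<pi> xs @ [x])))"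
  proof (intro sum.cong refl)
    fix j \<pi> assume j: "j \<in> {..n}" and \<pi>: "\<pi> \<in> {\<pi>. \<pi> permutes {..<n}}"
    then obtain "is" where w: "simple_word n is" "tprod is = \<pi>" "ascending is"
      using exists_ascending_word by blast
    have "braid_result (cycle_down j n \<circ> \<pi>) (xs @ [x]) = swaps ([j..<n] @ is) (xs @ [x])"
      using swaps_eq_braid_result[of "xs @ [x]" "[j..<n] @ is"] w j n xs
        simple_word_mono[OF w(1), of "Suc n"] simple_word_upt(1)[of n j]
        ascending_insert_last[of n "is" j]
      by (simp add: tprod_append tprod_upt del: o_apply)
    also have "\<dots> = swaps [j..<n] (braid_result \<pi> xs @ [x])"
      using swaps_append_right[of xs "is" "[x]"] swaps_eq_braid_result[of xs "is"] w xs n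
      by (simp add: swaps_append)
    finally show "f (braid_result (cycle_down j n \<circ> \<pi>) (xs @ [x])) = f (swaps [j..<n] (braid_result \<pi> xs @ [x]))"
      by simp
  qed
  finally show ?thesis .
qed

lemma sum_braid_result_Cons:
  fixes f :: "'x list \<Rightarrow> 'b::comm_monoid_add"
  assumes xs: "set xs \<subseteq> S" "x \<in> S" and n: "length xs = n"
  shows "(\<Sum>\<pi> | \<pi> permutes {..<Suc n}. f (braid_result \<pi> (x # xs))) =
    (\<Sum>j\<le>n. \<Sum>\<pi> | \<pi> permutes {..<n}. f (swaps (rev [0..<j]) (x # braid_result \<pi> xs)))"
proof -
  have "(\<Sum>\<pi> | \<pi> permutes {..<Suc n}. f (braid_result \<pi> (x # xs))) =
      (\<Sum>j\<le>n. \<Sum>\<pi> | \<pi> permutes {..<n}. f (braid_result (cycle_up 0 j \<circ> shift_perm \<pi>) (x # xs)))"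
  proof (rule sum_permutations_Suc)
    show "cycle_up 0 j \<circ> shift_perm \<pi> permutes {..<Suc n}" if "j \<le> n" "\<pi> permutes {..<n}" for j \<pi>
      using that by (intro permutes_compose cycle_up_0_permutes shift_perm_permutes)
    fix j j' \<pi> \<pi>'
    assume A: "j \<le> n" "j' \<le> n" "\<pi> permutes {..<n}" "\<pi>' permutes {..<n}"
      "cycle_up 0 j \<circ> shift_perm \<pi> = cycle_up 0 j' \<circ> shift_perm \<pi>'"
    have "(cycle_up 0 j \<circ> shift_perm \<pi>) 0 = j" "(cycle_up 0 j' \<circ> shift_perm \<pi>') 0 = j'"
      by (simp_all add: cycle_up_def)
    then have j: "j = j'" using A(5) by metis
    have "cycle_down 0 j \<circ> (cycle_up 0 j \<circ> shift_perm \<pi>) = cycle_down 0 j \<circ> (cycle_up 0 j \<circ> shift_perm \<pi>')"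
      using A(5) j by simp
    then have "shift_perm \<pi> = shift_perm \<pi>'"
      using cycle_up_down(2)[of 0 j] by (metis comp_assoc id_comp zero_le)
    then have "\<pi> x = \<pi>' x" for x
      by (metis shift_perm_simps(2) nat.inject)
    with j show "j = j' \<and> \<pi> = \<pi>'" by auto
  qed
  also have "\<dots> = (\<Sum>j\<le>n. \<Sum>\<pi> | \<pi> permutes {..<n}. f (swaps (rev [0..<j]) (x # braid_result \<pi> xs)))"
  proof (intro sum.cong refl)
    fix j \<pi> assume j: "j \<in> {..n}" and \<pi>: "\<pi> \<in> {\<pi>. \<pi> permutes {..<n}}"
    then obtain "is" where w: "simple_word n is" "tprod is = \<pi>" "ascending is"
      using exists_ascending_word by blast
    have "braid_result (cycle_up 0 j \<circ> shift_perm \<pi>) (x # xs) = swaps (rev [0..<j] @ map Suc is) (x # xs)"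
      using swaps_eq_braid_result[of "x # xs" "rev [0..<j] @ map Suc is"] w j n xs
        simple_word_map_Suc[OF w(1)] simple_word_upt(3)[of j n]
        ascending_insert_first[of "is" j]
      by (simp add: tprod_append tprod_rev_upt tprod_map_Suc del: o_apply)
    also have "\<dots> = swaps (rev [0..<j]) (x # braid_result \<pi> xs)"
      using swaps_eq_braid_result[of xs "is"] w xs n
      by (simp add: swaps_append swaps_Cons)
    finally show "f (braid_result (cycle_up 0 j \<circ> shift_perm \<pi>) (x # xs)) = f (swaps (rev [0..<j]) (x # braid_result \<pi> xs))"
      by simp
  qed
  finally show ?thesis .
qed

end


section \<open>The tensor ideal and its homogeneous components\<close>

text \<open>
  The homogeneous component of degree \<open>n\<close>.
\<close>

definition hcomp :: "nat \<Rightarrow> ('u list \<Rightarrow>\<^sub>0 complex) \<Rightarrow> ('u list \<Rightarrow>\<^sub>0 complex)"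
  where "hcomp n = lin_ext (\<lambda>xs. if length xs = n then word xs else 0)"

lemma hcomp_linear: "fin_linear (hcomp n)" by (simp add: hcomp_def)
lemmas hcomp_add = fin_linear_add[OF hcomp_linear] and hcomp_zero [simp] = fin_linear_zero[OF hcomp_linear]
  and hcomp_smult = fin_linear_smult[OF hcomp_linear] and hcomp_minus = fin_linear_minus[OF hcomp_linear]
  and hcomp_diff = fin_linear_diff[OF hcomp_linear]
lemma hcomp_word: "hcomp n (word xs) = (if length xs = n then word xs else 0)"
  by (simp add: hcomp_def)
lemma hcomp_eq:
  assumes "Poly_Mapping.keys f \<subseteq> {xs. length xs = m}"
  shows "hcomp n f = (if n = m then f else 0)"
proof (cases "n = m")
  case True
  have "hcomp n f = f"
    by (rule fin_linear_eqI[OF hcomp_linear fin_linear_id assms]) (simp add: hcomp_word True)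
  with True show ?thesis by simp
next
  case False
  have "hcomp n f = smult_fin 0 f"
    by (rule fin_linear_eqI[OF hcomp_linear _ assms]) (use False in \<open>auto simp: hcomp_word fin_linear_def\<close>)
  with False show ?thesis by simp
qed
lemma keys_hcomp: "Poly_Mapping.keys (hcomp n f) \<subseteq> {xs \<in> Poly_Mapping.keys f. length xs = n}"
  unfolding hcomp_def by (rule keys_lin_ext) auto
lemma hcomp_word_mult: "hcomp (length xs + n) (word xs * f) = word xs * hcomp n f"
  by (rule fin_linear_eqI[OF fin_linear_compose[OF hcomp_linear fin_linear_mult_left]
        fin_linear_compose[OF fin_linear_mult_left hcomp_linear] subset_UNIV])
    (simp add: hcomp_word word_mult)
lemma hcomp_mult_word: "hcomp (n + length xs) (f * word xs) = hcomp n f * word xs"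
  by (rule fin_linear_eqI[OF fin_linear_compose[OF hcomp_linear fin_linear_mult_right]
        fin_linear_compose[OF fin_linear_mult_right hcomp_linear] subset_UNIV])
    (simp add: hcomp_word word_mult)
lemma hcomp_0_word_mult: "xs \<noteq> [] \<Longrightarrow> hcomp 0 (word xs * f) = 0" "xs \<noteq> [] \<Longrightarrow> hcomp 0 (f * word xs) = 0"
proof -
  assume "xs \<noteq> []"
  have "hcomp 0 (word xs * f) = smult_fin 0 f"
    by (rule fin_linear_eqI[OF fin_linear_compose[OF hcomp_linear fin_linear_mult_left] _ subset_UNIV])
      (use \<open>xs \<noteq> []\<close> in \<open>auto simp: hcomp_word word_mult fin_linear_def\<close>)
  then show "hcomp 0 (word xs * f) = 0" by simp
  have "hcomp 0 (f * word xs) = smult_fin 0 f"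
    by (rule fin_linear_eqI[OF fin_linear_compose[OF hcomp_linear fin_linear_mult_right] _ subset_UNIV])
      (use \<open>xs \<noteq> []\<close> in \<open>auto simp: hcomp_word word_mult fin_linear_def\<close>)
  then show "hcomp 0 (f * word xs) = 0" by simp
qed
lemma sum_hcomp:
  assumes "\<And>xs. xs \<in> Poly_Mapping.keys f \<Longrightarrow> length xs \<le> m"
  shows "(\<Sum>n\<le>m. hcomp n f) = f"
  by (rule fin_linear_eqI[OF fin_linear_sum_map[OF hcomp_linear] fin_linear_id, of f "{xs. length xs \<le> m}"])
    (use assms in \<open>auto simp: hcomp_word\<close>)

lemma keys_subset_add: "Poly_Mapping.keys f \<subseteq> A \<Longrightarrow> Poly_Mapping.keys g \<subseteq> A \<Longrightarrow> Poly_Mapping.keys (f + g) \<subseteq> A"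
  using keys_add[of f g] by blast
lemma keys_subset_diff: "Poly_Mapping.keys f \<subseteq> A \<Longrightarrow> Poly_Mapping.keys g \<subseteq> A \<Longrightarrow> Poly_Mapping.keys (f - g) \<subseteq> A"
  for f g :: "'a \<Rightarrow>\<^sub>0 complex"
  using keys_diff_subset[of f g] by blast
lemma keys_subset_smult: "Poly_Mapping.keys f \<subseteq> A \<Longrightarrow> Poly_Mapping.keys (smult_fin a f) \<subseteq> A"
  using keys_smult_fin[of a f] by blast

locale tensor_space =
  fixes scale :: "complex \<Rightarrow> 'u \<Rightarrow> 'u::ab_group_add" and U :: "'u set"
  assumes U_zero: "0 \<in> U" and U_add: "u \<in> U \<Longrightarrow> v \<in> U \<Longrightarrow> u + v \<in> U"
    and U_scale: "u \<in> U \<Longrightarrow> scale a u \<in> U"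
begin

abbreviation "I \<equiv> tensor_ideal scale U"
abbreviation "Fr \<equiv> free_algebra U"

text \<open>
  The carrier of the free algebra, and below its homogeneous components.
\<close>

definition FC :: "('u list \<Rightarrow>\<^sub>0 complex) set" where "FC = {f. Poly_Mapping.keys f \<subseteq> lists U}"
definition Fn :: "nat \<Rightarrow> ('u list \<Rightarrow>\<^sub>0 complex) set"
  where "Fn n = {f. Poly_Mapping.keys f \<subseteq> {xs \<in> lists U. length xs = n}}"

lemma carrier_Fr: "carrier Fr = FC" by (simp add: FC_def)

lemma FC_closed [intro]:
  "0 \<in> FC" "f \<in> FC \<Longrightarrow> g \<in> FC \<Longrightarrow> f + g \<in> FC" "f \<in> FC \<Longrightarrow> g \<in> FC \<Longrightarrow> f - g \<in> FC" "f \<in> FC \<Longrightarrow> g \<in> FC \<Longrightarrow> f * g \<in> FC"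
  "f \<in> FC \<Longrightarrow> smult_fin a f \<in> FC" "xs \<in> lists U \<Longrightarrow> word xs \<in> FC" "f \<in> FC \<Longrightarrow> - f \<in> FC"
  using keys_mult_lists[of f "lists U" g "lists U" "lists U"]
  by (simp_all add: FC_def keys_subset_add keys_subset_diff keys_subset_smult)

lemma Fn_closed [intro]:
  "0 \<in> Fn n" "f \<in> Fn n \<Longrightarrow> g \<in> Fn n \<Longrightarrow> f + g \<in> Fn n" "f \<in> Fn n \<Longrightarrow> g \<in> Fn n \<Longrightarrow> f - g \<in> Fn n"
  "f \<in> Fn n \<Longrightarrow> smult_fin a f \<in> Fn n" "xs \<in> lists U \<Longrightarrow> length xs = n \<Longrightarrow> word xs \<in> Fn n" 
  by (simp_all add: Fn_def keys_subset_add keys_subset_diff keys_subset_smult)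

lemma Fn_mult: "f \<in> Fn n \<Longrightarrow> g \<in> Fn m \<Longrightarrow> f * g \<in> Fn (n + m)"
  unfolding Fn_def by (simp, erule (1) keys_mult_lists) auto
lemma Fn_sum: "(\<And>x. x \<in> X \<Longrightarrow> f x \<in> Fn n) \<Longrightarrow> sum f X \<in> Fn n"
  unfolding Fn_def by (simp add: keys_sum_subset)
lemma Fn_FC: "f \<in> Fn n \<Longrightarrow> f \<in> FC" by (auto simp: Fn_def FC_def)
lemma hcomp_Fn: "f \<in> Fn m \<Longrightarrow> hcomp n f = (if n = m then f else 0)"
  by (rule hcomp_eq) (auto simp: Fn_def)
lemma hcomp_in_Fn: "f \<in> FC \<Longrightarrow> hcomp n f \<in> Fn n"
  using keys_hcomp[of n f] by (auto simp: FC_def Fn_def)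

lemma relations_subset: "tensor_relations scale U \<subseteq> Fn 1"
  by (auto simp: tensor_relations_def U_add U_scale intro!: Fn_closed)

lemma ideal_I: "ideal I Fr"
  unfolding tensor_ideal_def
  by (rule ring.genideal_ideal[OF ring_free_algebra]) (use relations_subset Fn_FC in \<open>auto simp: carrier_Fr simp del: free_algebra_simps\<close>)

lemma I_carrier: "f \<in> I \<Longrightarrow> f \<in> FC"
  using ideal.Icarr[OF ideal_I] by (simp add: FC_def)
lemma I_mult_left: "f \<in> I \<Longrightarrow> g \<in> FC \<Longrightarrow> g * f \<in> I"
  using ideal.I_l_closed[OF ideal_I, of f g] by (simp add: FC_def free_algebra_mult)
lemma I_mult_right: "f \<in> I \<Longrightarrow> g \<in> FC \<Longrightarrow> f * g \<in> I"
  using ideal.I_r_closed[OF ideal_I, of f g] by (simp add: FC_def free_algebra_mult)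
lemma I_smult: "f \<in> I \<Longrightarrow> smult_fin a f \<in> I"
  unfolding smult_fin_conv_mult by (rule I_mult_left) (auto simp: FC_def)
lemma I_zero [simp]: "0 \<in> I"
  using additive_subgroup.zero_closed[OF ideal.axioms(1)[OF ideal_I]] by simp
lemma I_add: "f \<in> I \<Longrightarrow> g \<in> I \<Longrightarrow> f + g \<in> I"
  using additive_subgroup.a_closed[OF ideal.axioms(1)[OF ideal_I]] by simp
lemma I_uminus: "f \<in> I \<Longrightarrow> - f \<in> I"
  using I_smult[of f "-1"] by (simp add: smult_fin_minus_one)
lemma I_diff: "f \<in> I \<Longrightarrow> g \<in> I \<Longrightarrow> f - g \<in> I"
  using I_add[of f "- g"] I_uminus by simp
lemma I_sum: "(\<And>x. x \<in> X \<Longrightarrow> f x \<in> I) \<Longrightarrow> sum f X \<in> I"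
  by (induction X rule: infinite_finite_induct) (auto intro: I_add)
lemma relations_in_I: "r \<in> tensor_relations scale U \<Longrightarrow> r \<in> I"
  unfolding tensor_ideal_def
  using ring.genideal_self[OF ring_free_algebra, of "tensor_relations scale U" U] relations_subset Fn_FC
  by (auto simp: carrier_Fr simp del: free_algebra_simps)

text \<open>
  In contrast to the ideal generated by the relations, this span has an induction principle in which only
  words occur as factors. It is an ideal, so it contains the tensor ideal, which gives the rule \<open>I_induct\<close>.
\<close>

inductive_set ispan :: "('u list \<Rightarrow>\<^sub>0 complex) set" where
  zero: "0 \<in> ispan"
| add: "f \<in> ispan \<Longrightarrow> g \<in> ispan \<Longrightarrow> f + g \<in> ispan"
| gen: "xs \<in> lists U \<Longrightarrow> ys \<in> lists U \<Longrightarrow> r \<in> tensor_relations scale U \<Longrightarrow>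
    smult_fin a (word xs * r * word ys) \<in> ispan"

lemma ispan_FC: "f \<in> ispan \<Longrightarrow> f \<in> FC"
proof (induction rule: ispan.induct)
  case (gen xs ys r a)
  then have "r \<in> FC" using relations_subset Fn_FC by blast
  then show ?case using gen by (intro FC_closed(4-6))
qed (auto intro: FC_closed)

lemma ispan_smult: "f \<in> ispan \<Longrightarrow> smult_fin a f \<in> ispan"
  by (induction rule: ispan.induct) (auto simp: smult_fin_add intro: ispan.intros)

lemma ispan_mult_word:
  assumes "f \<in> ispan" "zs \<in> lists U"
  shows "word zs * f \<in> ispan \<and> f * word zs \<in> ispan"
  using assms(1)
proof (induction rule: ispan.induct)
  case (gen xs ys r a)
  have "word zs * smult_fin a (word xs * r * word ys) = smult_fin a (word (zs @ xs) * r * word ys)"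
    by (simp only: smult_fin_mult_right word_mult[symmetric] mult.assoc)
  moreover have "smult_fin a (word xs * r * word ys) * word zs = smult_fin a (word xs * r * word (ys @ zs))"
    by (simp only: smult_fin_mult_left word_mult[symmetric] mult.assoc)
  ultimately show ?case using gen assms(2) by (auto intro!: ispan.gen)
qed (auto simp: distrib_left distrib_right intro: ispan.intros)

lemma ispan_mult:
  assumes "f \<in> ispan" "g \<in> FC"
  shows "g * f \<in> ispan \<and> f * g \<in> ispan"
  using assms(2) unfolding FC_def mem_Collect_eq
proof (induction rule: poly_mapping_span_induct)
  case (single x a)
  then show ?case using ispan_mult_word[OF assms(1), of x]
    by (simp add: smult_fin_word[symmetric] smult_fin_mult_left smult_fin_mult_right ispan_smult)
qed (auto simp: distrib_left distrib_right intro: ispan.intros)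

lemma ideal_ispan: "ideal ispan Fr"
proof (rule idealI[OF ring_free_algebra])
  show "subgroup ispan (add_monoid Fr)"
  proof (rule group.subgroupI)
    show "Group.group (add_monoid Fr)"
      using abelian_group.a_group[OF ring.is_abelian_group[OF ring_free_algebra]] .
    show "ispan \<subseteq> carrier (add_monoid Fr)" using ispan_FC by (auto simp: FC_def)
    show "ispan \<noteq> {}" using ispan.zero by blast
    show "inv\<^bsub>add_monoid Fr\<^esub> a \<in> ispan" if "a \<in> ispan" for a
    proof -
      have m: "- a \<in> ispan" using ispan_smult[OF that, of "-1"] by (simp add: smult_fin_minus_one)
      have "\<ominus>\<^bsub>Fr\<^esub> a = - a"
        by (rule abelian_group.minus_equality[OF ring.is_abelian_group[OF ring_free_algebra]])
          (use ispan_FC[OF that] ispan_FC[OF m] in \<open>simp_all add: FC_def\<close>)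
      with m show ?thesis by (simp add: a_inv_def)
    qed
    show "a \<otimes>\<^bsub>add_monoid Fr\<^esub> b \<in> ispan" if "a \<in> ispan" "b \<in> ispan" for a b
      using that by (simp add: ispan.add)
  qed
qed (use ispan_mult in \<open>auto simp: FC_def free_algebra_mult\<close>)

lemma I_induct [consumes 1, case_names zero add gen]:
  assumes "f \<in> I" "P 0" "\<And>f g. f \<in> I \<Longrightarrow> g \<in> I \<Longrightarrow> P f \<Longrightarrow> P g \<Longrightarrow> P (f + g)"
    "\<And>xs ys r a. xs \<in> lists U \<Longrightarrow> ys \<in> lists U \<Longrightarrow> r \<in> tensor_relations scale U \<Longrightarrow> P (smult_fin a (word xs * r * word ys))"
  shows "P f"
proof -
  have gen: "smult_fin a (word xs * r * word ys) \<in> I"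
    if "xs \<in> lists U" "ys \<in> lists U" "r \<in> tensor_relations scale U" for xs ys r a
    using that by (intro I_smult I_mult_right I_mult_left relations_in_I FC_closed(6))
  have "f \<in> ispan"
    using ring.genideal_minimal[OF ring_free_algebra ideal_ispan, of "tensor_relations scale U"] assms(1)
      ispan.gen[of "[]" "[]" _ 1] by (auto simp: tensor_ideal_def word_Nil)
  then have "f \<in> I \<and> P f"
    by (induction rule: ispan.induct) (auto intro: assms gen I_add)
  then show ?thesis ..
qed

lemma hcomp_generator:
  assumes "r \<in> tensor_relations scale U" "xs \<in> lists U" "ys \<in> lists U"
  shows "hcomp n (word xs * r * word ys) = (if n = Suc (length xs + length ys) then word xs * r * word ys else 0)"
proof -
  have "word xs * r * word ys \<in> Fn (length xs + 1 + length ys)"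
    using assms relations_subset by (intro Fn_mult) auto
  from hcomp_Fn[OF this, of n] show ?thesis by simp
qed

text \<open>
  The relations are homogeneous of degree one. So the part of the ideal in degree \<open>n\<close> is spanned by
  relations with \<open>n - 1\<close> further letters around them, and operators that only make sense on words of length \<open>n\<close>
  can be tested on these.
\<close>

lemma linear_map_I:
  assumes f: "f \<in> I" "f \<in> Fn n" and L: "fin_linear L"
    and gen: "\<And>xs ys r. xs \<in> lists U \<Longrightarrow> ys \<in> lists U \<Longrightarrow> r \<in> tensor_relations scale U \<Longrightarrow>
      n = Suc (length xs + length ys) \<Longrightarrow> L (word xs * r * word ys) \<in> I"
  shows "L f \<in> I"
proof -
  have "L (hcomp n f) \<in> I"
    using f(1)
  proof (induction rule: I_induct)
    case zero
    show ?case using fin_linear_zero[OF L] by simp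
  next
    case (add f g)
    then show ?case by (simp add: hcomp_add fin_linear_add[OF L] I_add)
  next
    case (gen xs ys r a)
    then show ?case
      using assms(4)[of xs ys r] fin_linear_zero[OF L]
      by (simp add: hcomp_smult fin_linear_smult[OF L] hcomp_generator I_smult)
  qed
  then show ?thesis using f(2) by (simp add: hcomp_Fn)
qed

lemma hcomp_I: "f \<in> I \<Longrightarrow> hcomp n f \<in> I"
proof (induction rule: I_induct)
  case (gen xs ys r a)
  then have "word xs * r * word ys \<in> I"
    by (intro I_mult_right I_mult_left relations_in_I FC_closed(6))
  then show ?case using gen by (simp add: hcomp_smult hcomp_generator I_smult)
qed (auto simp: hcomp_add I_add)

text \<open>
  Equality in the tensor algebra, for representatives in the free algebra.
\<close>

definition teq :: "('u list \<Rightarrow>\<^sub>0 complex) \<Rightarrow> ('u list \<Rightarrow>\<^sub>0 complex) \<Rightarrow> bool" (infix "\<approx>\<^sub>I" 50)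
  where "f \<approx>\<^sub>I g \<longleftrightarrow> f - g \<in> I"

lemma teq_refl [simp, intro]: "f \<approx>\<^sub>I f" by (simp add: teq_def)
lemma teq_sym: "f \<approx>\<^sub>I g \<Longrightarrow> g \<approx>\<^sub>I f" using I_uminus[of "f - g"] by (simp add: teq_def)
lemma teq_trans [trans]: "f \<approx>\<^sub>I g \<Longrightarrow> g \<approx>\<^sub>I h \<Longrightarrow> f \<approx>\<^sub>I h" using I_add[of "f - g" "g - h"] by (simp add: teq_def)
lemma teq_eq_trans [trans]: "f \<approx>\<^sub>I g \<Longrightarrow> g = h \<Longrightarrow> f \<approx>\<^sub>I h" "f = g \<Longrightarrow> g \<approx>\<^sub>I h \<Longrightarrow> f \<approx>\<^sub>I h" by simp_all
lemma teq_add: "f \<approx>\<^sub>I g \<Longrightarrow> f' \<approx>\<^sub>I g' \<Longrightarrow> f + f' \<approx>\<^sub>I g + g'"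
  using I_add[of "f - g" "f' - g'"] by (simp add: teq_def algebra_simps)
lemma teq_smult: "f \<approx>\<^sub>I g \<Longrightarrow> smult_fin a f \<approx>\<^sub>I smult_fin a g"
  using I_smult[of "f - g" a] by (simp add: teq_def smult_fin_diff)
lemma teq_sum: "(\<And>x. x \<in> X \<Longrightarrow> f x \<approx>\<^sub>I g x) \<Longrightarrow> sum f X \<approx>\<^sub>I sum g X"
  using I_sum[of X "\<lambda>x. f x - g x"] by (simp add: teq_def sum_subtractf)
lemma teq_mult_left: "f \<approx>\<^sub>I g \<Longrightarrow> h \<in> FC \<Longrightarrow> h * f \<approx>\<^sub>I h * g"
  using I_mult_left[of "f - g" h] by (simp add: teq_def right_diff_distrib)
lemma teq_mult_right: "f \<approx>\<^sub>I g \<Longrightarrow> h \<in> FC \<Longrightarrow> f * h \<approx>\<^sub>I g * h"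
  using I_mult_right[of "f - g" h] by (simp add: teq_def left_diff_distrib)
lemma teq_I: "f \<approx>\<^sub>I g \<Longrightarrow> f \<in> I \<longleftrightarrow> g \<in> I"
  using I_add[of "f - g" g] I_diff[of f "f - g"] by (auto simp: teq_def)

lemma word_add: "u \<in> U \<Longrightarrow> v \<in> U \<Longrightarrow> word [u + v] \<approx>\<^sub>I word [u] + word [v]"
  using relations_in_I[of "word [u + v] - word [u] - word [v]"]
  by (auto simp: teq_def tensor_relations_def algebra_simps)
lemma word_scale: "u \<in> U \<Longrightarrow> word [scale a u] \<approx>\<^sub>I smult_fin a (word [u])"
  using relations_in_I[of "word [scale a u] - smult_fin a (word [u])"]
  by (auto simp: teq_def tensor_relations_def)
lemma word_zero: "word [0] \<approx>\<^sub>I 0"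
  using word_add[OF U_zero U_zero] I_uminus by (fastforce simp: teq_def)
lemma word_context: "word [u] \<approx>\<^sub>I f \<Longrightarrow> xs \<in> lists U \<Longrightarrow> ys \<in> lists U \<Longrightarrow> word (xs @ u # ys) \<approx>\<^sub>I word xs * f * word ys"
  using teq_mult_right[OF teq_mult_left, of "word [u]" f "word xs" "word ys"]
  by (auto simp: word_mult)
lemma U_sum_list: "set us \<subseteq> U \<Longrightarrow> sum_list us \<in> U"
  by (induction us) (auto simp: U_zero U_add)
lemma word_sum_list: "set us \<subseteq> U \<Longrightarrow> word [sum_list us] \<approx>\<^sub>I sum_list (map (\<lambda>u. word [u]) us)"
proof (induction us)
  case (Cons u us)
  then have "word [u + sum_list us] \<approx>\<^sub>I word [u] + word [sum_list us]"
    by (intro word_add) (auto intro: U_sum_list)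
  also have "\<dots> \<approx>\<^sub>I word [u] + sum_list (map (\<lambda>u. word [u]) us)"
    using Cons by (intro teq_add) auto
  finally show ?case by simp
qed (simp add: word_zero)

end


section \<open>Quantum symmetrizers on homogeneous words\<close>

lemma braid_at_linear: "fin_linear (braid_at c i)"
  by (simp add: braid_at_def)

lemma braid_at_word: "braid_at c (length ps) (word (ps @ u # v # qs)) = word ps * c u v * word qs"
proof -
  have "lin_ext (\<lambda>ys. word (ps @ ys @ qs)) (c u v) = word ps * c u v * word qs"
    by (rule fin_linear_eqI[OF fin_linear_lin_ext fin_linear_compose[OF fin_linear_mult_right fin_linear_mult_left] subset_UNIV])
      (simp add: word_mult)
  then show ?thesis by (simp add: braid_at_def nth_append)
qed

lemma split_two_letters:
  assumes "Suc i < length xs"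
  obtains ps u v qs where "xs = ps @ u # v # qs" "length ps = i"
proof -
  have "xs = take i xs @ xs ! i # xs ! Suc i # drop (Suc (Suc i)) xs"
    using assms by (simp add: Cons_nth_drop_Suc)
  with that[of "take i xs"] assms show thesis by simp
qed

definition braid_word :: "('u \<Rightarrow> 'u \<Rightarrow> ('u list \<Rightarrow>\<^sub>0 complex)) \<Rightarrow> nat list \<Rightarrow> ('u list \<Rightarrow>\<^sub>0 complex) \<Rightarrow> ('u list \<Rightarrow>\<^sub>0 complex)"
  where "braid_word c is = foldr (\<lambda>i f. braid_at c i \<circ> f) is id"

lemma braid_word_simps: "braid_word c [] f = f" "braid_word c (i # is) f = braid_at c i (braid_word c is f)"
  by (simp_all add: braid_word_def)

lemma braid_word_linear: "fin_linear (braid_word c is)"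
proof (induction "is")
  case Nil
  then show ?case by (simp add: fin_linear_def braid_word_simps)
next
  case (Cons i "is")
  then show ?case by (simp add: fin_linear_def braid_word_simps fin_linear_add[OF braid_at_linear] fin_linear_smult[OF braid_at_linear])
qed

lemma braid_perm_eq_braid_word:
  "braid_perm c n \<pi> = braid_word c (SOME is. reduced_expression n \<pi> is)"
  by (simp add: braid_perm_def braid_word_def)

lemma quantum_symmetrizer_linear: "fin_linear (quantum_symmetrizer c n)"
  using fin_linear_sum_map[of "{\<pi>. \<pi> permutes {..<n}}" "braid_perm c n"]
  by (simp add: braid_perm_eq_braid_word braid_word_linear quantum_symmetrizer_def[abs_def])

lemma quantum_symmetrizer_small:
  assumes "n \<le> 1" shows "quantum_symmetrizer c n f = f"
proof -
  have "{\<pi>. \<pi> permutes {..<n}} = {id}"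
  proof (cases "n = 0")
    case False
    then have "{..<n} = {0}" using assms by auto
    then show ?thesis by (simp only: permutes_sing) auto
  qed auto
  moreover have "simple_word n w \<longleftrightarrow> w = []" for w
    using assms by (cases w) auto
  then have "(SOME is. reduced_expression n id is) = []"
    using chosen_reduced_expression(1)[OF permutes_id, of n] by simp
  ultimately show ?thesis
    by (simp add: quantum_symmetrizer_def braid_perm_eq_braid_word braid_word_simps)
qed

text \<open>
  A braided vector space spanned by homogeneous vectors \<open>e x\<close> on which the braiding is set-theoretic. The function
  \<open>c\<close> yields representatives in the free algebra, so it is bilinear and given by the exchange rule only
  modulo the tensor ideal.
\<close>

locale braided_tensor_space = tensor_space scale U + shelf op S
  for scale :: "complex \<Rightarrow> 'u \<Rightarrow> 'u::ab_group_add" and U :: "'u set"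
    and op :: "'x \<Rightarrow> 'x \<Rightarrow> 'x" (infixr "\<rhd>" 70) and S :: "'x set" +
  fixes e :: "'x \<Rightarrow> 'u" and c :: "'u \<Rightarrow> 'u \<Rightarrow> ('u list \<Rightarrow>\<^sub>0 complex)"
  assumes e_in_U: "x \<in> S \<Longrightarrow> e x \<in> U"
    and e_spans: "u \<in> U \<Longrightarrow> \<exists>xs. set xs \<subseteq> S \<and> u = sum_list (map e xs)"
    and c_degree: "u \<in> U \<Longrightarrow> v \<in> U \<Longrightarrow> c u v \<in> Fn 2"
    and c_add_left: "u \<in> U \<Longrightarrow> u' \<in> U \<Longrightarrow> v \<in> U \<Longrightarrow> c (u + u') v \<approx>\<^sub>I c u v + c u' v"
    and c_add_right: "u \<in> U \<Longrightarrow> v \<in> U \<Longrightarrow> v' \<in> U \<Longrightarrow> c u (v + v') \<approx>\<^sub>I c u v + c u v'"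
    and c_scale_left: "u \<in> U \<Longrightarrow> v \<in> U \<Longrightarrow> c (scale a u) v \<approx>\<^sub>I smult_fin a (c u v)"
    and c_scale_right: "u \<in> U \<Longrightarrow> v \<in> U \<Longrightarrow> c u (scale a v) \<approx>\<^sub>I smult_fin a (c u v)"
    and c_homogeneous: "x \<in> S \<Longrightarrow> y \<in> S \<Longrightarrow> c (e x) (e y) \<approx>\<^sub>I word [e (x \<rhd> y), e x]"
begin

abbreviation E :: "'x list \<Rightarrow> ('u list \<Rightarrow>\<^sub>0 complex)" where "E xs \<equiv> word (map e xs)"

lemma E_Fn: "set xs \<subseteq> S \<Longrightarrow> E xs \<in> Fn (length xs)"
  by (rule Fn_closed(5)) (auto intro!: e_in_U)

lemma braid_at_Fn: 
  assumes f: "f \<in> Fn n" and i: "Suc i < n"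
  shows "braid_at c i f \<in> Fn n"
  using f unfolding Fn_def mem_Collect_eq[of _ "\<lambda>f. Poly_Mapping.keys f \<subseteq> _"]
proof (induction rule: poly_mapping_span_induct)
  case zero
  then show ?case by (simp add: fin_linear_zero[OF braid_at_linear])
next
  case (add f g)
  then show ?case by (simp add: fin_linear_add[OF braid_at_linear] keys_subset_add)
next
  case (single xs a)
  with i have "Suc i < length xs" by simp
  then obtain ps u v qs where xs: "xs = ps @ u # v # qs" "length ps = i"
    by (rule split_two_letters)
  have "word ps * c u v * word qs \<in> Fn (length ps + 2 + length qs)"
    using single xs by (intro Fn_mult c_degree Fn_closed(5)) auto
  then have "word ps * c u v * word qs \<in> Fn n"
    using xs single by simp
  then have "smult_fin a (braid_at c i (word xs)) \<in> Fn n"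
    using xs braid_at_word[of c ps u v qs] by (auto intro: Fn_closed)
  then show ?case by (simp add: fin_linear_single[OF braid_at_linear] Fn_def)
qed

lemma c_relation_left:
  assumes "r \<in> tensor_relations scale U" "v \<in> U"
  shows "lin_ext (\<lambda>us. c (hd us) v) r \<in> I"
  using assms c_add_left[of _ _ v] c_scale_left[of _ v]
  by (auto simp: tensor_relations_def teq_def lin_ext_smult lin_ext_add fin_linear_diff[OF fin_linear_lin_ext] diff_diff_eq)

lemma c_relation_right:
  assumes "r \<in> tensor_relations scale U" "u \<in> U"
  shows "lin_ext (\<lambda>vs. c u (hd vs)) r \<in> I"
  using assms c_add_right[of u] c_scale_right[of u]
  by (auto simp: tensor_relations_def teq_def lin_ext_smult lin_ext_add fin_linear_diff[OF fin_linear_lin_ext] diff_diff_eq)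

lemma I_sandwich: "f \<in> I \<Longrightarrow> g \<in> FC \<Longrightarrow> h \<in> FC \<Longrightarrow> g * f * h \<in> I"
  by (intro I_mult_left I_mult_right)

text \<open>
  Either \<open>c\<close> is applied to letters beside the relation, which then remains as a factor, or one
  of the two letters lies in the relation, and bilinearity of \<open>c\<close> applies.
\<close>

lemma braid_at_generator:
  assumes r: "r \<in> tensor_relations scale U" and xs: "xs \<in> lists U" "ys \<in> lists U"
    and i: "Suc i < Suc (length xs + length ys)"
  shows "braid_at c i (word xs * r * word ys) \<in> I"
proof -
  have rI: "r \<in> I" using r by (rule relations_in_I)
  have keys: "Poly_Mapping.keys r \<subseteq> range (\<lambda>a. [a])"
  proof -
    have "Poly_Mapping.keys r \<subseteq> {xs. length xs = Suc 0}"
      using r relations_subset by (auto simp: Fn_def)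
    then show ?thesis by (auto simp: length_Suc_conv)
  qed
  have L: "fin_linear (\<lambda>f. braid_at c i (word xs * f * word ys))"
    by (rule fin_linear_compose[OF braid_at_linear fin_linear_compose[OF fin_linear_mult_right fin_linear_mult_left]])
  have M: "fin_linear (\<lambda>f. A * f * B)" for A B :: "'u list \<Rightarrow>\<^sub>0 complex"
    by (rule fin_linear_compose[OF fin_linear_mult_right fin_linear_mult_left])
  have N: "fin_linear (\<lambda>f. A * lin_ext \<phi> f * B)" for A B :: "'u list \<Rightarrow>\<^sub>0 complex" and \<phi>
    by (rule fin_linear_compose[OF M fin_linear_lin_ext])
  consider "Suc i < length xs" | "Suc i = length xs" | "i = length xs" | "length xs < i" by linarith
  then show ?thesis
  proof cases
    case 1
    then obtain ps u v qs where s: "xs = ps @ u # v # qs" "length ps = i"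
      by (rule split_two_letters)
    have "braid_at c i (word xs * r * word ys) = (word ps * c u v * word qs) * r * word ys"
      by (rule fin_linear_eqI[OF L M keys])
        (use s braid_at_word[of c ps u v] in \<open>auto simp: word_mult mult.assoc\<close>)
    moreover have "word ps * c u v * word qs \<in> FC"
      using s xs by (intro FC_closed Fn_FC[OF c_degree]) auto
    moreover have "word xs \<in> FC" "word ys \<in> FC" using xs by (auto intro: FC_closed)
    ultimately show ?thesis using I_sandwich rI by metis
  next
    case 2
    then obtain ps u where s: "xs = ps @ [u]" "length ps = i"
      by (metis append_butlast_last_id length_append_singleton length_0_conv nat.distinct(1) nat.inject)
    have "braid_at c i (word xs * r * word ys) = word ps * lin_ext (\<lambda>vs. c u (hd vs)) r * word ys"
      by (rule fin_linear_eqI[OF L N keys])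
        (use s braid_at_word[of c ps u _ ys] in \<open>auto simp: word_mult mult.assoc\<close>)
    moreover have "lin_ext (\<lambda>vs. c u (hd vs)) r \<in> I"
      using s xs by (intro c_relation_right r) auto
    moreover have "word ps \<in> FC" "word ys \<in> FC" using s xs by (auto intro!: FC_closed)
    ultimately show ?thesis using I_sandwich by metis
  next
    case 3
    then obtain v qs where s: "ys = v # qs" using i by (cases ys) auto
    have "braid_at c i (word xs * r * word ys) = word xs * lin_ext (\<lambda>us. c (hd us) v) r * word qs"
      by (rule fin_linear_eqI[OF L N keys])
        (use 3 s braid_at_word[of c xs _ v qs] in \<open>auto simp: word_mult mult.assoc\<close>)
    moreover have "lin_ext (\<lambda>us. c (hd us) v) r \<in> I"
      using s xs by (intro c_relation_left r) auto
    moreover have "word xs \<in> FC" "word qs \<in> FC" using s xs by (auto intro!: FC_closed)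
    ultimately show ?thesis using I_sandwich by metis
  next
    case 4
    then have "Suc (i - Suc (length xs)) < length ys" using i by simp
    then obtain ps u v qs where s: "ys = ps @ u # v # qs" "length ps = i - Suc (length xs)"
      by (rule split_two_letters)
    have "braid_at c i (word xs * r * word ys) = word xs * r * (word ps * c u v * word qs)"
    proof -
      have "braid_at c i (word xs * word x * word ys) = word xs * word x * (word ps * c u v * word qs)"
        if "x \<in> range (\<lambda>a. [a])" for x
      proof -
        have "word xs * word x * word ys = word ((xs @ x @ ps) @ u # v # qs)"
          by (simp add: word_mult s)
        moreover have "length (xs @ x @ ps) = i" using that s 4 by auto
        ultimately have "braid_at c i (word xs * word x * word ys) = word (xs @ x @ ps) * c u v * word qs"
          using braid_at_word[of c "xs @ x @ ps" u v qs] by simp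
        then show ?thesis by (simp add: word_mult[symmetric] mult.assoc)
      qed
      then show ?thesis
        using fin_linear_eqI[OF L fin_linear_compose[OF fin_linear_mult_right fin_linear_mult_left] keys] by blast
    qed
    moreover have "word ps * c u v * word qs \<in> FC"
      using s xs by (intro FC_closed Fn_FC[OF c_degree]) auto
    moreover have "word xs \<in> FC" "word ys \<in> FC" using xs by (auto intro: FC_closed)
    ultimately show ?thesis using I_sandwich rI by metis
  qed
qed

lemma braid_at_I: "f \<in> I \<Longrightarrow> f \<in> Fn n \<Longrightarrow> Suc i < n \<Longrightarrow> braid_at c i f \<in> I"
  by (rule linear_map_I[OF _ _ braid_at_linear]) (auto intro: braid_at_generator)

lemma braid_word_Fn: "f \<in> Fn n \<Longrightarrow> simple_word n is \<Longrightarrow> braid_word c is f \<in> Fn n"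
  by (induction "is") (auto simp: braid_word_simps intro: braid_at_Fn)

lemma braid_word_I: "f \<in> I \<Longrightarrow> f \<in> Fn n \<Longrightarrow> simple_word n is \<Longrightarrow> braid_word c is f \<in> I"
  by (induction "is") (auto simp: braid_word_simps intro: braid_at_I braid_word_Fn)

lemma braid_word_cong: "f \<approx>\<^sub>I g \<Longrightarrow> f \<in> Fn n \<Longrightarrow> g \<in> Fn n \<Longrightarrow> simple_word n is \<Longrightarrow> braid_word c is f \<approx>\<^sub>I braid_word c is g"
  using braid_word_I[of "f - g" n "is"]
  by (simp add: teq_def fin_linear_diff[OF braid_word_linear] Fn_closed)

lemma braid_at_E:
  assumes "set xs \<subseteq> S" "Suc i < length xs"
  shows "braid_at c i (E xs) \<approx>\<^sub>I E (swap_at i xs)"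
proof -
  obtain ps x y qs where s: "xs = ps @ x # y # qs" "length ps = i"
    by (rule split_two_letters[OF assms(2)])
  have "braid_at c i (E xs) = E ps * c (e x) (e y) * E qs"
    using s braid_at_word[of c "map e ps"] by simp
  also have "\<dots> \<approx>\<^sub>I E ps * word [e (x \<rhd> y), e x] * E qs"
    using assms s by (intro teq_mult_left teq_mult_right c_homogeneous FC_closed) (auto intro!: e_in_U)
  also have "\<dots> = E (swap_at i xs)"
    using s by (simp add: word_mult swap_at_def nth_append list_update_append)
  finally show ?thesis .
qed

lemma braid_word_E:
  assumes "set xs \<subseteq> S" "simple_word (length xs) is"
  shows "braid_word c is (E xs) \<approx>\<^sub>I E (swaps is xs)"
  using assms(2)
proof (induction "is")
  case Nil
  then show ?case by (simp add: braid_word_simps swaps_simps)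
next
  case (Cons i "is")
  have Fn: "E (swaps is xs) \<in> Fn (length xs)"
    using E_Fn[OF set_swaps[OF assms(1)]] Cons.prems by simp
  have "braid_word c [i] (braid_word c is (E xs)) \<approx>\<^sub>I braid_word c [i] (E (swaps is xs))"
    using Cons assms(1) Fn by (intro braid_word_cong[of _ _ "length xs"] braid_word_Fn E_Fn) auto
  also have "\<dots> \<approx>\<^sub>I E (swap_at i (swaps is xs))"
    using braid_at_E[of "swaps is xs" i] set_swaps[OF assms(1)] Cons.prems by (simp add: braid_word_simps)
  finally show ?case by (simp add: braid_word_simps swaps_simps)
qed

lemma quantum_symmetrizer_Fn:
  assumes "f \<in> Fn n" shows "quantum_symmetrizer c n f \<in> Fn n"
  unfolding quantum_symmetrizer_def braid_perm_eq_braid_word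
  by (intro Fn_sum braid_word_Fn[OF assms] chosen_reduced_expression(1)) simp

lemma quantum_symmetrizer_I:
  assumes "f \<in> I" "f \<in> Fn n" shows "quantum_symmetrizer c n f \<in> I"
  unfolding quantum_symmetrizer_def braid_perm_eq_braid_word
  by (intro I_sum braid_word_I[OF assms] chosen_reduced_expression(1)) simp

text \<open>
  On homogeneous words the choice of reduced expressions disappears from the quantum symmetrizer.
\<close>

proposition quantum_symmetrizer_E:
  assumes "set xs \<subseteq> S"
  shows "quantum_symmetrizer c (length xs) (E xs) \<approx>\<^sub>I (\<Sum>\<pi> | \<pi> permutes {..<length xs}. E (braid_result \<pi> xs))"
  unfolding quantum_symmetrizer_def braid_perm_eq_braid_word
proof (rule teq_sum)
  fix \<pi> assume "\<pi> \<in> {\<pi>. \<pi> permutes {..<length xs}}"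
  then have \<pi>: "\<pi> permutes {..<length xs}" by simp
  let ?w = "SOME is. reduced_expression (length xs) \<pi> is"
  have "braid_word c ?w (E xs) \<approx>\<^sub>I E (swaps ?w xs)"
    by (rule braid_word_E[OF assms chosen_reduced_expression(1)[OF \<pi>]])
  then show "braid_word c ?w (E xs) \<approx>\<^sub>I E (braid_result \<pi> xs)"
    using swaps_eq_braid_result[of xs ?w] chosen_reduced_expression[OF \<pi>] assms by simp
qed

lemma E_span_word_left:
  assumes u: "u \<in> U"
  obtains xs where "set xs \<subseteq> S" "word [u] \<approx>\<^sub>I sum_list (map (\<lambda>x. E [x]) xs)"
proof -
  obtain xs where "set xs \<subseteq> S" "u = sum_list (map e xs)" using e_spans[OF u] by blast
  moreover have "word [sum_list (map e xs)] \<approx>\<^sub>I sum_list (map (\<lambda>u. word [u]) (map e xs))"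
    using \<open>set xs \<subseteq> S\<close> by (intro word_sum_list) (auto intro!: e_in_U)
  ultimately show thesis using that[of xs] by (simp add: o_def)
qed

lemma sum_list_closed:
  fixes h :: "'x \<Rightarrow> ('u list \<Rightarrow>\<^sub>0 complex)"
  assumes "P 0" "\<And>f g. P f \<Longrightarrow> P g \<Longrightarrow> P (f + g)" "\<And>x. x \<in> set xs \<Longrightarrow> P (h x)"
  shows "P (sum_list (map h xs))"
  using assms(3) by (induction xs) (auto intro: assms(1,2))

text \<open>
  The tensors that are congruent to combinations of homogeneous words; the rule \<open>Fn_induct\<close> rests on the
  fact that these are all tensors.
\<close>

inductive_set hspan :: "nat \<Rightarrow> ('u list \<Rightarrow>\<^sub>0 complex) set" for n where
  ideal: "f \<in> I \<Longrightarrow> f \<in> Fn n \<Longrightarrow> f \<in> hspan n"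
| add: "f \<in> hspan n \<Longrightarrow> g \<in> hspan n \<Longrightarrow> f + g \<in> hspan n"
| smult: "f \<in> hspan n \<Longrightarrow> smult_fin a f \<in> hspan n"
| homogeneous: "set xs \<subseteq> S \<Longrightarrow> length xs = n \<Longrightarrow> E xs \<in> hspan n"

lemma hspan_Fn: "f \<in> hspan n \<Longrightarrow> f \<in> Fn n"
  by (induction rule: hspan.induct) (use E_Fn in \<open>auto intro: Fn_closed\<close>)

lemma hspan_zero: "0 \<in> hspan n" by (rule hspan.ideal) auto

lemma hspan_word_mult:
  assumes u: "u \<in> U" and f: "f \<in> hspan n"
  shows "word [u] * f \<in> hspan (Suc n)"
  using f
proof (induction rule: hspan.induct)
  case (ideal f)
  moreover have "word [u] \<in> Fn 1" using u by (intro Fn_closed) auto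
  ultimately show ?case
    using Fn_mult[of "word [u]" 1 f n] by (intro hspan.ideal I_mult_left) (auto intro: Fn_FC)
next
  case (add f g)
  then show ?case by (simp add: distrib_left hspan.add)
next
  case (smult f a)
  then show ?case by (simp add: smult_fin_mult_right hspan.smult)
next
  case (homogeneous xs)
  note xs = homogeneous
  obtain ys where ys: "set ys \<subseteq> S" "word [u] \<approx>\<^sub>I sum_list (map (\<lambda>x. E [x]) ys)"
    using E_span_word_left[OF u] .
  have F1: "sum_list (map (\<lambda>x. E [x]) ys) \<in> Fn 1"
    using ys by (intro sum_list_closed[where P = "\<lambda>f. f \<in> Fn 1"]) (auto intro!: Fn_closed e_in_U)
  have "word [u] - sum_list (map (\<lambda>x. E [x]) ys) \<in> Fn 1"
    using u F1 by (intro Fn_closed) auto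
  from Fn_mult[OF this E_Fn[OF xs(1)]] xs(2)
  have F: "(word [u] - sum_list (map (\<lambda>x. E [x]) ys)) * E xs \<in> Fn (Suc n)" by simp
  have "(word [u] - sum_list (map (\<lambda>x. E [x]) ys)) * E xs \<in> hspan (Suc n)"
    using ys(2) F Fn_FC[OF E_Fn[OF xs(1)]] by (intro hspan.ideal I_mult_right) (auto simp: teq_def)
  moreover have "sum_list (map (\<lambda>x. E [x]) ys) * E xs \<in> hspan (Suc n)"
    using ys(1)
  proof (induction ys)
    case Nil
    then show ?case by (simp add: hspan_zero)
  next
    case (Cons y ys)
    then have "E (y # xs) \<in> hspan (Suc n)" using xs by (intro hspan.homogeneous) auto
    moreover have "sum_list (map (\<lambda>x. E [x]) (y # ys)) * E xs = E (y # xs) + sum_list (map (\<lambda>x. E [x]) ys) * E xs"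
      by (simp add: distrib_right word_mult)
    moreover have "sum_list (map (\<lambda>x. E [x]) ys) * E xs \<in> hspan (Suc n)" using Cons by simp
    ultimately show ?case using hspan.add by metis
  qed
  ultimately have "(word [u] - sum_list (map (\<lambda>x. E [x]) ys)) * E xs + sum_list (map (\<lambda>x. E [x]) ys) * E xs \<in> hspan (Suc n)"
    by (rule hspan.add)
  then show ?case by (simp add: left_diff_distrib)
qed

lemma word_hspan: "us \<in> lists U \<Longrightarrow> word us \<in> hspan (length us)"
proof (induction us)
  case Nil
  then show ?case using hspan.homogeneous[of "[]" 0] by simp
next
  case (Cons u us)
  then show ?case using hspan_word_mult[of u "word us" "length us"] by (simp add: word_mult)
qed

lemma Fn_induct [consumes 1, case_names ideal add smult homogeneous]:
  assumes f: "f \<in> Fn n"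
    and P: "\<And>f. f \<in> I \<Longrightarrow> f \<in> Fn n \<Longrightarrow> P f" "\<And>f g. f \<in> Fn n \<Longrightarrow> g \<in> Fn n \<Longrightarrow> P f \<Longrightarrow> P g \<Longrightarrow> P (f + g)"
      "\<And>a f. f \<in> Fn n \<Longrightarrow> P f \<Longrightarrow> P (smult_fin a f)" "\<And>xs. set xs \<subseteq> S \<Longrightarrow> length xs = n \<Longrightarrow> P (E xs)"
  shows "P f"
proof -
  have "f \<in> hspan n"
    using f unfolding Fn_def mem_Collect_eq[of _ "\<lambda>f. Poly_Mapping.keys f \<subseteq> _"]
  proof (induction rule: poly_mapping_span_induct)
    case (single xs a)
    then show ?case using hspan.smult[OF word_hspan[of xs], of a] by (simp add: smult_fin_word)
  qed (auto intro: hspan_zero hspan.add)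
  then show ?thesis
    by (induction rule: hspan.induct) (use hspan_Fn in \<open>auto intro: P\<close>)
qed

end


section \<open>The Nichols algebra as a graded ring\<close>

context braided_tensor_space
begin

abbreviation "QS \<equiv> quantum_symmetrizer c"
lemmas QS_smult = fin_linear_smult[OF quantum_symmetrizer_linear[of c]]
  and QS_add = fin_linear_add[OF quantum_symmetrizer_linear[of c]]
  and QS_zero = fin_linear_zero[OF quantum_symmetrizer_linear[of c]]

lemma linear_cong_on_Fn:
  assumes f: "f \<in> Fn n" and L: "fin_linear L" "fin_linear M"
    and ideal: "\<And>f. f \<in> I \<Longrightarrow> f \<in> Fn n \<Longrightarrow> L f \<in> I \<and> M f \<in> I"
    and hom: "\<And>xs. set xs \<subseteq> S \<Longrightarrow> length xs = n \<Longrightarrow> L (E xs) \<approx>\<^sub>I M (E xs)"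
  shows "L f \<approx>\<^sub>I M f"
  using f
proof (induction rule: Fn_induct)
  case (ideal f)
  then show ?case using assms(4)[of f] by (simp add: teq_def I_diff)
next
  case (add f g)
  then show ?case by (simp add: fin_linear_add[OF L(1)] fin_linear_add[OF L(2)] teq_add)
next
  case (smult a f)
  then show ?case by (simp add: fin_linear_smult[OF L(1)] fin_linear_smult[OF L(2)] teq_smult)
next
  case (homogeneous xs)
  then show ?case by (rule hom)
qed

text \<open>
  Here \<open>A\<close> multiplies by a homogeneous letter, on words this is \<open>ins\<close>, and \<open>W j\<close> moves the new letter to its
  \<open>j\<close>-th possible place. Multiplication on the left and on the right are the two instances, with the
  two decompositions of permutations proved above.
\<close>

lemma QS_insert_letter:
  assumes f: "f \<in> Fn n"
    and A: "fin_linear A" "\<And>h. h \<in> Fn n \<Longrightarrow> A h \<in> Fn (Suc n)" "\<And>h. h \<in> I \<Longrightarrow> A h \<in> I"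
    and ins: "\<And>xs. set xs \<subseteq> S \<Longrightarrow> length xs = n \<Longrightarrow>
      set (ins xs) \<subseteq> S \<and> length (ins xs) = Suc n \<and> A (E xs) = E (ins xs)"
    and W: "\<And>j. j \<le> n \<Longrightarrow> simple_word (Suc n) (W j)"
    and sum: "\<And>xs. set xs \<subseteq> S \<Longrightarrow> length xs = n \<Longrightarrow>
      (\<Sum>\<pi> | \<pi> permutes {..<Suc n}. E (braid_result \<pi> (ins xs))) =
      (\<Sum>j\<le>n. \<Sum>\<pi> | \<pi> permutes {..<n}. E (swaps (W j) (ins (braid_result \<pi> xs))))"
  shows "QS (Suc n) (A f) \<approx>\<^sub>I (\<Sum>j\<le>n. braid_word c (W j) (A (QS n f)))"
proof (rule linear_cong_on_Fn[OF f])
  show "fin_linear (\<lambda>f. QS (Suc n) (A f))"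
    by (rule fin_linear_compose[OF quantum_symmetrizer_linear A(1)])
  show "fin_linear (\<lambda>f. \<Sum>j\<le>n. braid_word c (W j) (A (QS n f)))"
    by (intro fin_linear_sum_map fin_linear_compose[OF braid_word_linear]
        fin_linear_compose[OF A(1) quantum_symmetrizer_linear])
  show "QS (Suc n) (A f) \<in> I \<and> (\<Sum>j\<le>n. braid_word c (W j) (A (QS n f))) \<in> I"
    if f: "f \<in> I" "f \<in> Fn n" for f
  proof
    show "QS (Suc n) (A f) \<in> I" using f by (intro quantum_symmetrizer_I A)
    show "(\<Sum>j\<le>n. braid_word c (W j) (A (QS n f))) \<in> I"
      using f by (intro I_sum braid_word_I[of _ "Suc n"] A quantum_symmetrizer_I quantum_symmetrizer_Fn W) auto
  qed
  show "QS (Suc n) (A (E xs)) \<approx>\<^sub>I (\<Sum>j\<le>n. braid_word c (W j) (A (QS n (E xs))))"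
    if xs: "set xs \<subseteq> S" "length xs = n" for xs
  proof -
    have res: "set (braid_result \<pi> xs) \<subseteq> S" "length (braid_result \<pi> xs) = n" if "\<pi> permutes {..<n}" for \<pi>
    proof -
      obtain "is" where "simple_word n is" "tprod is = \<pi>" "ascending is"
        using exists_ascending_word[OF \<open>\<pi> permutes {..<n}\<close>] by blast
      then show "set (braid_result \<pi> xs) \<subseteq> S"
        using swaps_eq_braid_result[of xs "is"] set_swaps[of xs "is"] xs by simp
    qed (simp add: xs)
    have E_res: "E (braid_result \<pi> xs) \<in> Fn n" if "\<pi> permutes {..<n}" for \<pi>
      using E_Fn[OF res(1)[OF that]] xs(2) by simp
    have "QS (Suc n) (A (E xs)) = QS (length (ins xs)) (E (ins xs))"
      using ins[OF xs] by simp
    also have "\<dots> \<approx>\<^sub>I (\<Sum>\<pi> | \<pi> permutes {..<length (ins xs)}. E (braid_result \<pi> (ins xs)))"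
      using ins[OF xs] by (intro quantum_symmetrizer_E) auto
    also have "\<dots> = (\<Sum>j\<le>n. \<Sum>\<pi> | \<pi> permutes {..<n}. E (swaps (W j) (ins (braid_result \<pi> xs))))"
      using sum[OF xs] ins[OF xs] by simp
    also have "\<dots> \<approx>\<^sub>I (\<Sum>j\<le>n. braid_word c (W j) (A (QS n (E xs))))"
    proof (rule teq_sum)
      fix j assume "j \<in> {..n}"
      then have j: "j \<le> n" by simp
      have "(\<Sum>\<pi> | \<pi> permutes {..<n}. E (swaps (W j) (ins (braid_result \<pi> xs)))) \<approx>\<^sub>I
          (\<Sum>\<pi> | \<pi> permutes {..<n}. braid_word c (W j) (A (E (braid_result \<pi> xs))))"
      proof (rule teq_sum)
        fix \<pi> assume "\<pi> \<in> {\<pi>. \<pi> permutes {..<n}}"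
        then have i: "set (ins (braid_result \<pi> xs)) \<subseteq> S" "length (ins (braid_result \<pi> xs)) = Suc n"
          "A (E (braid_result \<pi> xs)) = E (ins (braid_result \<pi> xs))"
          using ins res by auto
        from i(2) W[OF j] have "simple_word (length (ins (braid_result \<pi> xs))) (W j)" by simp
        from teq_sym[OF braid_word_E[OF i(1) this]]
        show "E (swaps (W j) (ins (braid_result \<pi> xs))) \<approx>\<^sub>I braid_word c (W j) (A (E (braid_result \<pi> xs)))"
          by (simp only: i(3))
      qed
      also have "\<dots> = braid_word c (W j) (A (\<Sum>\<pi> | \<pi> permutes {..<n}. E (braid_result \<pi> xs)))"
        by (simp only: fin_linear_sum[OF braid_word_linear] fin_linear_sum[OF A(1)])
      also have "\<dots> \<approx>\<^sub>I braid_word c (W j) (A (QS n (E xs)))"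
      proof (rule braid_word_cong[OF _ _ _ W[OF j]])
        have QS: "(\<Sum>\<pi> | \<pi> permutes {..<n}. E (braid_result \<pi> xs)) \<approx>\<^sub>I QS n (E xs)"
          using teq_sym[OF quantum_symmetrizer_E[OF xs(1)]] xs(2) by simp
        then show "A (\<Sum>\<pi> | \<pi> permutes {..<n}. E (braid_result \<pi> xs)) \<approx>\<^sub>I A (QS n (E xs))"
          using A(3) by (simp add: teq_def flip: fin_linear_diff[OF A(1)])
        show "A (\<Sum>\<pi> | \<pi> permutes {..<n}. E (braid_result \<pi> xs)) \<in> Fn (Suc n)"
          using E_res by (intro A(2) Fn_sum) simp
        show "A (QS n (E xs)) \<in> Fn (Suc n)"
          using E_Fn[OF xs(1)] xs(2) by (intro A(2) quantum_symmetrizer_Fn) simp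
      qed
      finally show "(\<Sum>\<pi> | \<pi> permutes {..<n}. E (swaps (W j) (ins (braid_result \<pi> xs))))
          \<approx>\<^sub>I braid_word c (W j) (A (QS n (E xs)))" .
    qed
    finally show ?thesis .
  qed
qed

lemma QS_letter_mult_kernel:
  assumes f: "f \<in> Fn n" "QS n f \<in> I" and x: "x \<in> S"
  shows "QS (Suc n) (E [x] * f) \<in> I" "QS (Suc n) (f * E [x]) \<in> I"
proof -
  have E1: "E [x] \<in> Fn 1" "E [x] \<in> FC" using x by (auto intro!: Fn_closed FC_closed e_in_U)
  have QSf: "QS n f \<in> Fn n" using f(1) by (rule quantum_symmetrizer_Fn)
  have "QS (Suc n) (E [x] * f) \<approx>\<^sub>I (\<Sum>j\<le>n. braid_word c (rev [0..<j]) (E [x] * QS n f))"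
    using Fn_mult[OF E1(1)] I_mult_left[OF _ E1(2)] x
    by (intro QS_insert_letter[where A = "\<lambda>h. E [x] * h" and ins = "\<lambda>xs. x # xs" and W = "\<lambda>j. rev [0..<j]"]
        f fin_linear_mult_left simple_word_upt sum_braid_result_Cons) (auto simp: word_mult)
  moreover have "(\<Sum>j\<le>n. braid_word c (rev [0..<j]) (E [x] * QS n f)) \<in> I"
    using Fn_mult[OF E1(1) QSf] f E1
    by (intro I_sum braid_word_I[of _ "Suc n"] I_mult_left simple_word_upt) auto
  ultimately show "QS (Suc n) (E [x] * f) \<in> I" by (simp add: teq_I)
  have "QS (Suc n) (f * E [x]) \<approx>\<^sub>I (\<Sum>j\<le>n. braid_word c [j..<n] (QS n f * E [x]))"
    using Fn_mult[OF _ E1(1)] I_mult_right[OF _ E1(2)] x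
    by (intro QS_insert_letter[where A = "\<lambda>h. h * E [x]" and ins = "\<lambda>xs. xs @ [x]" and W = "\<lambda>j. [j..<n]"]
        f fin_linear_mult_right simple_word_upt sum_braid_result_snoc) (auto simp: word_mult)
  moreover have "(\<Sum>j\<le>n. braid_word c [j..<n] (QS n f * E [x])) \<in> I"
    using Fn_mult[OF QSf E1(1)] f E1
    by (intro I_sum braid_word_I[of _ "Suc n"] I_mult_right simple_word_upt) auto
  ultimately show "QS (Suc n) (f * E [x]) \<in> I" by (simp add: teq_I)
qed

text \<open>
  Every homogeneous component has to be annihilated; this includes degrees \<open>0\<close> and \<open>1\<close>, where the symmetrizer is
  the identity and the condition says that the component vanishes in the tensor algebra.
\<close>

definition kernel :: "('u list \<Rightarrow>\<^sub>0 complex) set"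
  where "kernel = {f \<in> FC. \<forall>n. QS n (hcomp n f) \<in> I}"

lemma kernel_FC: "f \<in> kernel \<Longrightarrow> f \<in> FC" by (simp add: kernel_def)
lemma I_kernel: "f \<in> I \<Longrightarrow> f \<in> kernel"
  using I_carrier hcomp_I hcomp_in_Fn quantum_symmetrizer_I by (auto simp: kernel_def)
lemma kernel_zero: "0 \<in> kernel" by (rule I_kernel) simp
lemma kernel_add: "f \<in> kernel \<Longrightarrow> g \<in> kernel \<Longrightarrow> f + g \<in> kernel"
  by (auto simp: kernel_def hcomp_add QS_add I_add)
lemma kernel_smult: "f \<in> kernel \<Longrightarrow> smult_fin a f \<in> kernel"
  by (auto simp: kernel_def hcomp_smult QS_smult I_smult)
lemma kernel_sum: "(\<And>x. x \<in> X \<Longrightarrow> f x \<in> kernel) \<Longrightarrow> sum f X \<in> kernel"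
  by (induction X rule: infinite_finite_induct) (auto intro: kernel_add kernel_zero)

lemma kernel_E_mult:
  assumes f: "f \<in> kernel" and x: "x \<in> S"
  shows "E [x] * f \<in> kernel" "f * E [x] \<in> kernel"
proof -
  have E1: "E [x] \<in> FC" using x by (auto intro!: FC_closed e_in_U)
  have h: "hcomp n f \<in> Fn n" "QS n (hcomp n f) \<in> I" for n
    using f hcomp_in_Fn[of f n] by (auto simp: kernel_def)
  have "QS n (hcomp n (E [x] * f)) \<in> I" for n
    using QS_letter_mult_kernel(1)[OF h x] hcomp_word_mult[of "map e [x]" _ f]
    by (cases n) (simp_all add: hcomp_0_word_mult QS_zero)
  then show "E [x] * f \<in> kernel" using f E1 by (auto simp: kernel_def)
  have "QS n (hcomp n (f * E [x])) \<in> I" for n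
    using QS_letter_mult_kernel(2)[OF h x] hcomp_mult_word[of _ "map e [x]" f]
    by (cases n) (simp_all add: hcomp_0_word_mult QS_zero)
  then show "f * E [x] \<in> kernel" using f E1 by (auto simp: kernel_def)
qed

text \<open>
  An arbitrary letter is congruent to a sum of homogeneous ones.
\<close>

lemma kernel_letter_mult:
  assumes f: "f \<in> kernel" and u: "u \<in> U"
  shows "word [u] * f \<in> kernel" "f * word [u] \<in> kernel"
proof -
  obtain ys where ys: "set ys \<subseteq> S" "word [u] \<approx>\<^sub>I sum_list (map (\<lambda>x. E [x]) ys)"
    using E_span_word_left[OF u] .
  let ?s = "sum_list (map (\<lambda>x. E [x]) ys)"
  have d: "word [u] - ?s \<in> I" using ys(2) by (simp add: teq_def)
  have "?s * f \<in> kernel \<and> f * ?s \<in> kernel"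
    using ys(1)
    by (induction ys) (auto simp: kernel_zero distrib_left distrib_right kernel_E_mult[OF f, simplified] intro!: kernel_add)
  moreover have "(word [u] - ?s) * f \<in> kernel" "f * (word [u] - ?s) \<in> kernel"
    using I_mult_right[OF d kernel_FC[OF f]] I_mult_left[OF d kernel_FC[OF f]] I_kernel by auto
  ultimately have "(word [u] - ?s) * f + ?s * f \<in> kernel" "f * (word [u] - ?s) + f * ?s \<in> kernel"
    by (auto intro: kernel_add)
  then show "word [u] * f \<in> kernel" "f * word [u] \<in> kernel"
    by (simp_all add: left_diff_distrib right_diff_distrib)
qed

lemma kernel_mult:
  assumes f: "f \<in> kernel" and g: "g \<in> FC"
  shows "g * f \<in> kernel \<and> f * g \<in> kernel"
proof -
  have word: "word us * f \<in> kernel \<and> f * word us \<in> kernel" if "us \<in> lists U" for us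
    using that f
  proof (induction us arbitrary: f)
    case Nil
    then show ?case by (simp add: word_Nil)
  next
    case (Cons u us)
    have "word (u # us) * f = word [u] * (word us * f)" "f * word (u # us) = (f * word [u]) * word us"
      by (simp_all add: mult.assoc[symmetric] word_mult) (simp add: mult.assoc word_mult)
    then show ?case using Cons kernel_letter_mult by simp
  qed
  show ?thesis
    using g unfolding FC_def mem_Collect_eq
  proof (induction rule: poly_mapping_span_induct)
    case (single xs a)
    then show ?case using word[of xs]
      by (simp add: smult_fin_word[symmetric] smult_fin_mult_left smult_fin_mult_right kernel_smult)
  qed (auto simp: distrib_left distrib_right kernel_zero kernel_add)
qed

lemma ideal_kernel: "ideal kernel Fr"
proof (rule idealI[OF ring_free_algebra])
  show "subgroup kernel (add_monoid Fr)"
  proof (rule group.subgroupI)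
    show "Group.group (add_monoid Fr)"
      using abelian_group.a_group[OF ring.is_abelian_group[OF ring_free_algebra]] .
    show "kernel \<subseteq> carrier (add_monoid Fr)" using kernel_FC by (auto simp: FC_def)
    show "kernel \<noteq> {}" using kernel_zero by blast
    show "inv\<^bsub>add_monoid Fr\<^esub> a \<in> kernel" if "a \<in> kernel" for a
    proof -
      have m: "- a \<in> kernel" using kernel_smult[OF that, of "-1"] by (simp add: smult_fin_minus_one)
      have "\<ominus>\<^bsub>Fr\<^esub> a = - a"
        by (rule abelian_group.minus_equality[OF ring.is_abelian_group[OF ring_free_algebra]])
          (use kernel_FC[OF that] kernel_FC[OF m] in \<open>simp_all add: FC_def\<close>)
      with m show ?thesis by (simp add: a_inv_def)
    qed
    show "a \<otimes>\<^bsub>add_monoid Fr\<^esub> b \<in> kernel" if "a \<in> kernel" "b \<in> kernel" for a b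
      using that by (simp add: kernel_add)
  qed
qed (use kernel_mult in \<open>auto simp: FC_def free_algebra_mult\<close>)

abbreviation "TA \<equiv> tensor_algebra scale U"
abbreviation tensor_class :: "('u list \<Rightarrow>\<^sub>0 complex) \<Rightarrow> ('u list \<Rightarrow>\<^sub>0 complex) set" where "tensor_class f \<equiv> I +>\<^bsub>Fr\<^esub> f"

lemma ring_TA: "ring TA"
  unfolding tensor_algebra_def by (rule ideal.quotient_is_ring[OF ideal_I])

lemma tensor_class_hom: "tensor_class \<in> ring_hom Fr TA"
  unfolding tensor_algebra_def by (rule ideal.rcos_ring_hom[OF ideal_I])

lemma tensor_class_eq: "f \<in> FC \<Longrightarrow> g \<in> FC \<Longrightarrow> tensor_class f = tensor_class g \<longleftrightarrow> f \<approx>\<^sub>I g"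
proof -
  assume fg: "f \<in> FC" "g \<in> FC"
  have "a_minus Fr f g = f - g"
  proof -
    have "\<ominus>\<^bsub>Fr\<^esub> g = - g"
      by (rule abelian_group.minus_equality[OF ring.is_abelian_group[OF ring_free_algebra]])
        (use fg in \<open>simp_all add: FC_def\<close>)
    then show ?thesis by (simp add: a_minus_def)
  qed
  then show ?thesis
    using ring.quotient_eq_iff_same_a_r_cos[OF ring_free_algebra ideal_I, of f g] fg
    by (auto simp: teq_def FC_def)
qed

lemma tensor_class_add: "f \<in> FC \<Longrightarrow> g \<in> FC \<Longrightarrow> tensor_class (f + g) = tensor_class f \<oplus>\<^bsub>TA\<^esub> tensor_class g"
  using ring_hom_add[OF tensor_class_hom, of f g] by (simp add: FC_def)

lemma tensor_class_closed: "f \<in> FC \<Longrightarrow> tensor_class f \<in> carrier TA"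
  using ring_hom_closed[OF tensor_class_hom, of f] by (simp add: FC_def)

lemma finsum_cls:
  assumes "finite X" "\<And>n. n \<in> X \<Longrightarrow> f n \<in> FC" "\<And>n. n \<in> X \<Longrightarrow> x n = tensor_class (f n)"
  shows "finsum TA x X = tensor_class (sum f X) \<and> sum f X \<in> FC"
proof -
  interpret TA: ring TA by (rule ring_TA)
  show ?thesis using assms
  proof (induction X)
    case empty
    have "tensor_class 0 = \<zero>\<^bsub>TA\<^esub>" using ring_hom_zero[OF tensor_class_hom ring_free_algebra ring_TA] by simp
    then show ?case by (auto intro: FC_closed)
  next
    case (insert a X)
    then show ?case
      by (subst TA.finsum_insert) (auto simp: tensor_class_add tensor_class_closed intro: FC_closed)
  qed
qed

text \<open>
  The ideal that defines the Nichols algebra consists of sums of homogeneous elements of degree at least two. This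
  is the image of \<^term>\<open>kernel\<close>, the components of degree \<open>0\<close> and \<open>1\<close> being zero in the tensor algebra.
\<close>

proposition nichols_ideal_eq: "nichols_ideal scale U c = tensor_class ` kernel"
proof (intro equalityI subsetI)
  fix z assume "z \<in> nichols_ideal scale U c"
  then obtain x m where z: "z = finsum TA x {2..m}" and x: "x \<in> (\<Pi> n\<in>{2..m}. symmetrizer_kernel scale U c n)"
    by (auto simp: nichols_ideal_def)
  have "\<exists>f. x n = tensor_class f \<and> f \<in> Fn n \<and> QS n f \<in> I" if "n \<in> {2..m}" for n
    using x that by (fastforce simp: symmetrizer_kernel_def Fn_def)
  then obtain f where f: "\<And>n. n \<in> {2..m} \<Longrightarrow> x n = tensor_class (f n) \<and> f n \<in> Fn n \<and> QS n (f n) \<in> I"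
    by metis
  have "f n \<in> kernel" if "n \<in> {2..m}" for n
    using f[OF that] Fn_FC by (auto simp: kernel_def hcomp_Fn QS_zero)
  then have "sum f {2..m} \<in> kernel" by (rule kernel_sum)
  moreover have "z = tensor_class (sum f {2..m})"
    using finsum_cls[of "{2..m}" f x] f Fn_FC z by auto
  ultimately show "z \<in> tensor_class ` kernel" by blast
next
  fix z assume "z \<in> tensor_class ` kernel"
  then obtain f where f: "f \<in> kernel" "z = tensor_class f" by blast
  have fF: "f \<in> FC" using f(1) by (rule kernel_FC)
  define m where "m = Max (insert 2 (length ` Poly_Mapping.keys f))"
  have m: "2 \<le> m" "\<And>xs. xs \<in> Poly_Mapping.keys f \<Longrightarrow> length xs \<le> m" by (auto simp: m_def)
  have low: "hcomp n f \<in> I" if "n \<le> 1" for n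
    using f(1) quantum_symmetrizer_small[OF that, of c "hcomp n f"] unfolding kernel_def by (metis (no_types, lifting) mem_Collect_eq)
  have "{..m} = {2..m} \<union> {0, 1}" using m(1) by auto
  then have "f = sum (\<lambda>n. hcomp n f) {2..m} + sum (\<lambda>n. hcomp n f) {0, 1}"
    using sum_hcomp[of f m] m(2) sum.union_disjoint[of "{2..m}" "{0, 1}" "\<lambda>n. hcomp n f"] by simp
  moreover have "sum (\<lambda>n. hcomp n f) {0, 1} \<in> I" using low by (intro I_sum) auto
  ultimately have "f \<approx>\<^sub>I sum (\<lambda>n. hcomp n f) {2..m}"
    unfolding teq_def by (metis add_diff_cancel_left')
  moreover have s: "finsum TA (\<lambda>n. tensor_class (hcomp n f)) {2..m} = tensor_class (sum (\<lambda>n. hcomp n f) {2..m})"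
      "sum (\<lambda>n. hcomp n f) {2..m} \<in> FC"
    using finsum_cls[of "{2..m}" "\<lambda>n. hcomp n f" "\<lambda>n. tensor_class (hcomp n f)"] hcomp_in_Fn[OF fF] Fn_FC by auto
  ultimately have "z = finsum TA (\<lambda>n. tensor_class (hcomp n f)) {2..m}"
    using f(2) tensor_class_eq[OF fF s(2)] by simp
  moreover have "(\<lambda>n. tensor_class (hcomp n f)) \<in> (\<Pi> n\<in>{2..m}. symmetrizer_kernel scale U c n)"
  proof (rule Pi_I)
    fix n
    have "hcomp n f \<in> Fn n" "QS n (hcomp n f) \<in> I"
      using f(1) hcomp_in_Fn[OF fF] by (auto simp: kernel_def)
    then show "tensor_class (hcomp n f) \<in> symmetrizer_kernel scale U c n"
      by (auto simp: symmetrizer_kernel_def Fn_def)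
  qed
  ultimately show "z \<in> nichols_ideal scale U c"
    unfolding nichols_ideal_def by blast
qed

abbreviation "NI \<equiv> nichols_ideal scale U c"
abbreviation "NA \<equiv> nichols_algebra scale U c"

lemma ideal_NI: "ideal NI TA"
  unfolding nichols_ideal_eq tensor_algebra_def
  by (rule ring.ring_ideal_imp_quot_ideal[OF ring_free_algebra ideal_I ideal_kernel])

lemma ring_NA: "ring NA"
  unfolding nichols_algebra_def by (rule ideal.quotient_is_ring[OF ideal_NI])

definition nichols_class :: "('u list \<Rightarrow>\<^sub>0 complex) \<Rightarrow> ('u list \<Rightarrow>\<^sub>0 complex) set set"
  where "nichols_class f = NI +>\<^bsub>TA\<^esub> tensor_class f"

lemma nichols_class_hom: "nichols_class \<in> ring_hom Fr NA"
  using ring_hom_trans[OF tensor_class_hom ideal.rcos_ring_hom[OF ideal_NI]]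
  by (simp add: nichols_algebra_def nichols_class_def[abs_def] o_def)

lemma nichols_class_add: "f \<in> FC \<Longrightarrow> g \<in> FC \<Longrightarrow> nichols_class (f + g) = nichols_class f \<oplus>\<^bsub>NA\<^esub> nichols_class g"
  using ring_hom_add[OF nichols_class_hom, of f g] by (simp add: FC_def)
lemma nichols_class_mult: "f \<in> FC \<Longrightarrow> g \<in> FC \<Longrightarrow> nichols_class (f * g) = nichols_class f \<otimes>\<^bsub>NA\<^esub> nichols_class g"
  using ring_hom_mult[OF nichols_class_hom, of f g] by (simp add: FC_def free_algebra_mult)
lemma nichols_class_zero: "nichols_class 0 = \<zero>\<^bsub>NA\<^esub>"
  using ring_hom_zero[OF nichols_class_hom ring_free_algebra ring_NA] by simp

lemma carrier_NA: "carrier NA = nichols_class ` FC"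
  by (auto simp: nichols_algebra_def tensor_algebra_def FactRing_def A_RCOSETS_defs a_r_coset_def nichols_class_def FC_def)

lemma nichols_class_eq: 
  assumes "f \<in> FC" "g \<in> FC" "nichols_class f = nichols_class g"
  shows "f - g \<in> kernel"
proof -
  interpret TA: ring TA by (rule ring_TA)
  have d: "f - g \<in> FC" using assms by (intro FC_closed)
  have "a_minus TA (tensor_class f) (tensor_class g) \<in> NI"
    using ring.quotient_eq_iff_same_a_r_cos[OF ring_TA ideal_NI, of "tensor_class f" "tensor_class g"] assms tensor_class_closed
    by (auto simp: nichols_class_def)
  moreover have "tensor_class f = tensor_class (f - g) \<oplus>\<^bsub>TA\<^esub> tensor_class g"
    using tensor_class_add[OF d assms(2)] by simp
  then have "a_minus TA (tensor_class f) (tensor_class g) = tensor_class (f - g)"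
    using tensor_class_closed[OF d] tensor_class_closed[OF assms(2)] by (simp add: a_minus_def TA.a_assoc TA.r_neg)
  ultimately obtain k where k: "k \<in> kernel" "tensor_class (f - g) = tensor_class k"
    unfolding nichols_ideal_eq by auto
  then have "f - g \<approx>\<^sub>I k" using tensor_class_eq[OF d kernel_FC] by simp
  then have "(f - g) - k \<in> kernel" by (simp add: teq_def I_kernel)
  from kernel_add[OF this k(1)] show ?thesis by simp
qed

lemma scalars_eq: "nichols_scalars scale U c = range (\<lambda>a. nichols_class (smult_fin a (word [])))"
  by (auto simp: nichols_scalars_def nichols_class_def)

text \<open>
  A subspace of finite dimension arises by adjoining finitely many vectors, and multiplication by scalars does not
  raise degrees.
\<close>

lemma dimension_bounded_degree:
  assumes "ring.dimension NA n K X" "K = nichols_scalars scale U c"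
  shows "\<exists>D. \<forall>x\<in>X. \<exists>f\<in>FC. x = nichols_class f \<and> (\<forall>xs\<in>Poly_Mapping.keys f. length xs \<le> D)"
  using assms
proof (induction rule: ring.dimension.induct[OF ring_NA, consumes 1, case_names zero step])
  case (zero K)
  show ?case by (intro exI[of _ 0]) (auto simp: nichols_class_zero intro!: bexI[of _ 0])
next
  case (step v X n K)
  then obtain D where D: "\<forall>x\<in>X. \<exists>f\<in>FC. x = nichols_class f \<and> (\<forall>xs\<in>Poly_Mapping.keys f. length xs \<le> D)" by blast
  obtain h where h: "h \<in> FC" "v = nichols_class h" using step by (auto simp: carrier_NA)
  define D' where "D' = Max (insert D (length ` Poly_Mapping.keys h))"
  have D': "D \<le> D'" "\<And>xs. xs \<in> Poly_Mapping.keys h \<Longrightarrow> length xs \<le> D'" by (auto simp: D'_def)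
  show ?case
  proof (intro exI[of _ D'] ballI)
    fix x assume "x \<in> ring.line_extension NA K v X"
    then have "x \<in> (K #>\<^bsub>NA\<^esub> v) <+>\<^bsub>NA\<^esub> X"
      unfolding ring.line_extension_def[OF ring_NA] .
    then obtain z y where zy: "z \<in> K #>\<^bsub>NA\<^esub> v" "y \<in> X" "x = z \<oplus>\<^bsub>NA\<^esub> y"
      by (auto simp: set_add_def set_mult_def)
    then obtain k where ky: "k \<in> K" "y \<in> X" "x = k \<otimes>\<^bsub>NA\<^esub> v \<oplus>\<^bsub>NA\<^esub> y"
      unfolding r_coset_def by blast
    obtain a where k: "k = nichols_class (smult_fin a (word []))"
      using ky(1)[unfolded step.prems scalars_eq] by (rule rangeE)
    obtain f where f: "f \<in> FC" "y = nichols_class f" "\<And>xs. xs \<in> Poly_Mapping.keys f \<Longrightarrow> length xs \<le> D"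
      using bspec[OF D ky(2)] by (elim bexE conjE) (rule that, auto)
    have w: "smult_fin a (word []) \<in> FC" by (intro FC_closed) auto
    have "x = nichols_class (smult_fin a h + f)"
    proof -
      have "nichols_class (smult_fin a h) = k \<otimes>\<^bsub>NA\<^esub> v"
        using nichols_class_mult[OF w h(1)] k h(2) by (simp add: smult_fin_mult_left word_Nil)
      then show ?thesis using nichols_class_add[OF FC_closed(5)[OF h(1)] f(1)] ky f(2) by simp
    qed
    moreover have "Poly_Mapping.keys (smult_fin a h + f) \<subseteq> {xs. length xs \<le> D'}"
      using D' f(3) by (intro keys_subset_add keys_subset_smult) (auto intro: order_trans)
    moreover have "smult_fin a h + f \<in> FC" using h f by (intro FC_closed)
    ultimately show "\<exists>f\<in>FC. x = nichols_class f \<and> (\<forall>xs\<in>Poly_Mapping.keys f. length xs \<le> D')" by blast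
  qed
qed

text \<open>
  Since the kernel is graded, an element of degree \<open>n\<close> that the symmetrizer does not annihilate has no
  representative of smaller degree.
\<close>

proposition infinite_dimension_criterion:
  assumes "\<And>D. \<exists>n > D. \<exists>f \<in> Fn n. QS n f \<notin> I"
  shows "ring.infinite_dimension NA (nichols_scalars scale U c) (carrier NA)"
proof
  assume "ring.finite_dimension NA (nichols_scalars scale U c) (carrier NA)"
  then obtain n where "ring.dimension NA n (nichols_scalars scale U c) (carrier NA)"
    unfolding ring.finite_dimension_def[OF ring_NA] by blast
  then obtain D where D: "\<forall>x\<in>carrier NA. \<exists>f\<in>FC. x = nichols_class f \<and> (\<forall>xs\<in>Poly_Mapping.keys f. length xs \<le> D)"
    using dimension_bounded_degree by blast
  obtain m f where m: "m > D" and f: "f \<in> Fn m" "QS m f \<notin> I" using assms by blast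
  obtain g where g: "g \<in> FC" "nichols_class f = nichols_class g" "\<forall>xs\<in>Poly_Mapping.keys g. length xs \<le> D"
    using D Fn_FC[OF f(1)] by (auto simp: carrier_NA)
  have "f - g \<in> kernel" by (rule nichols_class_eq[OF Fn_FC[OF f(1)] g(1,2)])
  moreover have "hcomp m g = 0"
    using keys_hcomp[of m g] g(3) m by (subst keys_eq_empty[symmetric]) fastforce
  ultimately have "QS m f \<in> I"
    using hcomp_Fn[OF f(1), of m] by (auto simp: kernel_def hcomp_diff dest!: spec[of _ m])
  with f(2) show False ..
qed

end


section \<open>Skew derivations and the braiding of sign type\<close>

text \<open>
  The braiding considered from here on is \<open>x \<otimes> y \<mapsto> - (x \<rhd> y) \<otimes> x\<close>. A letter that passes over a word acts on
  all its letters and picks up a sign for each of them.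
\<close>

definition skew_aut :: "('l \<Rightarrow> 'l \<Rightarrow> 'l) \<Rightarrow> 'l \<Rightarrow> ('l list \<Rightarrow>\<^sub>0 complex) \<Rightarrow> ('l list \<Rightarrow>\<^sub>0 complex)"
  where "skew_aut st x = lin_ext (\<lambda>ys. smult_fin ((-1) ^ length ys) (word (map (st x) ys)))"

text \<open>
  Moves one letter \<open>x\<close> to the end of the word, past everything behind it, and deletes it there.
\<close>

definition skew_deriv :: "('l \<Rightarrow> 'l \<Rightarrow> 'l) \<Rightarrow> 'l \<Rightarrow> ('l list \<Rightarrow>\<^sub>0 complex) \<Rightarrow> ('l list \<Rightarrow>\<^sub>0 complex)"
  where "skew_deriv st x = lin_ext (\<lambda>ys. \<Sum>j<length ys.
    if ys ! j = x then word (take j ys) * skew_aut st x (word (drop (Suc j) ys)) else 0)"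

lemma skew_aut_linear: "fin_linear (skew_aut st x)" by (simp add: skew_aut_def)
lemma skew_deriv_linear: "fin_linear (skew_deriv st x)" by (simp add: skew_deriv_def)

lemma skew_aut_word: "skew_aut st x (word ys) = smult_fin ((-1) ^ length ys) (word (map (st x) ys))"
  by (simp add: skew_aut_def)

lemma skew_deriv_Nil: "skew_deriv st x (word []) = 0"
  by (simp add: skew_deriv_def)

lemma skew_deriv_Cons:
  "skew_deriv st x (word (y # ys)) = (if y = x then skew_aut st x (word ys) else 0) + word [y] * skew_deriv st x (word ys)"
proof -
  have 1: "word (y # take j ys) * F = word [y] * (word (take j ys) * F)" for j F
    by (simp add: mult.assoc[symmetric] word_mult)
  have 2: "(\<Sum>i<length ys. if (y # ys) ! Suc i = x then word (take (Suc i) (y # ys)) * skew_aut st x (word (drop (Suc (Suc i)) (y # ys))) else 0)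
      = word [y] * skew_deriv st x (word ys)"
    unfolding skew_deriv_def lin_ext_word sum_distrib_left by (rule sum.cong) (auto simp: 1)
  show ?thesis
    unfolding 2[symmetric] by (simp only: skew_deriv_def lin_ext_word length_Cons sum.lessThan_Suc_shift) (simp add: word_Nil)
qed

lemma fin_bilinear_eqI:
  fixes f :: "'a list \<Rightarrow>\<^sub>0 complex" and g :: "'b list \<Rightarrow>\<^sub>0 complex"
  assumes "\<And>g. fin_linear (\<lambda>f. B f g)" "\<And>f. fin_linear (B f)" "\<And>g. fin_linear (\<lambda>f. B' f g)" "\<And>f. fin_linear (B' f)"
    "\<And>x y. B (word x) (word y) = B' (word x) (word y)"
  shows "B f g = B' f g"
proof (rule fin_linear_eqI[OF assms(1,3) subset_UNIV])
  fix x
  show "B (word x) g = B' (word x) g"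
    by (rule fin_linear_eqI[OF assms(2,4) subset_UNIV]) (rule assms(5))
qed

lemma skew_aut_mult: "skew_aut st x (f * g) = skew_aut st x f * skew_aut st x g"
proof (rule fin_bilinear_eqI[where B = "\<lambda>f g. skew_aut st x (f * g)" and B' = "\<lambda>f g. skew_aut st x f * skew_aut st x g"])
  show "fin_linear (\<lambda>f. skew_aut st x (f * g))" "fin_linear (\<lambda>g. skew_aut st x (f * g))"
    "fin_linear (\<lambda>f. skew_aut st x f * skew_aut st x g)" "fin_linear (\<lambda>g. skew_aut st x f * skew_aut st x g)" for f g
    by (rule fin_linear_compose[OF skew_aut_linear fin_linear_mult_right] fin_linear_compose[OF skew_aut_linear fin_linear_mult_left]
        fin_linear_compose[OF fin_linear_mult_right skew_aut_linear] fin_linear_compose[OF fin_linear_mult_left skew_aut_linear])+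
  show "skew_aut st x (word as * word bs) = skew_aut st x (word as) * skew_aut st x (word bs)" for as bs
    by (simp add: skew_aut_word word_mult smult_fin_mult_left smult_fin_mult_right power_add mult.commute)
qed

lemma skew_deriv_mult: "skew_deriv st x (f * g) = f * skew_deriv st x g + skew_deriv st x f * skew_aut st x g"
proof (rule fin_bilinear_eqI[where B = "\<lambda>f g. skew_deriv st x (f * g)" and B' = "\<lambda>f g. f * skew_deriv st x g + skew_deriv st x f * skew_aut st x g"])
  show "fin_linear (\<lambda>f. skew_deriv st x (f * g))" "fin_linear (\<lambda>g. skew_deriv st x (f * g))" for f g
    by (rule fin_linear_compose[OF skew_deriv_linear fin_linear_mult_right] fin_linear_compose[OF skew_deriv_linear fin_linear_mult_left])+
  show "fin_linear (\<lambda>f. f * skew_deriv st x g + skew_deriv st x f * skew_aut st x g)" for g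
    by (intro fin_linear_plus fin_linear_mult_right fin_linear_compose[OF fin_linear_mult_right skew_deriv_linear])
  show "fin_linear (\<lambda>g. f * skew_deriv st x g + skew_deriv st x f * skew_aut st x g)" for f
    by (intro fin_linear_plus fin_linear_compose[OF fin_linear_mult_left skew_deriv_linear] fin_linear_compose[OF fin_linear_mult_left skew_aut_linear])
  show "skew_deriv st x (word as * word bs) = word as * skew_deriv st x (word bs) + skew_deriv st x (word as) * skew_aut st x (word bs)" for as bs
  proof (induction as)
    case Nil
    then show ?case by (simp add: skew_deriv_Nil word_mult) (simp add: word_Nil)
  next
    case (Cons y as)
    have "skew_deriv st x (word (y # as) * word bs) = (if y = x then skew_aut st x (word as * word bs) else 0) + word [y] * skew_deriv st x (word as * word bs)"
      by (simp add: word_mult skew_deriv_Cons)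
    also have "\<dots> = word (y # as) * skew_deriv st x (word bs) + skew_deriv st x (word (y # as)) * skew_aut st x (word bs)"
    proof -
      have "word (y # as) = word [y] * word as" by (simp add: word_mult)
      then show ?thesis
        unfolding Cons.IH skew_deriv_Cons by (simp add: skew_aut_mult distrib_left distrib_right mult.assoc)
    qed
    finally show ?case .
  qed
qed

lemma keys_skew_deriv:
  assumes "Poly_Mapping.keys f \<subseteq> lists A" "x \<in> A" "\<And>y. y \<in> A \<Longrightarrow> st x y \<in> A"
  shows "Poly_Mapping.keys (skew_deriv st x f) \<subseteq> lists A"
  unfolding skew_deriv_def
proof (rule keys_lin_ext, rule keys_sum_subset)
  fix ys j assume ys: "ys \<in> Poly_Mapping.keys f" "j \<in> {..<length ys}"
  then have ysA: "set ys \<subseteq> A" using assms(1) by auto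
  have "set (take j ys) \<subseteq> A" "set (map (st x) (drop (Suc j) ys)) \<subseteq> A"
    using ysA assms(3) by (auto dest!: in_set_takeD in_set_dropD)
  then have "take j ys @ map (st x) (drop (Suc j) ys) \<in> lists A" by auto
  then have "Poly_Mapping.keys (smult_fin a (word (take j ys @ map (st x) (drop (Suc j) ys)))) \<subseteq> lists A" for a
    by (intro keys_subset_smult) simp
  then show "Poly_Mapping.keys (if ys ! j = x then word (take j ys) * skew_aut st x (word (drop (Suc j) ys)) else 0) \<subseteq> lists A"
    by (simp add: skew_aut_word smult_fin_mult_right word_mult)
qed

text \<open>
  A finite family of homogeneous vectors that is stable, up to the sign \<open>-1\<close>, under the operation and that is linearly
  independent. Independence is expressed by coordinate functionals on all of \<open>U\<close>, because the complement
  of the span need not be compatible with the braiding.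
\<close>

locale rack_letters = braided_tensor_space scale U op S e c
  for scale :: "complex \<Rightarrow> 'u \<Rightarrow> 'u::ab_group_add" and U :: "'u set"
    and op :: "'x \<Rightarrow> 'x \<Rightarrow> 'x" (infixr "\<rhd>" 70) and S :: "'x set" and e c +
  fixes L :: "'l set" and pr :: "'l \<Rightarrow> 'x" and st :: "'l \<Rightarrow> 'l \<Rightarrow> 'l" and coef :: "'l \<Rightarrow> 'u \<Rightarrow> complex"
  assumes finite_L: "finite L" and pr_S: "x \<in> L \<Longrightarrow> pr x \<in> S"
    and st_L: "x \<in> L \<Longrightarrow> y \<in> L \<Longrightarrow> st x y \<in> L"
    and pr_op: "x \<in> L \<Longrightarrow> y \<in> L \<Longrightarrow> e (pr x \<rhd> pr y) = scale (-1) (e (pr (st x y)))"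
    and coef_add: "x \<in> L \<Longrightarrow> u \<in> U \<Longrightarrow> v \<in> U \<Longrightarrow> coef x (u + v) = coef x u + coef x v"
    and coef_scale: "x \<in> L \<Longrightarrow> u \<in> U \<Longrightarrow> coef x (scale a u) = a * coef x u"
    and coef_pr: "x \<in> L \<Longrightarrow> y \<in> L \<Longrightarrow> coef x (e (pr y)) = (if x = y then 1 else 0)"
begin

definition proj_letter :: "'u \<Rightarrow> ('l list \<Rightarrow>\<^sub>0 complex)"
  where "proj_letter u = (\<Sum>x\<in>L. smult_fin (coef x u) (word [x]))"

text \<open>
  The algebra homomorphism from the tensor algebra to the free algebra on the letters that is
  induced by the coordinate functionals. It only serves to detect that an element is nonzero, and is
  not a homomorphism of braided spaces.
\<close>

definition proj :: "('u list \<Rightarrow>\<^sub>0 complex) \<Rightarrow> ('l list \<Rightarrow>\<^sub>0 complex)"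
  where "proj = lin_ext (\<lambda>us. foldr (\<lambda>u f. proj_letter u * f) us 1)"

lemma proj_linear: "fin_linear proj" by (simp add: proj_def)

lemma proj_mult: "proj (f * g) = proj f * proj g"
proof (rule fin_bilinear_eqI[where B = "\<lambda>f g. proj (f * g)" and B' = "\<lambda>f g. proj f * proj g"])
  show "fin_linear (\<lambda>f. proj (f * g))" "fin_linear (\<lambda>g. proj (f * g))"
    "fin_linear (\<lambda>f. proj f * proj g)" "fin_linear (\<lambda>g. proj f * proj g)" for f g
    by (rule fin_linear_compose[OF proj_linear fin_linear_mult_right] fin_linear_compose[OF proj_linear fin_linear_mult_left]
        fin_linear_compose[OF fin_linear_mult_right proj_linear] fin_linear_compose[OF fin_linear_mult_left proj_linear])+
  show "proj (word as * word bs) = proj (word as) * proj (word bs)" for as bs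
    by (induction as) (simp_all add: proj_def word_mult mult.assoc)
qed

lemma proj_relation: "r \<in> tensor_relations scale U \<Longrightarrow> proj r = 0"
  by (auto simp: tensor_relations_def fin_linear_diff[OF proj_linear] fin_linear_smult[OF proj_linear])
    (auto simp: proj_def proj_letter_def coef_add coef_scale smult_fin_add_left sum.distrib smult_fin_sum)

lemma proj_I: "f \<in> I \<Longrightarrow> proj f = 0"
  by (induction rule: I_induct)
    (simp_all add: fin_linear_zero[OF proj_linear] fin_linear_add[OF proj_linear] fin_linear_smult[OF proj_linear] proj_mult proj_relation)

lemma proj_cong: "f \<approx>\<^sub>I g \<Longrightarrow> proj f = proj g"
  using proj_I[of "f - g"] by (simp add: teq_def fin_linear_diff[OF proj_linear])

lemma proj_E_pr: "x \<in> L \<Longrightarrow> proj (E [pr x]) = word [x]"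
proof -
  assume x: "x \<in> L"
  have "proj_letter (e (pr x)) = (\<Sum>y\<in>L. if y = x then word [x] else 0)"
    unfolding proj_letter_def by (rule sum.cong) (use x in \<open>auto simp: coef_pr\<close>)
  then show ?thesis using x finite_L by (simp add: proj_def)
qed

abbreviation emb :: "('l list \<Rightarrow>\<^sub>0 complex) \<Rightarrow> ('u list \<Rightarrow>\<^sub>0 complex)"
  where "emb \<equiv> lin_ext (\<lambda>ys. E (map pr ys))"

text \<open>
  The quantum symmetrizer of a combination of words in the letters, read off in the free algebra on the letters.
\<close>

definition sym :: "('l list \<Rightarrow>\<^sub>0 complex) \<Rightarrow> ('l list \<Rightarrow>\<^sub>0 complex)"
  where "sym = lin_ext (\<lambda>ys. proj (QS (length ys) (E (map pr ys))))"

lemma sym_linear: "fin_linear sym" by (simp add: sym_def)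

lemma sym_emb:
  assumes "Poly_Mapping.keys f \<subseteq> {ys. length ys = n}"
  shows "sym f = proj (QS n (emb f))"
  by (rule fin_linear_eqI[OF sym_linear fin_linear_compose[OF proj_linear fin_linear_compose[OF quantum_symmetrizer_linear fin_linear_lin_ext]] assms])
    (simp add: sym_def)

lemma emb_Fn:
  assumes "Poly_Mapping.keys f \<subseteq> {ys \<in> lists L. length ys = n}" shows "emb f \<in> Fn n"
  unfolding Fn_def mem_Collect_eq[of _ "\<lambda>f. Poly_Mapping.keys f \<subseteq> _"]
proof (rule keys_lin_ext)
  fix ys assume "ys \<in> Poly_Mapping.keys f"
  then have "set ys \<subseteq> L" "length ys = n" using assms by auto
  then show "Poly_Mapping.keys (E (map pr ys)) \<subseteq> {xs \<in> lists U. length xs = n}"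
    by (auto intro!: e_in_U pr_S)
qed

lemma sym_one: "sym 1 = 1"
proof -
  have "sym (word []) = proj (word [])"
    using quantum_symmetrizer_small[of 0 c "word []"] by (simp add: sym_def)
  also have "\<dots> = 1" by (simp add: proj_def)
  finally show ?thesis by (simp add: word_Nil)
qed

lemma E_acted_letters:
  assumes x: "x \<in> L" and ys: "set ys \<subseteq> L" and ps: "ps \<in> lists U"
  shows "word (ps @ map e (map (\<lambda>z. pr x \<rhd> z) (map pr ys))) \<approx>\<^sub>I smult_fin ((-1) ^ length ys) (word (ps @ map e (map pr (map (st x) ys))))"
  using ys ps
proof (induction ys arbitrary: ps)
  case (Cons y ys)
  let ?u = "e (pr (st x y))"
  have y: "y \<in> L" and u: "?u \<in> U" using Cons.prems x by (auto intro!: e_in_U pr_S st_L)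
  have U': "map e (map (\<lambda>z. pr x \<rhd> z) (map pr ys)) \<in> lists U"
    using Cons.prems x by (auto intro!: e_in_U op_closed pr_S)
  have "word (ps @ scale (-1) ?u # map e (map (\<lambda>z. pr x \<rhd> z) (map pr ys)))
      \<approx>\<^sub>I word ps * smult_fin (-1) (word [?u]) * word (map e (map (\<lambda>z. pr x \<rhd> z) (map pr ys)))"
    using Cons.prems U' by (intro word_context word_scale u)
  also have "\<dots> = smult_fin (-1) (word ((ps @ [?u]) @ map e (map (\<lambda>z. pr x \<rhd> z) (map pr ys))))"
    by (simp add: smult_fin_mult_left smult_fin_mult_right word_mult)
  also have "\<dots> \<approx>\<^sub>I smult_fin (-1) (smult_fin ((-1) ^ length ys) (word ((ps @ [?u]) @ map e (map pr (map (st x) ys)))))"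
    using Cons.prems u by (intro teq_smult Cons.IH) auto
  finally show ?case using pr_op[OF x y] by simp
qed simp

text \<open>
  Decompose the permutations according to the letter that they move to the end.
\<close>

lemma sym_word:
  assumes ys: "set ys \<subseteq> L" "ys \<noteq> []"
  shows "sym (word ys) = (\<Sum>x\<in>L. sym (skew_deriv st x (word ys)) * word [x])"
proof -
  obtain n where n: "length ys = Suc n" using ys(2) by (cases ys) auto
  let ?xs = "map pr ys"
  have xs: "set ?xs \<subseteq> S" "length ?xs = Suc n" using ys n by (auto intro!: pr_S)
  let ?ms = "\<lambda>j. take j ?xs @ map (\<lambda>y. ?xs ! j \<rhd> y) (drop (Suc j) ?xs)"
  let ?d = "\<lambda>j. word (take j ys) * skew_aut st (ys ! j) (word (drop (Suc j) ys))"
  have "proj (QS (Suc n) (E ?xs)) = proj (\<Sum>\<pi> | \<pi> permutes {..<Suc n}. E (braid_result \<pi> ?xs))"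
    using quantum_symmetrizer_E[OF xs(1)] xs(2) by (intro proj_cong) simp
  also have "\<dots> = proj (\<Sum>j\<le>n. \<Sum>\<pi> | \<pi> permutes {..<n}. E (braid_result \<pi> (?ms j) @ [?xs ! j]))"
    by (simp only: sum_braid_result_move_last[OF xs, of E])
  also have "\<dots> = (\<Sum>j\<le>n. proj (\<Sum>\<pi> | \<pi> permutes {..<n}. E (braid_result \<pi> (?ms j))) * word [ys ! j])"
  proof -
    have "proj (E (braid_result \<pi> (?ms j) @ [?xs ! j])) = proj (E (braid_result \<pi> (?ms j))) * word [ys ! j]" if "j \<le> n" for \<pi> j
    proof -
      have "ys ! j \<in> L" using that n ys by auto
      then show ?thesis
        using proj_mult[of "E (braid_result \<pi> (?ms j))" "E [?xs ! j]"] proj_E_pr[of "ys ! j"] that n by (simp add: word_mult)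
    qed
    then show ?thesis by (simp add: fin_linear_sum[OF proj_linear] sum_distrib_right)
  qed
  also have "\<dots> = (\<Sum>j\<le>n. sym (?d j) * word [ys ! j])"
  proof (rule sum.cong[OF refl])
    fix j assume "j \<in> {..n}"
    then have j: "j < length ys" using n by simp
    then have yj: "ys ! j \<in> L" using ys by auto
    have sets: "set (take j ys) \<subseteq> L" "set (drop (Suc j) ys) \<subseteq> L"
      using ys(1) set_take_subset[of j ys] set_drop_subset[of "Suc j" ys] by auto
    let ?zs = "take j ys @ map (st (ys ! j)) (drop (Suc j) ys)"
    have zs: "set ?zs \<subseteq> L" using sets yj by (auto intro!: st_L)
    have ms: "?ms j = map pr (take j ys) @ map (\<lambda>z. pr (ys ! j) \<rhd> z) (map pr (drop (Suc j) ys))"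
      using j by (simp add: take_map drop_map)
    have msS: "set (?ms j) \<subseteq> S"
      unfolding ms using sets yj by (auto intro!: pr_S op_closed)
    have lms: "length (?ms j) = n" using n j by simp
    have zn: "length ?zs = n" using n j by simp
    have eq: "E (?ms j) \<approx>\<^sub>I smult_fin ((-1) ^ (n - j)) (E (map pr ?zs))"
    proof -
      have "map e (map pr (take j ys)) \<in> lists U"
        unfolding in_lists_conv_set using sets(1) by (auto simp del: in_set_takeD intro!: e_in_U pr_S)
      then show ?thesis
        unfolding ms using E_acted_letters[OF yj sets(2), of "map e (map pr (take j ys))"] n j by simp
    qed
    have "proj (\<Sum>\<pi> | \<pi> permutes {..<n}. E (braid_result \<pi> (?ms j))) = proj (QS n (E (?ms j)))"
      using quantum_symmetrizer_E[OF msS] unfolding lms by (intro proj_cong) (rule teq_sym)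
    also have "\<dots> = proj (QS n (smult_fin ((-1) ^ (n - j)) (E (map pr ?zs))))"
    proof -
      have "E (map pr ?zs) \<in> Fn n" using E_Fn[of "map pr ?zs"] zs zn by (auto intro!: pr_S)
      then have "E (?ms j) - smult_fin ((-1) ^ (n - j)) (E (map pr ?zs)) \<in> Fn n"
        using E_Fn[OF msS] unfolding lms by (intro Fn_closed(3,4))
      then have "QS n (E (?ms j) - smult_fin ((-1) ^ (n - j)) (E (map pr ?zs))) \<in> I"
        using eq unfolding teq_def by (intro quantum_symmetrizer_I)
      then show ?thesis
        by (intro proj_cong) (simp add: teq_def fin_linear_diff[OF quantum_symmetrizer_linear])
    qed
    also have "\<dots> = smult_fin ((-1) ^ (n - j)) (sym (word ?zs))"
      using zn by (simp add: sym_def QS_smult fin_linear_smult[OF proj_linear] o_assoc)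
    also have "\<dots> = sym (?d j)"
      using n j by (simp add: skew_aut_word smult_fin_mult_right word_mult fin_linear_smult[OF sym_linear])
    finally show "proj (\<Sum>\<pi> | \<pi> permutes {..<n}. E (braid_result \<pi> (?ms j))) * word [ys ! j] = sym (?d j) * word [ys ! j]"
      by simp
  qed
  also have "\<dots> = (\<Sum>j\<le>n. \<Sum>x\<in>L. sym (if ys ! j = x then ?d j else 0) * word [x])"
  proof (rule sum.cong[OF refl])
    fix j assume "j \<in> {..n}"
    then have "ys ! j \<in> L" using n ys by auto
    have "(\<Sum>x\<in>L. sym (if ys ! j = x then ?d j else 0) * word [x]) = (\<Sum>x\<in>L. if x = ys ! j then sym (?d j) * word [x] else 0)"
      by (rule sum.cong) (auto simp: fin_linear_zero[OF sym_linear])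
    then show "sym (?d j) * word [ys ! j] = (\<Sum>x\<in>L. sym (if ys ! j = x then ?d j else 0) * word [x])"
      using \<open>ys ! j \<in> L\<close> finite_L by simp
  qed
  also have "\<dots> = (\<Sum>x\<in>L. \<Sum>j\<le>n. sym (if ys ! j = x then ?d j else 0) * word [x])"
    by (rule sum.swap)
  also have "\<dots> = (\<Sum>x\<in>L. sym (skew_deriv st x (word ys)) * word [x])"
  proof (rule sum.cong[OF refl])
    fix x
    have "skew_deriv st x (word ys) = (\<Sum>j\<le>n. if ys ! j = x then ?d j else 0)"
      unfolding skew_deriv_def by (simp add: n lessThan_Suc_atMost cong: if_cong)
    then show "(\<Sum>j\<le>n. sym (if ys ! j = x then ?d j else 0) * word [x]) = sym (skew_deriv st x (word ys)) * word [x]"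
      by (simp add: fin_linear_sum[OF sym_linear] sum_distrib_right)
  qed
  finally show ?thesis using n by (simp add: sym_def)
qed

lemma lookup_mult_letter:
  "Poly_Mapping.lookup (f * word [x]) (zs @ [y]) = (if x = y then Poly_Mapping.lookup f zs else 0)"
  "Poly_Mapping.lookup (f * word [x]) [] = 0" for f :: "'l list \<Rightarrow>\<^sub>0 complex"
proof -
  have "Poly_Mapping.lookup (f * word [x]) (zs @ [y]) = (if x = y then Poly_Mapping.lookup f zs else 0) \<and> Poly_Mapping.lookup (f * word [x]) [] = 0"
    using subset_UNIV[of "Poly_Mapping.keys f"]
  proof (induction rule: poly_mapping_span_induct)
    case (single ws a)
    then show ?case by (auto simp: word_def mult_single plus_list_def lookup_single when_def)
  qed (auto simp: distrib_right lookup_add)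
  then show "Poly_Mapping.lookup (f * word [x]) (zs @ [y]) = (if x = y then Poly_Mapping.lookup f zs else 0)"
    "Poly_Mapping.lookup (f * word [x]) [] = 0" by auto
qed

text \<open>
  The terms \<open>sym (\<partial>\<^sub>x f) x\<close> for different letters \<open>x\<close> consist of words with different last letters, and
  so cannot cancel.
\<close>

proposition sym_skew_deriv:
  assumes f: "Poly_Mapping.keys f \<subseteq> lists L" and z: "sym f = 0" and x: "x \<in> L"
  shows "sym (skew_deriv st x f) = 0"
proof (rule poly_mapping_eqI)
  fix zs
  (* the constant term of f is not reached by any derivation *)
  have "sym f = smult_fin (Poly_Mapping.lookup f []) 1 + (\<Sum>x\<in>L. sym (skew_deriv st x f) * word [x])"
    using f
  proof (induction rule: poly_mapping_span_induct)
    case zero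
    then show ?case by (simp add: fin_linear_zero[OF sym_linear] fin_linear_zero[OF skew_deriv_linear])
  next
    case (add f g)
    then show ?case
      by (simp add: fin_linear_add[OF sym_linear] fin_linear_add[OF skew_deriv_linear] lookup_add smult_fin_add_left distrib_right sum.distrib)
  next
    case (single ys a)
    show ?case
    proof (cases "ys = []")
      case True
      then show ?thesis
        using sym_one by (simp add: fin_linear_single[OF sym_linear] fin_linear_single[OF skew_deriv_linear] skew_deriv_Nil[unfolded word_Nil]
            fin_linear_zero[OF sym_linear] word_Nil lookup_single)
    next
      case False
      have "set ys \<subseteq> L" using single by auto
      from sym_word[OF this False] have "smult_fin a (sym (word ys)) = (\<Sum>x\<in>L. smult_fin a (sym (skew_deriv st x (word ys)) * word [x]))"
        by (simp add: smult_fin_sum)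
      then show ?thesis
        using False
        by (auto simp: fin_linear_single[OF sym_linear] fin_linear_single[OF skew_deriv_linear] fin_linear_smult[OF sym_linear]
            lookup_single when_def smult_fin_mult_left smult_fin_sum)
    qed
  qed
  then have "Poly_Mapping.lookup (smult_fin (Poly_Mapping.lookup f []) 1 + (\<Sum>x\<in>L. sym (skew_deriv st x f) * word [x])) (zs @ [x]) = 0"
    using z by simp
  moreover have "Poly_Mapping.lookup (1 :: 'l list \<Rightarrow>\<^sub>0 complex) (zs @ [x]) = 0"
    unfolding word_Nil[symmetric] by (simp add: word_def lookup_single when_def)
  ultimately show "Poly_Mapping.lookup (sym (skew_deriv st x f)) zs = Poly_Mapping.lookup 0 zs"
    using x finite_L by (simp add: lookup_add lookup_sum lookup_mult_letter)
qed

end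


section \<open>An element of degree four whose powers do not vanish\<close>

locale dihedral_letters =
  fixes p :: nat assumes odd_p: "odd p" and p_gt_1: "p > 1"
begin

text \<open>
  Letters are pairs of a residue and a colour, which tells the two families apart; the operation only depends on
  the residue of its first argument. The letters \<open>a\<^sub>k\<close> and \<open>b\<^sub>k\<close> have the colours \<open>False\<close> and \<open>True\<close>.
\<close>

definition dih :: "int \<times> bool \<Rightarrow> int \<times> bool \<Rightarrow> int \<times> bool"
  where "dih x y = ((2 * fst x - fst y) mod int p, snd y)"

definition letters :: "(int \<times> bool) set" where "letters = {0..<int p} \<times> UNIV"

definition mu_letter :: "int \<Rightarrow> ((int \<times> bool) list \<Rightarrow>\<^sub>0 complex)" where "mu_letter k = word [(k mod int p, False)]"
definition nu_letter :: "int \<Rightarrow> ((int \<times> bool) list \<Rightarrow>\<^sub>0 complex)" where "nu_letter k = word [(k mod int p, True)]"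

definition zeta :: "int \<Rightarrow> complex" where "zeta k = cis (2 * pi * of_int k / real p)"

abbreviation "aut_mu t \<equiv> skew_aut dih (t mod int p, False)"
abbreviation "aut_nu t \<equiv> skew_aut dih (t mod int p, True)"
abbreviation "deriv_mu t \<equiv> skew_deriv dih (t mod int p, False)"
abbreviation "deriv_nu t \<equiv> skew_deriv dih (t mod int p, True)"

lemma zeta_add: "zeta (k + l) = zeta k * zeta l"
  by (simp add: zeta_def cis_mult add_divide_distrib ring_distribs)
lemma zeta_0 [simp]: "zeta 0 = 1" by (simp add: zeta_def)
lemma zeta_eq_1_iff: "zeta k = 1 \<longleftrightarrow> int p dvd k"
proof
  assume "zeta k = 1"
  then have "cos (2 * pi * of_int k / real p) = 1"
    by (simp add: zeta_def complex_eq_iff)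
  then obtain n where "2 * pi * of_int k / real p = of_int n * 2 * pi"
    unfolding cos_one_2pi_int by blast
  then have "(of_int k :: real) = of_int (n * int p)"
    using p_gt_1 by (simp add: field_simps)
  then show "int p dvd k" using of_int_eq_iff by (metis dvd_triv_right)
next
  assume "int p dvd k"
  then obtain n where "k = int p * n" by blast
  then have "2 * pi * of_int k / real p = 2 * pi * of_int n" using p_gt_1 by simp
  then show "zeta k = 1" unfolding zeta_def by (simp only: cis_multiple_2pi Ints_of_int)
qed
lemma zeta_mod: "zeta (k mod int p) = zeta k"
proof -
  have "zeta (int p * (k div int p)) = 1" unfolding zeta_eq_1_iff by simp
  then show ?thesis using zeta_add[of "int p * (k div int p)" "k mod int p"] by simp
qed
lemma zeta_2_neq_1: "zeta (- 2) \<noteq> 1" and zeta_4_neq_1: "zeta 4 \<noteq> 1"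
proof -
  have c: "coprime (int p) 2" using odd_p by simp
  have "\<not> int p dvd 1" using p_gt_1 by simp
  then have 2: "\<not> int p dvd 2" using c by (metis coprime_dvd_mult_left_iff mult_1 )
  then have "\<not> int p dvd 2 * 2" using c by (metis coprime_dvd_mult_left_iff)
  with 2 show "zeta (- 2) \<noteq> 1" "zeta 4 \<noteq> 1" by (simp_all add: zeta_eq_1_iff)
qed

lemma letter_cong: "k mod int p = l mod int p \<Longrightarrow> mu_letter k = mu_letter l" "k mod int p = l mod int p \<Longrightarrow> nu_letter k = nu_letter l"
  by (simp_all add: mu_letter_def nu_letter_def)

lemma reflection_mod: "(2 * (t mod int p) - k) mod int p = (2 * t - k) mod int p"
  by (metis mod_diff_left_eq mod_mult_right_eq)

lemma aut_letter:
  "aut_mu t (mu_letter k) = - mu_letter (2 * t - k)" "aut_mu t (nu_letter k) = - nu_letter (2 * t - k)"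
  "aut_nu t (mu_letter k) = - mu_letter (2 * t - k)" "aut_nu t (nu_letter k) = - nu_letter (2 * t - k)"
  by (simp_all add: skew_aut_word dih_def mu_letter_def nu_letter_def smult_fin_minus_one mod_diff_right_eq reflection_mod)

lemma skew_deriv_letter: "skew_deriv st x (word [y]) = (if y = x then 1 else 0)"
  by (simp add: skew_deriv_Cons skew_deriv_Nil) (simp add: skew_aut_word word_Nil[symmetric])

lemma deriv_letter:
  "deriv_mu t (mu_letter k) = (if k mod int p = t mod int p then 1 else 0)" "deriv_mu t (nu_letter k) = 0"
  "deriv_nu t (nu_letter k) = (if k mod int p = t mod int p then 1 else 0)" "deriv_nu t (mu_letter k) = 0"
  by (simp_all add: mu_letter_def nu_letter_def skew_deriv_letter)

lemmas aut_linear [simp] = fin_linear_add[OF skew_aut_linear] fin_linear_smult[OF skew_aut_linear]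
    fin_linear_diff[OF skew_aut_linear] fin_linear_zero[OF skew_aut_linear] fin_linear_sum[OF skew_aut_linear] fin_linear_minus[OF skew_aut_linear]
lemmas deriv_linear [simp] = fin_linear_add[OF skew_deriv_linear] fin_linear_smult[OF skew_deriv_linear]
    fin_linear_diff[OF skew_deriv_linear] fin_linear_zero[OF skew_deriv_linear] fin_linear_sum[OF skew_deriv_linear] fin_linear_minus[OF skew_deriv_linear]

text \<open>
  The braided commutator of the letters \<open>a\<^bsub>k+s\<^esub>\<close> and \<open>b\<^sub>k\<close>.
\<close>

definition commutator :: "int \<Rightarrow> int \<Rightarrow> ((int \<times> bool) list \<Rightarrow>\<^sub>0 complex)"
  where "commutator s k = mu_letter (k + s) * nu_letter k + nu_letter (k + 2 * s) * mu_letter (k + s)"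
definition fourier :: "int \<Rightarrow> ((int \<times> bool) list \<Rightarrow>\<^sub>0 complex)"
  where "fourier s = (\<Sum>k = 0..<int p. smult_fin (zeta (s * k)) (commutator s k))"

lemma sum_reflect:
  assumes "\<And>k. f (k mod int p) = f k"
  shows "(\<Sum>k = 0..<int p. f (c - k)) = (\<Sum>k = 0..<int p. f k :: 'c::comm_monoid_add)"
proof (rule sum.reindex_bij_witness[of _ "\<lambda>k. (c - k) mod int p" "\<lambda>k. (c - k) mod int p"])
  fix k assume k: "k \<in> {0..<int p}"
  then show "(c - (c - k) mod int p) mod int p = k" by (simp add: mod_diff_right_eq)
  then show "(c - (c - k) mod int p) mod int p = k" .
  show "f ((c - k) mod int p) = f (c - k)" by (rule assms)
qed (use p_gt_1 in auto)

lemma commutator_mod: "commutator s (k mod int p) = commutator s k"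
  unfolding commutator_def by (intro arg_cong2[of _ _ _ _ "(+)"] arg_cong2[of _ _ _ _ "(*)"] letter_cong) (simp_all add: mod_simps)

lemma fourier_term_mod: "smult_fin (zeta (s * (k mod int p))) (commutator s (k mod int p)) = smult_fin (zeta (s * k)) (commutator s k)"
proof -
  have "zeta (s * (k mod int p)) = zeta (s * k)"
    using zeta_mod[of "s * (k mod int p)"] zeta_mod[of "s * k"] by (simp add: mod_simps)
  then show ?thesis by (simp add: commutator_mod)
qed

lemma aut_commutator: "aut_mu t (commutator s k) = commutator (- s) (2 * t - k)" "aut_nu t (commutator s k) = commutator (- s) (2 * t - k)"
  by (simp_all add: commutator_def skew_aut_mult aut_letter algebra_simps)

text \<open>
  A reflection reverses the cyclic order of the commutators, and so exchanges the two Fourier components up to a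
  root of unity.
\<close>

lemma aut_fourier: "aut_mu t (fourier s) = smult_fin (zeta (2 * s * t)) (fourier (- s))" "aut_nu t (fourier s) = smult_fin (zeta (2 * s * t)) (fourier (- s))"
proof -
  have "(\<Sum>k = 0..<int p. smult_fin (zeta (s * k)) (commutator (- s) (2 * t - k))) =
      (\<Sum>k = 0..<int p. smult_fin (zeta (2 * s * t)) (smult_fin (zeta (- s * (2 * t - k))) (commutator (- s) (2 * t - k))))"
    by (rule sum.cong) (simp_all flip: zeta_add, simp add: algebra_simps)
  also have "\<dots> = smult_fin (zeta (2 * s * t)) (\<Sum>k = 0..<int p. smult_fin (zeta (- s * (2 * t - k))) (commutator (- s) (2 * t - k)))"
    by (simp only: smult_fin_sum)
  also have "\<dots> = smult_fin (zeta (2 * s * t)) (fourier (- s))"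
    unfolding fourier_def by (subst sum_reflect[of "\<lambda>k. smult_fin (zeta (- s * k)) (commutator (- s) k)"]) (rule fourier_term_mod, rule refl)
  finally show "aut_mu t (fourier s) = smult_fin (zeta (2 * s * t)) (fourier (- s))" "aut_nu t (fourier s) = smult_fin (zeta (2 * s * t)) (fourier (- s))"
    by (simp_all add: fourier_def aut_commutator)
qed

lemma aut_nu_0_fourier: "skew_aut dih (0, True) (fourier s) = fourier (- s)"
  using aut_fourier(2)[of 0 s] by simp

lemma deriv_mu_fourier: "deriv_mu t (fourier s) = 0"
proof -
  have "deriv_mu t (commutator s k) = 0" for k
  proof (cases "(k + s) mod int p = t mod int p")
    case True
    then have "(2 * (k + s) - k) mod int p = (2 * t - k) mod int p"
      by (metis mod_diff_left_eq mod_mult_right_eq)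
    then have "nu_letter (2 * t - k) = nu_letter (k + 2 * s)" by (intro letter_cong) (simp add: algebra_simps)
    then show ?thesis using True by (simp add: commutator_def skew_deriv_mult aut_letter deriv_letter)
  next
    case False
    then show ?thesis by (simp add: commutator_def skew_deriv_mult deriv_letter)
  qed
  then show ?thesis by (simp add: fourier_def)
qed

definition eps :: complex where "eps = 1 - zeta (- 2)"

text \<open>
  The letter \<open>b\<^sub>0\<close> occurs at the end of the commutator with index \<open>0\<close> and at the front of the one with index
  \<open>-2s\<close>. Both contribute the letter \<open>a\<^sub>s\<close>, with coefficients \<open>1\<close> and \<open>- \<zeta>\<^sup>-\<^sup>2\<close>.
\<close>

lemma deriv_nu_fourier:
  assumes s: "s * s = 1"
  shows "deriv_nu 0 (fourier s) = smult_fin eps (mu_letter s)"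
proof -
  have summand: "deriv_nu 0 (commutator s k) = (if k mod int p = 0 then mu_letter s else 0) - (if k mod int p = (- 2 * s) mod int p then mu_letter s else 0)" for k
  proof -
    have 1: "mu_letter (k + s) = mu_letter s" if "k mod int p = 0"
      using that by (intro letter_cong) (metis add_0 mod_add_left_eq)
    (* b 0 at the front of the second product of the commutator *)
    have eq: "(k + 2 * s) mod int p = 0 mod int p \<longleftrightarrow> k mod int p = (- 2 * s) mod int p"
      by (simp add: mod_eq_dvd_iff mod_eq_0_iff_dvd)
    have 2: "mu_letter (- k - s) = mu_letter s" if "k mod int p = (- 2 * s) mod int p"
    proof (rule letter_cong(1))
      have "int p dvd k + 2 * s" using that by (simp add: mod_eq_dvd_iff)
      then have "int p dvd - k - s - s" by (metis dvd_minus_iff minus_add_distrib diff_diff_eq mult_2 uminus_add_conv_diff diff_conv_add_uminus)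
      then show "(- k - s) mod int p = s mod int p" by (simp add: mod_eq_dvd_iff)
    qed
    have "deriv_nu 0 (commutator s k) = mu_letter (k + s) * (if k mod int p = 0 mod int p then 1 else 0)
        + (if (k + 2 * s) mod int p = 0 mod int p then 1 else 0) * - mu_letter (2 * 0 - (k + s))"
      by (simp only: commutator_def deriv_linear skew_deriv_mult deriv_letter aut_letter) simp
    also have "\<dots> = (if k mod int p = 0 then mu_letter s else 0) - (if k mod int p = (- 2 * s) mod int p then mu_letter s else 0)"
      unfolding eq using 1 2 by auto
    finally show ?thesis .
  qed
  let ?m = "(- 2 * s) mod int p"
  have m: "?m \<in> {0..<int p}" "0 \<in> {0..<int p}" using p_gt_1 by auto
  have "deriv_nu 0 (fourier s) = (\<Sum>k = 0..<int p. (if k = 0 then smult_fin (zeta (s * k)) (mu_letter s) else 0) - (if k = ?m then smult_fin (zeta (s * k)) (mu_letter s) else 0))"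
    unfolding fourier_def deriv_linear summand by (rule sum.cong) (auto simp: smult_fin_diff)
  also have "\<dots> = mu_letter s - smult_fin (zeta (s * ?m)) (mu_letter s)"
    using m by (simp only: sum_subtractf) (simp add: sum.delta)
  also have "zeta (s * ?m) = zeta (- 2)"
  proof -
    have "s * (- 2 * s) = - 2" using s by (metis mult.commute mult.left_commute mult.right_neutral)
    moreover have "zeta (s * ?m) = zeta (s * (- 2 * s))"
      using zeta_mod[of "s * ?m"] zeta_mod[of "s * (- 2 * s)"] by (simp add: mod_simps)
    ultimately show ?thesis by (simp only:)
  qed
  finally show ?thesis
    by (simp add: eps_def) (metis smult_fin_simps(1) smult_fin_add_left smult_fin_minus(2) diff_conv_add_uminus)
qed

lemma deriv_mu_deriv_nu_fourier:
  assumes "s \<in> {1, -1}" "t \<in> {1, -1}"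
  shows "deriv_mu t (deriv_nu 0 (fourier s)) = (if s = t then smult_fin eps 1 else 0)"
proof -
  have "s mod int p \<noteq> t mod int p" if "s \<noteq> t"
  proof
    assume "s mod int p = t mod int p"
    then have "int p dvd s - t" by (simp add: mod_eq_dvd_iff)
    then have "int p dvd 2" using that assms by auto
    then show False using zeta_2_neq_1 by (simp add: zeta_eq_1_iff)
  qed
  then show ?thesis using deriv_nu_fourier[of s] assms by (auto simp: deriv_letter)
qed

text \<open>
  On these elements the Leibniz rule for the second order operators below has no mixed terms; they form
  a subalgebra.
\<close>

definition coinvariants :: "((int \<times> bool) list \<Rightarrow>\<^sub>0 complex) set"
  where "coinvariants = {z. \<forall>t. deriv_mu t z = 0 \<and> deriv_mu t (aut_nu 0 z) = 0}"

lemma coinvariants_mult: "z \<in> coinvariants \<Longrightarrow> z' \<in> coinvariants \<Longrightarrow> z * z' \<in> coinvariants"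
  by (simp add: coinvariants_def skew_deriv_mult skew_aut_mult)
lemma coinvariants_add: "z \<in> coinvariants \<Longrightarrow> z' \<in> coinvariants \<Longrightarrow> z + z' \<in> coinvariants" by (simp add: coinvariants_def)
lemma coinvariants_diff: "z \<in> coinvariants \<Longrightarrow> z' \<in> coinvariants \<Longrightarrow> z - z' \<in> coinvariants" by (simp add: coinvariants_def)
lemma coinvariants_smult: "z \<in> coinvariants \<Longrightarrow> smult_fin c z \<in> coinvariants" by (simp add: coinvariants_def)
lemma coinvariants_one: "1 \<in> coinvariants" unfolding word_Nil[symmetric] by (simp add: coinvariants_def skew_aut_word skew_deriv_Nil)
lemma coinvariants_zero: "0 \<in> coinvariants" by (simp add: coinvariants_def)
lemma fourier_coinvariant: "fourier s \<in> coinvariants" by (simp add: coinvariants_def deriv_mu_fourier aut_nu_0_fourier)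
lemma coinvariants_power: "z \<in> coinvariants \<Longrightarrow> z ^ n \<in> coinvariants" by (induction n) (auto intro: coinvariants_one coinvariants_mult)

text \<open>
  With \<open>t = 1\<close> and \<open>t = -1\<close> these are, up to the factor \<open>eps\<close>, dual to the two Fourier components.
\<close>

definition double_deriv :: "int \<Rightarrow> ((int \<times> bool) list \<Rightarrow>\<^sub>0 complex) \<Rightarrow> ((int \<times> bool) list \<Rightarrow>\<^sub>0 complex)"
  where "double_deriv t z = deriv_mu t (deriv_nu 0 z)"
text \<open>
  A product of two reflections, that is, a rotation by \<open>2t\<close> steps; it is diagonal on the Fourier components.
\<close>

definition double_aut :: "int \<Rightarrow> ((int \<times> bool) list \<Rightarrow>\<^sub>0 complex) \<Rightarrow> ((int \<times> bool) list \<Rightarrow>\<^sub>0 complex)"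
  where "double_aut t z = aut_mu t (aut_nu 0 z)"

lemma double_deriv_mult: "z \<in> coinvariants \<Longrightarrow> z' \<in> coinvariants \<Longrightarrow> double_deriv t (z * z') = z * double_deriv t z' + double_deriv t z * double_aut t z'"
  by (simp add: double_deriv_def double_aut_def skew_deriv_mult coinvariants_def)
lemma double_aut_mult: "double_aut t (z * z') = double_aut t z * double_aut t z'" by (simp add: double_aut_def skew_aut_mult)
lemma double_aut_fourier: "double_aut t (fourier s) = smult_fin (zeta (- 2 * s * t)) (fourier s)"
  by (simp add: double_aut_def aut_fourier aut_nu_0_fourier)
lemma double_deriv_linear: "double_deriv t (z + z') = double_deriv t z + double_deriv t z'" "double_deriv t (z - z') = double_deriv t z - double_deriv t z'" "double_deriv t (smult_fin c z) = smult_fin c (double_deriv t z)"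
  by (simp_all add: double_deriv_def)
lemma double_aut_linear: "double_aut t (z - z') = double_aut t z - double_aut t z'" "double_aut t (smult_fin c z) = smult_fin c (double_aut t z)"
  by (simp_all add: double_aut_def)
lemma one_deriv: "skew_deriv st x 1 = 0" "skew_aut st x 1 = 1"
  unfolding word_Nil[symmetric] by (simp_all add: skew_aut_word skew_deriv_Nil)

text \<open>
  The two Fourier components generate a braided vector space of diagonal type and affine Cartan matrix. The
  coefficient \<open>\<zeta>\<^sup>2\<close> makes this element the braided commutator of the two, an imaginary root vector: it is
  annihilated by one of the second order operators and fixed by both rotations.
\<close>

definition imag :: "(int \<times> bool) list \<Rightarrow>\<^sub>0 complex"
  where "imag = fourier 1 * fourier (- 1) - smult_fin (zeta 2) (fourier (- 1) * fourier 1)"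

lemma imag_coinvariant: "imag \<in> coinvariants" unfolding imag_def by (intro coinvariants_diff coinvariants_smult coinvariants_mult fourier_coinvariant)

lemma double_aut_imag: "t \<in> {1, -1} \<Longrightarrow> double_aut t imag = imag"
  by (auto simp: imag_def double_aut_linear double_aut_mult double_aut_fourier smult_fin_mult_left smult_fin_mult_right simp flip: zeta_add)

lemma double_deriv_fourier: "double_deriv 1 (fourier 1) = smult_fin eps 1" "double_deriv 1 (fourier (- 1)) = 0" "double_deriv (- 1) (fourier 1) = 0" "double_deriv (- 1) (fourier (- 1)) = smult_fin eps 1"
  using deriv_mu_deriv_nu_fourier[of 1 1] deriv_mu_deriv_nu_fourier[of "-1" 1] deriv_mu_deriv_nu_fourier[of 1 "-1"] deriv_mu_deriv_nu_fourier[of "-1" "-1"] by (simp_all add: double_deriv_def)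

lemma double_deriv_1_imag: "double_deriv 1 imag = 0"
  by (simp add: imag_def double_deriv_linear double_deriv_mult fourier_coinvariant double_deriv_fourier double_aut_fourier smult_fin_mult_left smult_fin_mult_right mult.commute)

definition \<kappa> :: complex where "\<kappa> = eps * (1 - zeta 4)"

lemma double_deriv_minus_1_imag: "double_deriv (- 1) imag = smult_fin \<kappa> (fourier 1)"
proof -
  have "double_deriv (- 1) imag = smult_fin eps (fourier 1) - smult_fin (zeta 2 * (eps * zeta 2)) (fourier 1)"
    by (simp add: imag_def double_deriv_linear double_deriv_mult fourier_coinvariant double_deriv_fourier double_aut_fourier smult_fin_mult_left smult_fin_mult_right mult.commute[of eps])
  moreover have "zeta 4 = zeta 2 * zeta 2" using zeta_add[of 2 2] by simp
  ultimately show ?thesis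
    by (simp add: \<kappa>_def algebra_simps) (metis smult_fin_add_left diff_add_cancel add_diff_cancel)
qed

lemma nonzero: "\<kappa> * eps \<noteq> 0"
  using zeta_2_neq_1 zeta_4_neq_1 by (simp add: \<kappa>_def eps_def)

lemma double_aut_one: "double_aut t 1 = 1" by (simp add: double_aut_def one_deriv)

lemma double_aut_power: "t \<in> {1, -1} \<Longrightarrow> double_aut t (imag ^ n) = imag ^ n"
  by (induction n) (auto simp: double_aut_mult double_aut_imag double_aut_one)

lemma double_deriv_1_power: "double_deriv 1 (imag ^ n) = 0"
proof (induction n)
  case (Suc n)
  then show ?case by (simp add: double_deriv_mult imag_coinvariant coinvariants_power double_deriv_1_imag)
qed (simp add: double_deriv_def one_deriv)

lemma double_deriv_minus_1_power: "double_deriv (- 1) (imag ^ Suc n) = imag * double_deriv (- 1) (imag ^ n) + smult_fin \<kappa> (fourier 1 * imag ^ n)"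
  by (simp add: double_deriv_mult imag_coinvariant coinvariants_power double_deriv_minus_1_imag double_aut_power smult_fin_mult_left)

lemma double_deriv_minus_1_power_coinvariant: "double_deriv (- 1) (imag ^ n) \<in> coinvariants"
proof (induction n)
  case 0
  show ?case by (simp add: double_deriv_def one_deriv coinvariants_zero)
next
  case (Suc n)
  then show ?case unfolding double_deriv_minus_1_power by (intro coinvariants_add coinvariants_mult coinvariants_smult fourier_coinvariant coinvariants_power imag_coinvariant)
qed

text \<open>
  As the rotations fix \<open>imag\<close>, its powers are differentiated as in a polynomial ring, and the
  factor \<open>n + 1\<close> does not vanish in characteristic zero.
\<close>

proposition double_deriv_double_deriv_power: "double_deriv 1 (double_deriv (- 1) (imag ^ Suc n)) = smult_fin (of_nat (Suc n) * (\<kappa> * eps)) (imag ^ n)"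
proof (induction n)
  case 0
  show ?case
    by (simp add: double_deriv_minus_1_imag double_deriv_linear double_deriv_fourier)
next
  case (Suc n)
  have "double_deriv 1 (double_deriv (- 1) (imag ^ Suc (Suc n))) = imag * double_deriv 1 (double_deriv (- 1) (imag ^ Suc n)) + smult_fin \<kappa> (double_deriv 1 (fourier 1 * imag ^ Suc n))"
    unfolding double_deriv_minus_1_power[of "Suc n"] double_deriv_linear
    by (simp only: double_deriv_mult[OF imag_coinvariant double_deriv_minus_1_power_coinvariant] double_deriv_1_imag) simp
  also have "double_deriv 1 (fourier 1 * imag ^ Suc n) = smult_fin eps (imag ^ Suc n)"
    using double_deriv_mult[OF fourier_coinvariant coinvariants_power[OF imag_coinvariant], of 1 1 "Suc n"] double_aut_power[of 1 "Suc n"] double_deriv_1_power[of "Suc n"]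
    by (simp add: double_deriv_fourier smult_fin_mult_left del: power_Suc)
  also have "imag * double_deriv 1 (double_deriv (- 1) (imag ^ Suc n)) = smult_fin (of_nat (Suc n) * (\<kappa> * eps)) (imag ^ Suc n)"
    unfolding Suc.IH by (simp add: smult_fin_mult_right)
  finally show ?case
    by (simp add: algebra_simps flip: smult_fin_add_left del: power_Suc)
qed

definition homog :: "nat \<Rightarrow> ((int \<times> bool) list \<Rightarrow>\<^sub>0 complex) set"
  where "homog n = {f. Poly_Mapping.keys f \<subseteq> {ys \<in> lists letters. length ys = n}}"

lemma homog_closed:
  "f \<in> homog n \<Longrightarrow> g \<in> homog n \<Longrightarrow> f + g \<in> homog n" "f \<in> homog n \<Longrightarrow> g \<in> homog n \<Longrightarrow> f - g \<in> homog n"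
  "f \<in> homog n \<Longrightarrow> smult_fin c f \<in> homog n"
  by (simp_all add: homog_def keys_subset_add keys_subset_diff keys_subset_smult)
lemma homog_mult: "f \<in> homog n \<Longrightarrow> g \<in> homog m \<Longrightarrow> f * g \<in> homog (n + m)"
  unfolding homog_def by (simp, erule (1) keys_mult_lists) auto
lemma homog_letter: "mu_letter k \<in> homog 1" "nu_letter k \<in> homog 1"
  using p_gt_1 by (auto simp: homog_def mu_letter_def nu_letter_def letters_def)
lemma homog_fourier: "fourier s \<in> homog 2"
proof -
  have "commutator s k \<in> homog 2" for k
    unfolding commutator_def using homog_mult[OF homog_letter(1,2)] homog_mult[OF homog_letter(2,1)]
    by (intro homog_closed(1)) (simp_all add: numeral_2_eq_2)
  then have "Poly_Mapping.keys (smult_fin (zeta (s * k)) (commutator s k)) \<subseteq> {ys \<in> lists letters. length ys = 2}" for k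
    by (intro keys_subset_smult) (simp add: homog_def)
  then show ?thesis
    unfolding fourier_def homog_def mem_Collect_eq[of _ "\<lambda>f. Poly_Mapping.keys f \<subseteq> _"] by (rule keys_sum_subset)
qed
lemma homog_imag: "imag \<in> homog 4"
  unfolding imag_def using homog_mult[OF homog_fourier homog_fourier] by (intro homog_closed(2,3)) simp_all
lemma homog_power: "imag ^ n \<in> homog (4 * n)"
proof (induction n)
  case 0
  show ?case by (simp add: homog_def zero_list_def)
next
  case (Suc n)
  show ?case using homog_mult[OF homog_imag Suc] by simp
qed

text \<open>
  The map \<open>\<Psi>\<close> stands for the symmetrizer. Differentiating down to the constant \<open>1\<close> shows that it cannot
  vanish on a power of \<open>imag\<close> unless it vanishes on \<open>1\<close>.
\<close>

proposition power_detected: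
  assumes \<Psi>: "fin_linear \<Psi>" and stable: "\<And>f x. Poly_Mapping.keys f \<subseteq> lists letters \<Longrightarrow> \<Psi> f = 0 \<Longrightarrow> x \<in> letters \<Longrightarrow> \<Psi> (skew_deriv dih x f) = 0"
    and zero: "\<Psi> (imag ^ n) = 0"
  shows "\<Psi> 1 = 0"
  using zero
proof (induction n)
  case (Suc n)
  have letters: "(t mod int p, c) \<in> letters" for t c using p_gt_1 by (simp add: letters_def)
  have keys: "Poly_Mapping.keys (skew_deriv dih x f) \<subseteq> lists letters" if "Poly_Mapping.keys f \<subseteq> lists letters" "x \<in> letters" for f x
    using that p_gt_1 by (intro keys_skew_deriv) (auto simp: letters_def dih_def)
  have double_deriv: "\<Psi> (double_deriv t f) = 0 \<and> Poly_Mapping.keys (double_deriv t f) \<subseteq> lists letters" if "Poly_Mapping.keys f \<subseteq> lists letters" "\<Psi> f = 0" for f t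
    unfolding double_deriv_def using that by (intro conjI stable keys letters)
  have "Poly_Mapping.keys (imag ^ Suc n) \<subseteq> lists letters" using homog_power[of "Suc n"] by (auto simp: homog_def)
  then have "\<Psi> (double_deriv 1 (double_deriv (- 1) (imag ^ Suc n))) = 0" using double_deriv Suc.prems by blast
  then have "smult_fin (of_nat (Suc n) * (\<kappa> * eps)) (\<Psi> (imag ^ n)) = 0"
    unfolding double_deriv_double_deriv_power fin_linear_smult[OF \<Psi>] .
  moreover have nz: "(of_nat (Suc n) * (\<kappa> * eps) :: complex) \<noteq> 0"
    using nonzero of_nat_neq_0[of n] by (metis mult_eq_0_iff)
  moreover have "smult_fin (inverse r) (smult_fin r F) = F" if "r \<noteq> 0" for r and F :: "'a \<Rightarrow>\<^sub>0 complex"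
    using that by simp
  ultimately have "\<Psi> (imag ^ n) = 0" by (metis smult_fin_simps(3))
  then show ?case by (rule Suc.IH)
qed simp

end


section \<open>Yetter-Drinfeld modules\<close>

locale yd_module = group G for G :: "('g, 'm) monoid_scheme" (structure) +
  fixes C :: "'g set" and s :: 'g and scale :: "complex \<Rightarrow> 'v::ab_group_add \<Rightarrow> 'v"
    and \<rho> :: "'g \<Rightarrow> 'v \<Rightarrow> 'v" and g :: "'g \<Rightarrow> 'g"
  assumes finite_G: "finite (carrier G)" and conj_class: "is_conjugacy_class G C" and s_C: "s \<in> C"
    and irreducible: "irreducible_representation (G\<lparr>carrier := centralizer G s\<rparr>) scale \<rho>"
    and reps: "coset_reps G C s g"
begin

sublocale V: vector_space scale
  using irreducible by (simp add: irreducible_representation_def)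

lemma C_carrier: "t \<in> C \<Longrightarrow> t \<in> carrier G"
  using conj_class by (auto simp: is_conjugacy_class_def conj_by_def)
lemma s_carrier [simp]: "s \<in> carrier G" using C_carrier s_C .
lemma finite_C: "finite C" using C_carrier finite_G by (meson finite_subset subsetI)

lemma conj_by_closed [simp]: "x \<in> carrier G \<Longrightarrow> y \<in> carrier G \<Longrightarrow> conj_by G x y \<in> carrier G"
  by (simp add: conj_by_def)
lemma conj_by_mult: "x \<in> carrier G \<Longrightarrow> y \<in> carrier G \<Longrightarrow> z \<in> carrier G \<Longrightarrow> conj_by G (x \<otimes> y) z = conj_by G x (conj_by G y z)"
  by (simp add: conj_by_def m_assoc inv_mult_group)
lemma conj_by_one [simp]: "z \<in> carrier G \<Longrightarrow> conj_by G \<one> z = z"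
  by (simp add: conj_by_def)
lemma conj_by_C: "x \<in> carrier G \<Longrightarrow> t \<in> C \<Longrightarrow> conj_by G x t \<in> C"
proof -
  assume x: "x \<in> carrier G" and t: "t \<in> C"
  obtain y where y: "y \<in> carrier G" "C = {conj_by G x y | x. x \<in> carrier G}"
    using conj_class by (auto simp: is_conjugacy_class_def)
  then obtain z where "z \<in> carrier G" "t = conj_by G z y" using t by auto
  then have "conj_by G x t = conj_by G (x \<otimes> z) y" "x \<otimes> z \<in> carrier G" using x y by (simp_all add: conj_by_mult)
  then show ?thesis using y by blast
qed
lemma g_closed [simp]: "t \<in> C \<Longrightarrow> g t \<in> carrier G" and g_conj: "t \<in> C \<Longrightarrow> conj_by G (g t) s = t"
  using reps by (auto simp: coset_reps_def)

lemma centralizer_iff: "x \<in> carrier G \<Longrightarrow> x \<in> centralizer G s \<longleftrightarrow> conj_by G x s = s"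
  unfolding centralizer_def conj_by_def
  by (auto simp: m_assoc) (metis inv_closed inv_solve_right m_assoc m_closed s_carrier)+

lemma centralizer_carrier: "x \<in> centralizer G s \<Longrightarrow> x \<in> carrier G"
  by (simp add: centralizer_def)
lemma s_centralizer: "s \<in> centralizer G s" by (simp add: centralizer_def)

lemma same_conj:
  assumes "x \<in> carrier G" "y \<in> carrier G" "conj_by G x s = conj_by G y s"
  shows "inv x \<otimes> y \<in> centralizer G s"
  using assms by (subst centralizer_iff) (simp_all add: conj_by_mult flip: assms(3), simp add: conj_by_mult[symmetric])

lemma rho_mult: "x \<in> centralizer G s \<Longrightarrow> y \<in> centralizer G s \<Longrightarrow> \<rho> (x \<otimes> y) v = \<rho> x (\<rho> y v)"
  using irreducible by (auto simp: irreducible_representation_def hom_def GL_def)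
lemma rho_linear: "x \<in> centralizer G s \<Longrightarrow> Vector_Spaces.linear scale scale (\<rho> x)"
  and rho_bij: "x \<in> centralizer G s \<Longrightarrow> bij (\<rho> x)"
  using irreducible by (auto simp: irreducible_representation_def hom_def GL_def)
lemma rho_add: "x \<in> centralizer G s \<Longrightarrow> \<rho> x (v + w) = \<rho> x v + \<rho> x w"
  and rho_scale: "x \<in> centralizer G s \<Longrightarrow> \<rho> x (scale a v) = scale a (\<rho> x v)"
  using rho_linear[of x] by (simp_all add: Vector_Spaces.linear_iff)
lemma rho_zero: "x \<in> centralizer G s \<Longrightarrow> \<rho> x 0 = 0"
  using rho_scale[of x 0 0] by simp
lemma rho_nonzero: "x \<in> centralizer G s \<Longrightarrow> v \<noteq> 0 \<Longrightarrow> \<rho> x v \<noteq> 0"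
  using rho_bij[of x] rho_zero[of x] by (metis bij_is_inj injD)

text \<open>
  The element \<open>\<gamma>\<close> of the centralizer with \<open>x g\<^sub>r = g\<^sub>h \<gamma>\<close> for \<open>h = x r x\<^sup>-\<^sup>1\<close>.
\<close>

definition coeff :: "'g \<Rightarrow> 'g \<Rightarrow> 'g" where "coeff x r = inv (g (conj_by G x r)) \<otimes> (x \<otimes> g r)"
text \<open>
  A pair \<open>(t, v)\<close> stands for \<open>g\<^sub>t v\<close>, and \<open>x\<close> acts on it as on the induced module.
\<close>

definition act :: "'g \<Rightarrow> 'g \<times> 'v \<Rightarrow> 'g \<times> 'v"
  where "act x z = (conj_by G x (fst z), \<rho> (coeff x (fst z)) (snd z))"
text \<open>
  The vector \<open>x \<otimes> v\<close> of the induced module for an arbitrary group element \<open>x\<close>, rewritten in terms of the chosen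
  representatives. Computations below take place in terms of \<open>x\<close>.
\<close>

definition elem :: "'g \<Rightarrow> 'v \<Rightarrow> 'g \<times> 'v"
  where "elem x v = (conj_by G x s, \<rho> (inv (g (conj_by G x s)) \<otimes> x) v)"

lemma coeff_centralizer: "x \<in> carrier G \<Longrightarrow> r \<in> C \<Longrightarrow> coeff x r \<in> centralizer G s"
  unfolding coeff_def using conj_by_C[of x r] C_carrier
  by (intro same_conj) (simp_all add: g_conj conj_by_mult)

lemma elem_centralizer: "x \<in> carrier G \<Longrightarrow> inv (g (conj_by G x s)) \<otimes> x \<in> centralizer G s"
  using conj_by_C[of x s] s_C by (intro same_conj) (simp_all add: g_conj)

lemma act_elem:
  assumes "x \<in> carrier G" "y \<in> carrier G"
  shows "act y (elem x v) = elem (y \<otimes> x) v"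
proof -
  let ?t = "conj_by G x s" let ?r = "conj_by G y ?t"
  have t: "?t \<in> C" "?r \<in> C" using assms s_C by (auto intro: conj_by_C)
  have "coeff y ?t \<otimes> (inv (g ?t) \<otimes> x) = inv (g ?r) \<otimes> (y \<otimes> x)"
    using assms t by (simp add: coeff_def m_assoc) (simp add: m_assoc[symmetric])
  then show ?thesis
    using rho_mult[OF coeff_centralizer[OF assms(2) t(1)] elem_centralizer[OF assms(1)], of v] assms t
    by (simp add: act_def elem_def conj_by_mult)
qed

lemma act_act:
  assumes "x \<in> carrier G" "y \<in> carrier G" "fst z \<in> C"
  shows "act y (act x z) = act (y \<otimes> x) z"
proof -
  let ?t = "conj_by G x (fst z)" let ?r = "conj_by G y ?t"
  have t: "?t \<in> C" "?r \<in> C" using assms by (auto intro: conj_by_C)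
  have c: "fst z \<in> carrier G" using assms C_carrier by auto
  have "coeff y ?t \<otimes> coeff x (fst z) = coeff (y \<otimes> x) (fst z)"
    using assms t c by (simp add: coeff_def m_assoc conj_by_mult) (simp add: m_assoc[symmetric])
  then show ?thesis
    using rho_mult[OF coeff_centralizer[OF assms(2) t(1)] coeff_centralizer[OF assms(1,3)], of "snd z"] assms t c
    by (simp add: act_def conj_by_mult)
qed

lemma elem_mult:
  assumes "x \<in> carrier G" "\<gamma> \<in> centralizer G s"
  shows "elem (x \<otimes> \<gamma>) v = elem x (\<rho> \<gamma> v)"
proof -
  have \<gamma>: "\<gamma> \<in> carrier G" "conj_by G \<gamma> s = s" using assms(2) centralizer_carrier centralizer_iff by auto
  then have "conj_by G (x \<otimes> \<gamma>) s = conj_by G x s" using assms by (simp add: conj_by_mult)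
  then show ?thesis
    using rho_mult[OF elem_centralizer[OF assms(1)] assms(2), of v] assms \<gamma> conj_by_C[of x s] s_C
    by (simp add: elem_def m_assoc)
qed

abbreviation "opn \<equiv> (\<lambda>x y. act (fst x) y)"
abbreviation "pairs \<equiv> C \<times> (UNIV :: 'v set)"
abbreviation "U \<equiv> (YD_space C :: ('g \<Rightarrow> 'v) set)"
abbreviation "eY \<equiv> (\<lambda>(t, v). YD_elem t v) :: 'g \<times> 'v \<Rightarrow> 'g \<Rightarrow> 'v"
abbreviation "cY \<equiv> YD_braiding G C s g \<rho>"

lemma YD_elem_U: "t \<in> C \<Longrightarrow> YD_elem t v \<in> U"
  by (auto simp: YD_space_def YD_elem_def)
lemma YD_elem_zero: "YD_elem t (0 :: 'v) = 0" by (auto simp: YD_elem_def fun_eq_iff)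
lemma YD_elem_add: "YD_elem t (v + w) = YD_elem t v + YD_elem t w" for v w :: 'v by (auto simp: YD_elem_def fun_eq_iff)
lemma YD_elem_scale: "YD_elem t (scale a v) = YD_scale scale a (YD_elem t v)" by (auto simp: YD_elem_def YD_scale_def fun_eq_iff)

lemma YD_factor_eq:
  assumes "t \<in> C" "r \<in> C"
  shows "YD_factor G C s g t r = (conj_by G t r, coeff t r)"
  unfolding YD_factor_def
proof (rule the_equality)
  have t: "t \<in> carrier G" "r \<in> carrier G" using assms C_carrier by auto
  have h: "conj_by G t r \<in> C" using conj_by_C[OF t(1) assms(2)] .
  show "case (conj_by G t r, coeff t r) of (h, \<gamma>) \<Rightarrow> h \<in> C \<and> \<gamma> \<in> centralizer G s \<and> t \<otimes> g r = g h \<otimes> \<gamma>"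
    using h assms t coeff_centralizer[OF t(1) assms(2)] by (simp add: coeff_def m_assoc[symmetric])
  fix z assume "case z of (h, \<gamma>) \<Rightarrow> h \<in> C \<and> \<gamma> \<in> centralizer G s \<and> t \<otimes> g r = g h \<otimes> \<gamma>"
  then obtain h' \<gamma> where z: "z = (h', \<gamma>)" "h' \<in> C" "\<gamma> \<in> centralizer G s" "t \<otimes> g r = g h' \<otimes> \<gamma>"
    by (cases z) auto
  have \<gamma>: "\<gamma> \<in> carrier G" "conj_by G \<gamma> s = s" using z(3) centralizer_carrier centralizer_iff by auto
  have "conj_by G (t \<otimes> g r) s = conj_by G t r" using t assms by (simp add: conj_by_mult g_conj)
  moreover have "conj_by G (g h' \<otimes> \<gamma>) s = h'" using z \<gamma> by (simp add: conj_by_mult g_conj)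
  ultimately have h': "h' = conj_by G t r" using z(4) by simp
  have "\<gamma> = inv (g h') \<otimes> (g h' \<otimes> \<gamma>)" using z \<gamma> by (simp add: m_assoc[symmetric])
  then have "\<gamma> = coeff t r" using z(4) h' by (simp add: coeff_def)
  with z h' show "z = (conj_by G t r, coeff t r)" by simp
qed

lemma cY_eq: "cY u u' = (\<Sum>t\<in>C. \<Sum>r\<in>C. word [eY (act t (r, u' r)), YD_elem t (u t)])"
  unfolding YD_braiding_def by (intro sum.cong refl) (simp add: YD_factor_eq act_def)

lemma eY_act_U: "t \<in> carrier G \<Longrightarrow> r \<in> C \<Longrightarrow> eY (act t (r, v)) \<in> U"
  by (simp add: act_def YD_elem_U conj_by_C)
lemma eY_act_add: "t \<in> carrier G \<Longrightarrow> r \<in> C \<Longrightarrow> eY (act t (r, v + w)) = eY (act t (r, v)) + eY (act t (r, w))"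
  by (simp add: act_def rho_add coeff_centralizer YD_elem_add)
lemma eY_act_scale: "t \<in> carrier G \<Longrightarrow> r \<in> C \<Longrightarrow> eY (act t (r, scale a v)) = YD_scale scale a (eY (act t (r, v)))"
  by (simp add: act_def rho_scale coeff_centralizer YD_elem_scale)
lemma eY_act_zero: "t \<in> carrier G \<Longrightarrow> r \<in> C \<Longrightarrow> eY (act t (r, 0)) = 0"
  by (simp add: act_def rho_zero coeff_centralizer YD_elem_zero)

sublocale T: tensor_space "YD_scale scale" U
  by unfold_locales (auto simp: YD_space_def YD_scale_def)

text \<open>
  Self-distributivity: the degree of \<open>x \<rhd> y\<close> is the conjugate of the degree of \<open>y\<close> by that of \<open>x\<close>.
\<close>

sublocale sh: shelf opn pairs
proof
  fix x y :: "'g \<times> 'v" assume xy: "x \<in> pairs" "y \<in> pairs"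
  then show "opn x y \<in> pairs" using C_carrier by (auto simp: act_def conj_by_C)
  fix z :: "'g \<times> 'v" assume z: "z \<in> pairs"
  let ?t = "fst x" let ?r = "fst y"
  have c: "?t \<in> carrier G" "?r \<in> carrier G" "fst z \<in> C" using xy z C_carrier by auto
  have "conj_by G ?t ?r \<otimes> ?t = ?t \<otimes> ?r" using c by (simp add: conj_by_def m_assoc)
  then show "opn x (opn y z) = opn (opn x y) (opn x z)"
    using c by (simp add: act_act) (simp add: act_def[of ?t y] act_act)
qed

lemma letter_FC:
  "t \<in> C \<Longrightarrow> r \<in> C \<Longrightarrow> word [eY (act t (r, v))] \<in> T.FC" "t \<in> C \<Longrightarrow> word [YD_elem t v :: 'g \<Rightarrow> 'v] \<in> T.FC"
  by (rule T.FC_closed; simp add: YD_elem_U eY_act_U C_carrier del: split_beta)+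

lemma YD_elem_sum: "u \<in> U \<Longrightarrow> u = (\<Sum>t\<in>C. YD_elem t (u t))"
proof
  fix x assume u: "u \<in> U"
  have "(\<Sum>t\<in>C. YD_elem t (u t)) x = (\<Sum>t\<in>C. YD_elem t (u t) x)"
    by (induction C rule: infinite_finite_induct) auto
  also have "\<dots> = (\<Sum>t\<in>C. if t = x then u x else 0)"
    by (rule sum.cong) (auto simp: YD_elem_def)
  also have "\<dots> = u x" using u finite_C by (auto simp: YD_space_def)
  finally show "u x = (\<Sum>t\<in>C. YD_elem t (u t)) x" by simp
qed

text \<open>
  In the double sum that defines the braiding, all terms but one contain a zero letter if both arguments are
  homogeneous. Such terms are not zero in the free algebra, but they lie in the tensor ideal.
\<close>

sublocale B: braided_tensor_space "YD_scale scale" U opn pairs eY cY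
proof
  show "eY x \<in> U" if "x \<in> pairs" for x using that by (auto simp: YD_elem_U)
  show "\<exists>xs. set xs \<subseteq> pairs \<and> u = sum_list (map eY xs)" if u: "u \<in> U" for u
  proof -
    obtain ts where ts: "set ts = C" "distinct ts" using finite_distinct_list[OF finite_C] by blast
    have "u = sum_list (map eY (map (\<lambda>t. (t, u t)) ts))"
      using YD_elem_sum[OF u] sum_list_distinct_conv_sum_set[OF ts(2), of "\<lambda>t. YD_elem t (u t)"] ts(1)
      by (simp add: o_def)
    then show ?thesis using ts by (intro exI[of _ "map (\<lambda>t. (t, u t)) ts"]) auto
  qed
  show "cY u v \<in> T.Fn 2" if "u \<in> U" "v \<in> U" for u v
    unfolding cY_eq by (intro T.Fn_sum T.Fn_closed(5)) (auto simp: YD_elem_U C_carrier simp del: split_beta intro: eY_act_U)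
  show "T.teq (cY (u + u') v) (cY u v + cY u' v)" if "u \<in> U" "u' \<in> U" "v \<in> U" for u u' v
  proof -
    have "T.teq (word [eY (act t (r, v r)), YD_elem t ((u + u') t)])
        (word [eY (act t (r, v r)), YD_elem t (u t)] + word [eY (act t (r, v r)), YD_elem t (u' t)])" if "t \<in> C" "r \<in> C" for t r
    proof -
      have "T.teq (word [YD_elem t ((u + u') t)]) (word [YD_elem t (u t)] + word [YD_elem t (u' t)])"
        using that by (simp add: YD_elem_add T.word_add YD_elem_U)
      from T.teq_mult_left[OF this letter_FC(1)[OF that]] show ?thesis
        by (simp add: distrib_left word_mult)
    qed
    then show ?thesis unfolding cY_eq sum.distrib[symmetric] by (intro T.teq_sum)
  qed
  show "T.teq (cY u (v + v')) (cY u v + cY u v')" if "u \<in> U" "v \<in> U" "v' \<in> U" for u v v'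
  proof -
    have "T.teq (word [eY (act t (r, (v + v') r)), YD_elem t (u t)])
        (word [eY (act t (r, v r)), YD_elem t (u t)] + word [eY (act t (r, v' r)), YD_elem t (u t)])" if "t \<in> C" "r \<in> C" for t r
    proof -
      have "T.teq (word [eY (act t (r, (v + v') r))]) (word [eY (act t (r, v r))] + word [eY (act t (r, v' r))])"
        using that eY_act_U[of t r] eY_act_add[of t r "v r" "v' r"] C_carrier T.word_add by simp
      from T.teq_mult_right[OF this letter_FC(2)[OF that(1)]] show ?thesis
        by (simp add: distrib_right word_mult)
    qed
    then show ?thesis unfolding cY_eq sum.distrib[symmetric] by (intro T.teq_sum)
  qed
  show "T.teq (cY (YD_scale scale a u) v) (smult_fin a (cY u v))" if "u \<in> U" "v \<in> U" for a u v
  proof -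
    have "T.teq (word [eY (act t (r, v r)), YD_elem t (YD_scale scale a u t)])
        (smult_fin a (word [eY (act t (r, v r)), YD_elem t (u t)]))" if "t \<in> C" "r \<in> C" for t r
    proof -
      have "T.teq (word [YD_elem t (YD_scale scale a u t)]) (smult_fin a (word [YD_elem t (u t)]))"
      proof -
        have "YD_scale scale a u t = scale a (u t)" by (simp add: YD_scale_def)
        then show ?thesis using T.word_scale[OF YD_elem_U[OF that(1)], of a "u t"] by (simp only: YD_elem_scale)
      qed
      from T.teq_mult_left[OF this letter_FC(1)[OF that]] show ?thesis
        by (simp add: smult_fin_mult_right word_mult)
    qed
    then show ?thesis unfolding cY_eq smult_fin_sum by (intro T.teq_sum)
  qed
  show "T.teq (cY u (YD_scale scale a v)) (smult_fin a (cY u v))" if "u \<in> U" "v \<in> U" for a u v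
  proof -
    have "T.teq (word [eY (act t (r, YD_scale scale a v r)), YD_elem t (u t)])
        (smult_fin a (word [eY (act t (r, v r)), YD_elem t (u t)]))" if "t \<in> C" "r \<in> C" for t r
    proof -
      have "T.teq (word [eY (act t (r, YD_scale scale a v r))]) (smult_fin a (word [eY (act t (r, v r))]))"
      proof -
        have "YD_scale scale a v r = scale a (v r)" by (simp add: YD_scale_def)
        moreover have t: "t \<in> carrier G" using that C_carrier by blast
        ultimately show ?thesis
          using T.word_scale[OF eY_act_U[OF t that(2)], of a "v r"] by (simp only: eY_act_scale[OF t that(2)])
      qed
      from T.teq_mult_right[OF this letter_FC(2)[OF that(1)]] show ?thesis
        by (simp add: smult_fin_mult_left word_mult)
    qed
    then show ?thesis unfolding cY_eq smult_fin_sum by (intro T.teq_sum)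
  qed
  show "T.teq (cY (eY x) (eY y)) (word [eY (opn x y), eY x])" if xy: "x \<in> pairs" "y \<in> pairs" for x y
  proof -
    obtain t v where x: "x = (t, v)" "t \<in> C" using xy by auto
    obtain r w where y: "y = (r, w)" "r \<in> C" using xy by auto
    let ?F = "word [eY (act t (r, w)), YD_elem t v]"
    have "T.teq (word [eY (act t' (r', YD_elem r w r')), YD_elem t' (YD_elem t v t')])
        (if t' = t then if r' = r then ?F else 0 else 0)" if "t' \<in> C" "r' \<in> C" for t' r'
    proof -
      have a: "word [eY (act t' (r', z))] \<in> T.FC" "word [YD_elem t' z] \<in> T.FC" for z
        using letter_FC that by blast+
      consider "t' \<noteq> t" | "t' = t" "r' \<noteq> r" | "t' = t" "r' = r" by blast
      then show ?thesis
      proof cases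
        case 1
        then have "T.teq (word [YD_elem t' (YD_elem t v t')]) 0"
          using T.word_zero by (simp add: YD_elem_zero YD_elem_def[of t v])
        from T.teq_mult_left[OF this a(1)] 1 show ?thesis by (simp add: word_mult)
      next
        case 2
        then have "eY (act t' (r', YD_elem r w r')) = 0"
          using that C_carrier by (simp add: eY_act_zero YD_elem_def[of r w] del: split_beta)
        then have "T.teq (word [eY (act t' (r', YD_elem r w r'))]) 0" using T.word_zero by simp
        from T.teq_mult_right[OF this a(2)] 2 show ?thesis by (simp add: word_mult)
      next
        case 3
        then show ?thesis by (simp add: YD_elem_def[of r w] YD_elem_def[of t v])
      qed
    qed
    then have "T.teq (cY (eY x) (eY y)) (\<Sum>t'\<in>C. \<Sum>r'\<in>C. if t' = t then if r' = r then ?F else 0 else 0)"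
      unfolding cY_eq x y split by (intro T.teq_sum)
    also have "(\<Sum>t'\<in>C. \<Sum>r'\<in>C. if t' = t then if r' = r then ?F else 0 else 0) = (\<Sum>t'\<in>C. if t' = t then ?F else 0)"
      by (rule sum.cong) (use y finite_C in auto)
    also have "\<dots> = ?F" using x finite_C by simp
    finally show ?thesis using x y by simp
  qed
qed

end


section \<open>Central scalars and dihedral relations\<close>

lemma sum_powers_root_of_unity:
  fixes z :: complex
  assumes "z ^ n = 1" "z \<noteq> 1"
  shows "(\<Sum>j<n. z ^ j) = 0"
  using assms by (simp add: sum_gp_strict)

text \<open>
  Averaging \<open>z\<^sup>-\<^sup>i T\<^sup>i v\<close> over \<open>i < n\<close> projects \<open>v\<close> to the eigenspace of \<open>T\<close> for an \<open>n\<close>-th root of unity \<open>z\<close>.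
  These projections add up to \<open>n v\<close>, so one of them is nonzero.
\<close>

lemma finite_order_eigenvector:
  fixes scale :: "complex \<Rightarrow> 'v::ab_group_add \<Rightarrow> 'v" and T :: "'v \<Rightarrow> 'v" and v :: 'v
  assumes "vector_space scale" and T: "Vector_Spaces.linear scale scale T"
    and n: "n > 0" "\<And>v. (T ^^ n) v = v" and v: "v \<noteq> 0"
  shows "\<exists>q x. x \<noteq> 0 \<and> T x = scale q x"
proof -
  interpret V: vector_space scale by fact
  interpret T: Vector_Spaces.linear scale scale T by fact
  define z where "z j = cis (2 * pi * real j / real n)" for j
  have zn: "z j ^ n = 1" for j
    using n(1) by (simp add: z_def DeMoivre) 
  have z0: "z j \<noteq> 0" for j by (simp add: z_def)
  define P where "P j = (\<Sum>i<n. scale (inverse (z j) ^ i) ((T ^^ i) v))" for j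
  have "T (P j) = scale (z j) (P j)" for j
  proof -
    have "T (P j) = (\<Sum>i<n. scale (inverse (z j) ^ i) ((T ^^ Suc i) v))"
      by (simp add: P_def T.sum T.scale)
    also have "\<dots> = (\<Sum>i<n. scale (z j) (scale (inverse (z j) ^ Suc i) ((T ^^ Suc i) v)))"
      by (rule sum.cong) (use z0[of j] in \<open>auto simp: field_simps\<close>)
    also have "\<dots> = scale (z j) (\<Sum>i<n. scale (inverse (z j) ^ Suc i) ((T ^^ Suc i) v))"
      by (simp only: V.scale_sum_right)
    also have "(\<Sum>i<n. scale (inverse (z j) ^ Suc i) ((T ^^ Suc i) v)) = P j"
    proof -
      let ?f = "\<lambda>i. scale (inverse (z j) ^ i) ((T ^^ i) v)"
      have "?f n = ?f 0" using n(2) zn[of j] by (simp add: power_inverse)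
      moreover have "(\<Sum>i<Suc n. ?f i) = ?f 0 + (\<Sum>i<n. ?f (Suc i))" by (rule sum.lessThan_Suc_shift)
      moreover have "(\<Sum>i<Suc n. ?f i) = P j + ?f n" by (simp add: P_def)
      ultimately show ?thesis by (simp only: add.commute[of "?f 0"] add_right_cancel)
    qed
    finally show ?thesis .
  qed
  moreover have "\<exists>j<n. P j \<noteq> 0"
  proof (rule ccontr)
    assume "\<not> ?thesis"
    then have "0 = (\<Sum>j<n. P j)" by simp
    also have "\<dots> = (\<Sum>i<n. \<Sum>j<n. scale (inverse (z j) ^ i) ((T ^^ i) v))"
      unfolding P_def by (rule sum.swap)
    also have "\<dots> = (\<Sum>i<n. scale (\<Sum>j<n. inverse (z j) ^ i) ((T ^^ i) v))"
      by (simp add: V.scale_sum_left)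
    also have "\<dots> = (\<Sum>i<n. if i = 0 then scale (of_nat n) v else 0)"
    proof (rule sum.cong[OF refl])
      fix i assume i: "i \<in> {..<n}"
      show "scale (\<Sum>j<n. inverse (z j) ^ i) ((T ^^ i) v) = (if i = 0 then scale (of_nat n) v else 0)"
      proof (cases "i = 0")
        case False
        let ?y = "inverse (z i)"
        have "inverse (z j) ^ i = ?y ^ j" for j
          by (simp add: z_def power_inverse DeMoivre mult.commute mult.left_commute)
        moreover have "?y ^ n = 1" using zn[of i] by (simp add: power_inverse)
        moreover have "?y \<noteq> 1"
        proof
          assume "?y = 1"
          then have "z i = 1" by simp
          then have "cos (2 * pi * real i / real n) = 1" by (simp add: z_def complex_eq_iff)
          then obtain m where "2 * pi * real i / real n = of_int m * 2 * pi" unfolding cos_one_2pi_int by blast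
          then have "(of_int (int i) :: real) = of_int (m * int n)" using n(1) by (simp add: field_simps)
          then have "int i = m * int n" by (simp only: of_int_eq_iff)
          then have "n dvd i" by (metis dvd_triv_right of_nat_dvd_iff)
          then show False using i False by (auto dest: dvd_imp_le)
        qed
        ultimately show ?thesis using False by (simp add: sum_powers_root_of_unity)
      qed simp
    qed
    also have "\<dots> = scale (of_nat n) v" using n(1) by simp
    finally show False using v n(1) by simp
  qed
  ultimately show ?thesis by blast
qed

context yd_module
begin

lemma rho_one: "\<rho> \<one> v = v"
proof -
  have one: "\<one> \<in> centralizer G s" by (simp add: centralizer_def)
  have "\<rho> \<one> (\<rho> \<one> v) = \<rho> \<one> v" using rho_mult[OF one one, of v] by simp
  then show ?thesis using rho_bij[OF one] by (metis bij_is_inj injD)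
qed

text \<open>
  An eigenspace of the central element is invariant under the whole representation.
\<close>

proposition schur:
  obtains q where "\<And>v. \<rho> s v = scale q v"
proof -
  have sc: "s \<in> centralizer G s" by (rule s_centralizer)
  have pow: "s [^] (n::nat) \<in> centralizer G s \<and> \<rho> (s [^] n) v = (\<rho> s ^^ n) v" for n v
  proof (induction n arbitrary: v)
    case 0
    then show ?case by (simp add: rho_one) (simp add: centralizer_def)
  next
    case (Suc n)
    have "s [^] Suc n = s \<otimes> s [^] n" by (rule nat_pow_Suc2) simp
    moreover have "s \<otimes> s [^] n \<in> centralizer G s"
      using Suc[of v] by (simp add: centralizer_def m_assoc)
    ultimately show ?case using Suc rho_mult[OF sc, of "s [^] n" v] by simp
  qed
  have "order G > 0" using finite_G by (simp add: order_gt_0_iff_finite)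
  moreover have "(\<rho> s ^^ order G) v = v" for v
    using pow[of "order G" v] pow_order_eq_1[OF s_carrier] by (simp add: rho_one)
  moreover obtain v0 :: 'v where "v0 \<noteq> 0"
    using irreducible by (auto simp: irreducible_representation_def)
  ultimately obtain q x where x: "x \<noteq> 0" "\<rho> s x = scale q x"
    using finite_order_eigenvector[OF V.vector_space_axioms rho_linear[OF sc], of "order G" v0] by blast
  let ?W = "{v. \<rho> s v = scale q v}"
  have "V.subspace ?W"
    by (rule V.subspaceI) (simp_all add: rho_zero[OF sc] rho_add[OF sc] rho_scale[OF sc] V.scale_right_distrib V.scale_left_commute)
  moreover have "\<rho> h ` ?W \<subseteq> ?W" if h: "h \<in> centralizer G s" for h
  proof
    fix y assume "y \<in> \<rho> h ` ?W"
    then obtain v where v: "y = \<rho> h v" "\<rho> s v = scale q v" by blast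
    have "\<rho> s (\<rho> h v) = \<rho> h (\<rho> s v)"
      using rho_mult[OF sc h, of v] rho_mult[OF h sc, of v] h by (simp add: centralizer_def)
    then show "y \<in> ?W" using v rho_scale[OF h] by simp
  qed
  ultimately have "?W = {0} \<or> ?W = UNIV"
    using irreducible by (auto simp: irreducible_representation_def)
  then have "?W = UNIV" using x by auto
  then show thesis using that[of q] by blast
qed

lemma rho_central_scalar: "\<rho> s v = scale (central_scalar scale \<rho> s) v"
proof -
  obtain q where q: "\<And>v. \<rho> s v = scale q v" using schur by blast
  obtain v0 :: 'v where v0: "v0 \<noteq> 0"
    using irreducible by (auto simp: irreducible_representation_def)
  have "central_scalar scale \<rho> s = q"
    unfolding central_scalar_def
    by (rule the_equality) (use q v0 in \<open>auto simp: V.scale_right_imp_eq\<close>)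
  then show ?thesis using q by simp
qed

end

lemma (in group) inv_cancel_left: "x \<in> carrier G \<Longrightarrow> y \<in> carrier G \<Longrightarrow> inv x \<otimes> (x \<otimes> y) = y" "x \<in> carrier G \<Longrightarrow> y \<in> carrier G \<Longrightarrow> x \<otimes> (inv x \<otimes> y) = y"
  by (simp_all add: m_assoc[symmetric])

locale dihedral_family = group G for G :: "('g, 'm) monoid_scheme" (structure) +
  fixes p :: nat and M :: "int \<Rightarrow> 'g"
  assumes odd_p: "odd p" and M_closed [simp]: "M i \<in> carrier G" and M_periodic: "M (i mod int p) = M i"
    and M_rel: "M i \<otimes> M j = M (2 * i - j) \<otimes> M i"
begin

text \<open>
  The square of \<open>M i\<close> commutes with every \<open>M j\<close>, while conjugation by \<open>M j\<close> takes it to the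
  square of \<open>M (2j - i)\<close>. As \<open>p\<close> is odd, \<open>2j - i\<close> runs through all residues.
\<close>

lemma M_square: "M i \<otimes> M i = M k \<otimes> M k"
proof -
  have refl: "M (2 * j - i) \<otimes> M (2 * j - i) = M i \<otimes> M i" for i j
  proof -
    have "M j \<otimes> (M i \<otimes> M i) = (M (2 * j - i) \<otimes> M (2 * j - i)) \<otimes> M j"
      using M_rel[of j i] by (metis M_closed m_assoc)
    moreover have "M j \<otimes> (M i \<otimes> M i) = (M i \<otimes> M i) \<otimes> M j"
    proof -
      have "M i \<otimes> (M i \<otimes> M j) = M i \<otimes> (M (2 * i - j) \<otimes> M i)" using M_rel[of i j] by simp
      also have "\<dots> = (M i \<otimes> M (2 * i - j)) \<otimes> M i" by (simp add: m_assoc)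
      also have "\<dots> = (M j \<otimes> M i) \<otimes> M i" using M_rel[of i "2 * i - j"] by simp
      finally show ?thesis by (simp add: m_assoc)
    qed
    ultimately show ?thesis by (metis M_closed m_closed right_cancel)
  qed
  define h where "h = (int p + 1) div 2"
  have h: "2 * h = int p + 1" using odd_p by (auto simp: h_def elim!: oddE)
  have "M (2 * (h * (i + k)) - i) = M k"
  proof -
    have "2 * (h * (i + k)) - i = (2 * h) * (i + k) - i" by simp
    also have "\<dots> = k + int p * (i + k)" unfolding h by (simp add: algebra_simps)
    finally have "2 * (h * (i + k)) - i = k + int p * (i + k)" .
    then have "(2 * (h * (i + k)) - i) mod int p = k mod int p" by simp
    then show ?thesis by (metis M_periodic)
  qed
  then show ?thesis using refl[of "h * (i + k)" i] by simp
qed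

definition T :: 'g where "T = M 1 \<otimes> inv (M 0)"

lemma T_closed [simp]: "T \<in> carrier G" by (simp add: T_def)

text \<open>
  The products \<open>M (i + 1) M i\<close> of neighbours all agree, by the relation for \<open>i + 1\<close> and \<open>i\<close>, and so do
  the squares; hence so do the quotients.
\<close>

lemma M_Suc: "M (i + 1) = T \<otimes> M i"
proof -
  have step: "M (i + 1) \<otimes> M i = M (i + 2) \<otimes> M (i + 1)" for i
    using M_rel[of "i + 1" i] by (simp add: algebra_simps)
  have c: "M (i + 1) \<otimes> M i = M 1 \<otimes> M 0" for i
  proof (induction i rule: int_induct[of _ 0])
    case (step1 i)
    then show ?case using step[of i] by (simp add: add.commute add.left_commute)
  next
    case (step2 i)
    then show ?case using step[of "i - 1"] by (simp add: add.commute)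
  qed simp
  have "M (i + 1) \<otimes> inv (M i) = (M (i + 1) \<otimes> M i) \<otimes> inv (M i \<otimes> M i)"
    by (simp add: inv_mult_group m_assoc inv_cancel_left)
  also have "\<dots> = (M 1 \<otimes> M 0) \<otimes> inv (M 0 \<otimes> M 0)" using c[of i] M_square[of i 0] by simp
  also have "\<dots> = T" by (simp add: T_def inv_mult_group m_assoc inv_cancel_left)
  finally show ?thesis by (metis M_closed inv_closed inv_solve_right' m_closed T_closed)
qed

lemma M_eq: "M k = T [^] k \<otimes> M 0"
proof (induction k rule: int_induct[of _ 0])
  case (step1 k)
  then show ?case using M_Suc[of k] by (simp add: int_pow_mult[of T 1 k, simplified] add.commute m_assoc)
next
  case (step2 k)
  have "T \<otimes> M (k - 1) = T \<otimes> (T [^] (k - 1) \<otimes> M 0)"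
    using step2 M_Suc[of "k - 1"] int_pow_mult[of T 1 "k - 1"] by (simp add: m_assoc)
  then show ?case by simp
qed simp

lemma T_pow_p: "T [^] int p = \<one>"
proof -
  have "M (int p) = M 0" using M_periodic[of "int p"] M_periodic[of 0] by simp
  then show ?thesis using M_eq[of "int p"] by (metis M_closed T_closed int_pow_closed r_cancel_one')
qed

lemma T_pow_mod: "T [^] (k mod int p) = T [^] k"
proof -
  have "T [^] k = T [^] (int p * (k div int p) + k mod int p)" by simp
  also have "\<dots> = (T [^] int p) [^] (k div int p) \<otimes> T [^] (k mod int p)"
    by (simp only: int_pow_mult[OF T_closed] int_pow_pow[OF T_closed])
  finally show ?thesis by (simp add: T_pow_p)
qed

lemma M0_T_pow: "M 0 \<otimes> T [^] k = T [^] (- k) \<otimes> M 0" for k :: int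
proof -
  have "(M 0 \<otimes> T [^] k) \<otimes> M 0 = (T [^] (- k) \<otimes> M 0) \<otimes> M 0"
    using M_rel[of 0 k] M_eq[of k] M_eq[of "- k"] by (simp add: m_assoc)
  then show ?thesis by (simp only: right_cancel M_closed m_closed int_pow_closed T_closed)
qed

end

locale dihedral_pair = Mf: dihedral_family G p M + Nf: dihedral_family G p N
  for G :: "('g, 'm) monoid_scheme" (structure) and p M N +
  assumes MN: "M i \<otimes> N j = N (2 * i - j) \<otimes> M i" and NM: "N i \<otimes> M j = M (2 * i - j) \<otimes> N i"
begin

abbreviation "T \<equiv> Mf.T"
abbreviation "T' \<equiv> Nf.T"

lemma comm0: "N 0 \<otimes> M 0 = M 0 \<otimes> N 0" using NM[of 0 0] by simp

lemma N0_T_pow: "N 0 \<otimes> T [^] k = T [^] (- k) \<otimes> N 0" for k :: int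
proof -
  have "(N 0 \<otimes> T [^] k) \<otimes> M 0 = (T [^] (- k) \<otimes> N 0) \<otimes> M 0"
    using NM[of 0 k] Mf.M_eq[of k] Mf.M_eq[of "- k"] comm0 by (simp add: Mf.m_assoc)
  then show ?thesis by (simp only: Mf.right_cancel Mf.M_closed Nf.M_closed Mf.m_closed Mf.int_pow_closed Mf.T_closed)
qed

lemma M0_T'_pow: "M 0 \<otimes> T' [^] k = T' [^] (- k) \<otimes> M 0" for k :: int
proof -
  have "(M 0 \<otimes> T' [^] k) \<otimes> N 0 = (T' [^] (- k) \<otimes> M 0) \<otimes> N 0"
    using MN[of 0 k] Nf.M_eq[of k] Nf.M_eq[of "- k"] comm0 by (simp add: Mf.m_assoc)
  then show ?thesis by (simp only: Mf.right_cancel Mf.M_closed Nf.M_closed Mf.m_closed Mf.int_pow_closed Nf.T_closed)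
qed

text \<open>
  Comparing \<open>N 1 M 0\<close> with \<open>M 2 N 1\<close> gives \<open>T'\<^sup>2 = T\<^sup>2\<close>, and both elements have odd order.
\<close>

lemma T'_eq: "T' = T"
proof -
  have N1: "N 1 = T' \<otimes> N 0" using Nf.M_Suc[of 0] by simp
  have M2: "M 2 = T [^] (2::int) \<otimes> M 0" by (rule Mf.M_eq)
  have M0T': "M 0 \<otimes> T' = inv T' \<otimes> M 0"
    using M0_T'_pow[of 1] by (simp add: Mf.int_pow_neg)
  have "(T' \<otimes> M 0) \<otimes> N 0 = N 1 \<otimes> M 0"
    using N1 comm0 by (simp add: Mf.m_assoc)
  also have "\<dots> = M 2 \<otimes> N 1" using NM[of 1 0] by simp
  also have "\<dots> = T [^] (2::int) \<otimes> ((M 0 \<otimes> T') \<otimes> N 0)" using N1 M2 by (simp add: Mf.m_assoc)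
  also have "\<dots> = ((T [^] (2::int) \<otimes> inv T') \<otimes> M 0) \<otimes> N 0" unfolding M0T' by (simp add: Mf.m_assoc)
  finally have "T' = T [^] (2::int) \<otimes> inv T'"
    by (simp only: Mf.right_cancel Mf.M_closed Nf.M_closed Mf.m_closed Mf.int_pow_closed Nf.T_closed Mf.T_closed Mf.inv_closed)
  then have "T' \<otimes> T' = T [^] (2::int)"
    by (metis Mf.T_closed Nf.T_closed Mf.int_pow_closed Mf.inv_closed Mf.inv_solve_right Mf.m_closed)
  moreover have "T' [^] (2::int) = T' \<otimes> T'" using Mf.int_pow_mult[of T' 1 1] by simp
  ultimately have sq: "T' [^] (2::int) = T [^] (2::int)" by simp
  define h where "h = (int p + 1) div 2"
  have h: "2 * h = int p + 1" using Mf.odd_p by (auto simp: h_def elim!: oddE)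
  have e: "T'' [^] (2 * h) = T''" if "T'' \<in> carrier G" "T'' [^] int p = \<one>" for T''
    unfolding h using that Mf.int_pow_mult[of T'' "int p" 1] by simp
  have "T' = (T' [^] (2::int)) [^] h" using e[OF Nf.T_closed Nf.T_pow_p] by (simp only: Mf.int_pow_pow[OF Nf.T_closed])
  also have "\<dots> = T" unfolding sq using e[OF Mf.T_closed Mf.T_pow_p] by (simp only: Mf.int_pow_pow[OF Mf.T_closed])
  finally show ?thesis .
qed

text \<open>
  As \<open>(p + 1) / 2\<close> is the inverse of \<open>2\<close> modulo \<open>p\<close>, this is the rotation that takes the index \<open>0\<close> to \<open>k\<close>;
  conjugation by \<open>T\<close> raises indices by \<open>2\<close>.
\<close>

definition rotn :: "int \<Rightarrow> 'g" where "rotn k = T [^] (k * ((int p + 1) div 2))"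

lemma rotn_closed [simp]: "rotn k \<in> carrier G" by (simp add: rotn_def)

lemma rotn_mod: "rotn (k mod int p) = rotn k"
  unfolding rotn_def using Mf.T_pow_mod[of "(k mod int p) * ((int p + 1) div 2)"] Mf.T_pow_mod[of "k * ((int p + 1) div 2)"]
  by (metis mod_mult_left_eq)

lemma rotn_reflect: "T [^] i \<otimes> rotn (- j) = rotn (2 * i - j)"
proof -
  define h where "h = (int p + 1) div 2"
  have h: "2 * h = int p + 1" using Mf.odd_p by (auto simp: h_def elim!: oddE)
  have "(2 * i - j) * h = i * (2 * h) - j * h" by (simp add: algebra_simps)
  also have "\<dots> = (i + (- j) * h) + int p * i" unfolding h by (simp add: algebra_simps)
  finally have "(2 * i - j) * h = (i + (- j) * h) + int p * i" .
  then have "((2 * i - j) * h) mod int p = (i + (- j) * h) mod int p" by simp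
  then have "T [^] ((2 * i - j) * h) = T [^] (i + (- j) * h)" by (metis Mf.T_pow_mod)
  then show ?thesis by (simp only: rotn_def h_def Mf.int_pow_mult[OF Mf.T_closed])
qed

lemma M_rotn: "M i \<otimes> rotn j = rotn (2 * i - j) \<otimes> M 0"
proof -
  have "M i \<otimes> rotn j = T [^] i \<otimes> (M 0 \<otimes> rotn j)" unfolding Mf.M_eq[of i] by (simp add: Mf.m_assoc)
  also have "M 0 \<otimes> rotn j = rotn (- j) \<otimes> M 0" unfolding rotn_def Mf.M0_T_pow by simp
  finally show ?thesis using rotn_reflect[of i j] by (simp add: Mf.m_assoc[symmetric])
qed

lemma N_rotn: "N i \<otimes> rotn j = rotn (2 * i - j) \<otimes> N 0"
proof -
  have "N i \<otimes> rotn j = T [^] i \<otimes> (N 0 \<otimes> rotn j)" unfolding Nf.M_eq[of i] T'_eq by (simp add: Mf.m_assoc)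
  also have "N 0 \<otimes> rotn j = rotn (- j) \<otimes> N 0" unfolding rotn_def N0_T_pow by simp
  finally show ?thesis using rotn_reflect[of i j] by (simp add: Mf.m_assoc[symmetric])
qed

lemma rotn_M0: "conj_by G (rotn k) (M 0) = M k" "conj_by G (rotn k) (N 0) = N k"
proof -
  have k: "k = 2 * k - k" by simp
  have "M k \<otimes> rotn k = rotn k \<otimes> M 0" "N k \<otimes> rotn k = rotn k \<otimes> N 0"
    using M_rotn[of k k] N_rotn[of k k] by simp_all
  then show "conj_by G (rotn k) (M 0) = M k" "conj_by G (rotn k) (N 0) = N k"
    unfolding conj_by_def by (metis Mf.M_closed Nf.M_closed rotn_closed Mf.inv_closed Mf.inv_solve_right' Mf.m_closed)+
qed

end


section \<open>The two dihedral families in the Yetter-Drinfeld module\<close>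

lemma exists_functional:
  fixes scale :: "complex \<Rightarrow> 'v::ab_group_add \<Rightarrow> 'v" and v :: 'v
  assumes "vector_space scale" "v \<noteq> 0"
  shows "\<exists>\<phi> :: 'v \<Rightarrow> complex. (\<forall>x y. \<phi> (x + y) = \<phi> x + \<phi> y) \<and> (\<forall>a x. \<phi> (scale a x) = a * \<phi> x) \<and> \<phi> v = 1"
proof -
  interpret V: vector_space scale by fact
  interpret P: vector_space_pair scale "(*) :: complex \<Rightarrow> complex \<Rightarrow> complex"
    by unfold_locales (auto simp: algebra_simps)
  have "V.independent {v}" using assms(2) by simp
  then obtain \<phi> :: "'v \<Rightarrow> complex" where "Vector_Spaces.linear scale (*) \<phi>" "\<phi> v = 1"
    using P.linear_independent_extend[of "{v}" "\<lambda>_. 1"] by auto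
  then show ?thesis by (auto simp: Vector_Spaces.linear_iff)
qed

locale dihedral_yd = yd_module G C s scale \<rho> g + dihedral_pair G p M N + L: dihedral_letters p
  for G :: "('g, 'm) monoid_scheme" (structure) and C s scale and \<rho> :: "'g \<Rightarrow> 'v::ab_group_add \<Rightarrow> 'v" and g p M N +
  fixes g_inf :: 'g and v w :: 'v
  assumes M_0: "M 0 = s" and g_inf: "g_inf \<in> carrier G" "conj_by G g_inf s = N 0"
    and distinct: "M i = M j \<Longrightarrow> i mod int p = j mod int p" "N i = N j \<Longrightarrow> i mod int p = j mod int p" "M i \<noteq> N j"
    and rho_s: "\<rho> s x = - x" and nonzero_vectors: "v \<noteq> 0" "w \<noteq> 0"
    and rho_w: "\<rho> (inv g_inf \<otimes> s \<otimes> g_inf) w = - w" and rho_v: "\<rho> (N 0) v = - v"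
begin

definition base :: "bool \<Rightarrow> 'g" where "base c = (if c then g_inf else \<one>)"
definition vec :: "bool \<Rightarrow> 'v" where "vec c = (if c then w else v)"
definition reflection :: "bool \<Rightarrow> int \<Rightarrow> 'g" where "reflection c = (if c then N else M)"
text \<open>
  The two families of vectors arise from \<open>1 \<otimes> v\<close> and \<open>g_inf \<otimes> w\<close> by rotation.
\<close>

definition pr :: "int \<times> bool \<Rightarrow> 'g \<times> 'v"
  where "pr x = elem (rotn (fst x) \<otimes> base (snd x)) (vec (snd x))"

lemma base_closed [simp]: "base c \<in> carrier G" using g_inf by (simp add: base_def)
lemma reflection_closed [simp]: "reflection c i \<in> carrier G" by (simp add: reflection_def)
lemma conj_base: "conj_by G (base c) s = reflection c 0"
  using g_inf M_0 by (simp add: base_def reflection_def)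

lemma fst_pr: "fst (pr x) = reflection (snd x) (fst x)"
  using rotn_M0[of "fst x"] by (simp add: pr_def elem_def conj_by_mult conj_base) (simp add: reflection_def)

lemma reflection_rotn: "reflection c i \<otimes> rotn j = rotn (2 * i - j) \<otimes> reflection c 0"
  by (simp add: reflection_def M_rotn N_rotn)

lemma N0_conv: "N 0 = g_inf \<otimes> s \<otimes> inv g_inf"
  using g_inf by (simp add: conj_by_def)
lemma comm: "N 0 \<otimes> s = s \<otimes> N 0" using comm0 by (simp add: M_0)

text \<open>
  In every case this is an eigenvalue \<open>-1\<close>: by the assumptions on \<open>v\<close> and \<open>w\<close> if the reflection and the vector
  belong to different families, and because \<open>s\<close> acts by \<open>-1\<close> if they belong to the same.
\<close>

lemma reflection_base:
  obtains \<gamma> where "\<gamma> \<in> centralizer G s" "reflection c 0 \<otimes> base d = base d \<otimes> \<gamma>" "\<rho> \<gamma> (vec d) = - vec d"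
proof -
  have N0_cent: "N 0 \<in> centralizer G s" using comm by (simp add: centralizer_def)
  have w_cent: "inv g_inf \<otimes> s \<otimes> g_inf \<in> centralizer G s"
  proof -
    have gs: "g_inf \<otimes> s = N 0 \<otimes> g_inf" using g_inf unfolding N0_conv by (simp add: m_assoc)
    have "(g_inf \<otimes> s) \<otimes> (inv g_inf \<otimes> s \<otimes> g_inf) = N 0 \<otimes> s \<otimes> g_inf"
      unfolding gs using g_inf by (simp add: m_assoc inv_cancel_left)
    also have "\<dots> = s \<otimes> (g_inf \<otimes> s)" unfolding comm gs using g_inf by (simp add: m_assoc)
    finally have "g_inf \<otimes> (s \<otimes> (inv g_inf \<otimes> s \<otimes> g_inf)) = g_inf \<otimes> ((inv g_inf \<otimes> s \<otimes> g_inf) \<otimes> s)"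
      using g_inf by (simp add: m_assoc inv_cancel_left)
    then have "s \<otimes> (inv g_inf \<otimes> s \<otimes> g_inf) = (inv g_inf \<otimes> s \<otimes> g_inf) \<otimes> s"
      using g_inf by (metis Units_eq Units_l_cancel inv_closed m_closed s_carrier)
    then show ?thesis using g_inf by (simp add: centralizer_def)
  qed
  consider "c \<noteq> d" "d" | "c \<noteq> d" "\<not> d" | "c = d" by blast
  then show thesis
  proof cases
    case 1
    then show ?thesis
      using that[OF w_cent] rho_w g_inf by (simp add: reflection_def base_def vec_def M_0 m_assoc inv_cancel_left)
  next
    case 2
    then show ?thesis
      using that[OF N0_cent] rho_v by (simp add: reflection_def base_def vec_def)
  next
    case 3
    then show ?thesis
      using that[OF s_centralizer] rho_s g_inf by (simp add: reflection_def base_def vec_def M_0 N0_conv m_assoc)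
  qed
qed

text \<open>
  A reflection moved past a rotation becomes the reflection with index \<open>0\<close>, which acts by \<open>-1\<close>.
\<close>

lemma pr_op: "opn (pr x) (pr y) = elem (rotn (fst (L.dih x y)) \<otimes> base (snd (L.dih x y))) (- vec (snd (L.dih x y)))"
proof -
  obtain \<gamma> where \<gamma>: "\<gamma> \<in> centralizer G s" "reflection (snd x) 0 \<otimes> base (snd y) = base (snd y) \<otimes> \<gamma>" "\<rho> \<gamma> (vec (snd y)) = - vec (snd y)"
    by (rule reflection_base)
  have "opn (pr x) (pr y) = elem (reflection (snd x) (fst x) \<otimes> (rotn (fst y) \<otimes> base (snd y))) (vec (snd y))"
    unfolding fst_pr pr_def[of y] by (simp add: act_elem)
  also have "reflection (snd x) (fst x) \<otimes> (rotn (fst y) \<otimes> base (snd y)) = rotn (2 * fst x - fst y) \<otimes> (reflection (snd x) 0 \<otimes> base (snd y))"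
    using reflection_rotn[of "snd x" "fst x" "fst y"] by (simp add: m_assoc[symmetric])
  also have "\<dots> = (rotn (2 * fst x - fst y) \<otimes> base (snd y)) \<otimes> \<gamma>"
    unfolding \<gamma>(2) using centralizer_carrier[OF \<gamma>(1)] by (simp add: m_assoc)
  finally show ?thesis
    using elem_mult[OF _ \<gamma>(1), of "rotn (2 * fst x - fst y) \<otimes> base (snd y)" "vec (snd y)"] \<gamma>(3)
    by (simp add: L.dih_def rotn_mod)
qed

lemma vec_nonzero: "vec c \<noteq> 0" using nonzero_vectors by (simp add: vec_def)

lemma snd_pr_nonzero: "snd (pr x) \<noteq> 0"
  unfolding pr_def elem_def snd_conv by (intro rho_nonzero elem_centralizer vec_nonzero) simp

definition functional :: "'v \<Rightarrow> 'v \<Rightarrow> complex"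
  where "functional x = (SOME \<phi>. (\<forall>x y. \<phi> (x + y) = \<phi> x + \<phi> y) \<and> (\<forall>a x. \<phi> (scale a x) = a * \<phi> x) \<and> \<phi> x = 1)"

lemma functional:
  assumes "x \<noteq> 0"
  shows "functional x (y + z) = functional x y + functional x z" "functional x (scale a y) = a * functional x y"
    "functional x x = 1"
  using someI_ex[OF exists_functional[OF V.vector_space_axioms assms]] unfolding functional_def[symmetric] by blast+

definition coef :: "int \<times> bool \<Rightarrow> ('g \<Rightarrow> 'v) \<Rightarrow> complex"
  where "coef x u = functional (snd (pr x)) (u (fst (pr x)))"

lemma fst_pr_inj: "x \<in> L.letters \<Longrightarrow> y \<in> L.letters \<Longrightarrow> fst (pr x) = fst (pr y) \<Longrightarrow> x = y"
  using distinct(1)[of "fst x" "fst y"] distinct(2)[of "fst x" "fst y"] distinct(3)[of "fst x" "fst y"] distinct(3)[of "fst y" "fst x"]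
  by (cases x; cases y) (auto simp: fst_pr reflection_def L.letters_def split: if_splits)

lemma pr_pairs: "pr x \<in> pairs"
  using conj_by_C[of "rotn (fst x) \<otimes> base (snd x)" s] s_C by (simp add: pr_def elem_def)

text \<open>
  The letters have pairwise distinct degrees, so coordinates can be read off degree by degree.
\<close>

sublocale R: rack_letters "YD_scale scale" U opn pairs eY cY L.letters pr L.dih coef
proof
  show "finite L.letters" by (simp add: L.letters_def)
  show "pr x \<in> pairs" for x by (rule pr_pairs)
  show "L.dih x y \<in> L.letters" for x y using L.p_gt_1 by (simp add: L.letters_def L.dih_def)
  show "eY (opn (pr x) (pr y)) = YD_scale scale (- 1) (eY (pr (L.dih x y)))" for x y
  proof -
    let ?z = "rotn (fst (L.dih x y)) \<otimes> base (snd (L.dih x y))"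
    have "elem ?z (scale (- 1) (vec (snd (L.dih x y)))) = (fst (pr (L.dih x y)), scale (- 1) (snd (pr (L.dih x y))))"
      using rho_scale[OF elem_centralizer[of ?z], of "- 1"] by (simp add: elem_def pr_def)
    then have "opn (pr x) (pr y) = (fst (pr (L.dih x y)), scale (- 1) (snd (pr (L.dih x y))))"
      unfolding pr_op by simp
    then show ?thesis by (simp only: split_def fst_conv snd_conv YD_elem_scale)
  qed
  show "coef x (u + u') = coef x u + coef x u'" for x u u'
    using functional(1)[OF snd_pr_nonzero] by (simp add: coef_def)
  show "coef x (YD_scale scale a u) = a * coef x u" for x u a
    using functional(2)[OF snd_pr_nonzero] by (simp add: coef_def YD_scale_def)
  show "coef x (eY (pr y)) = (if x = y then 1 else 0)" if "x \<in> L.letters" "y \<in> L.letters" for x y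
    using fst_pr_inj[OF that] functional(2)[OF snd_pr_nonzero[of x], of 0] functional(3)[OF snd_pr_nonzero[of x]]
    by (auto simp: coef_def split_def YD_elem_def)
qed

proposition infinite_dimensional:
  "ring.infinite_dimension (nichols_algebra (YD_scale scale) U cY) (nichols_scalars (YD_scale scale) U cY)
     (carrier (nichols_algebra (YD_scale scale) U cY))"
proof (rule B.infinite_dimension_criterion)
  fix D :: nat
  let ?n = "4 * Suc D" and ?f = "L.imag ^ Suc D"
  have keys: "Poly_Mapping.keys ?f \<subseteq> {ys \<in> lists L.letters. length ys = ?n}"
    using L.homog_power[of "Suc D"] by (simp add: L.homog_def)
  have "R.emb ?f \<in> T.Fn ?n" by (rule R.emb_Fn[OF keys])
  moreover have "B.QS ?n (R.emb ?f) \<notin> T.I"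
  proof
    assume "B.QS ?n (R.emb ?f) \<in> T.I"
    then have "R.sym ?f = 0"
      using R.sym_emb[of ?f ?n] R.proj_I keys by auto
    then have "R.sym 1 = 0"
      using L.power_detected[OF R.sym_linear, of "Suc D"] R.sym_skew_deriv by blast
    then show False using R.sym_one by simp
  qed
  moreover have "?n > D" by simp
  ultimately show "\<exists>n>D. \<exists>f\<in>T.Fn n. B.QS n f \<notin> T.I" by blast
qed

end

theorem theorem2p8:
  fixes G :: "('g, 'm) monoid_scheme"
    and C :: "'g set"
    and p :: nat
    and \<mu> \<nu> :: "int \<Rightarrow> 'g"
    and scale :: "complex \<Rightarrow> 'v::ab_group_add \<Rightarrow> 'v"
    and \<rho> :: "'g \<Rightarrow> 'v \<Rightarrow> 'v"
    and g :: "'g \<Rightarrow> 'g"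
    and g_inf :: 'g
  assumes "group G" and "finite (carrier G)"
    and "is_conjugacy_class G C"
    and "Factorial_Ring.prime p" and "odd p"
    and "\<mu> 0 \<in> C"
    and "irreducible_representation (G\<lparr>carrier := centralizer G (\<mu> 0)\<rparr>) scale \<rho>"
    and "coset_reps G C (\<mu> 0) g"
    and H1: "type_D2 G p \<mu> \<nu>"
    and H2: "\<mu> ` {0..<int p} \<subseteq> C" "\<nu> ` {0..<int p} \<subseteq> C"
            "g_inf \<in> carrier G" "conj_by G g_inf (\<mu> 0) = \<nu> 0"
    and H3: "central_scalar scale \<rho> (\<mu> 0) = -1"
    and H4: "\<exists>v w. v \<noteq> 0 \<and> w \<noteq> 0 \<and>
               \<rho> (inv\<^bsub>G\<^esub> g_inf \<otimes>\<^bsub>G\<^esub> \<mu> 0 \<otimes>\<^bsub>G\<^esub> g_inf) w = - w \<and>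
               \<rho> (\<nu> 0) v = - v"
  shows "ring.infinite_dimension (YD_nichols_algebra G C (\<mu> 0) g scale \<rho>)
           (YD_nichols_scalars G C (\<mu> 0) g scale \<rho>)
           (carrier (YD_nichols_algebra G C (\<mu> 0) g scale \<rho>))"
proof -
  interpret group G by fact
  have yd: "yd_module G C (\<mu> 0) scale \<rho> g"
    by unfold_locales (use assms in auto)
  interpret Y: yd_module G C "\<mu> 0" scale \<rho> g by (rule yd)
  obtain v w where vw: "v \<noteq> 0" "w \<noteq> 0" "\<rho> (inv\<^bsub>G\<^esub> g_inf \<otimes>\<^bsub>G\<^esub> \<mu> 0 \<otimes>\<^bsub>G\<^esub> g_inf) w = - w" "\<rho> (\<nu> 0) v = - v"
    using H4 by blast
  define M N where "M i = \<mu> (i mod int p)" and "N i = \<nu> (i mod int p)" for i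
  have p1: "p > 1" using H1 by (simp add: type_D2_def type_D_def)
  have mod: "i mod int p \<in> {0..<int p}" for i using p1 by simp
  have inj: "inj_on \<mu> {0..<int p}" "inj_on \<nu> {0..<int p}" and sub: "\<mu> ` {0..<int p} \<subseteq> carrier G" "\<nu> ` {0..<int p} \<subseteq> carrier G"
    using H1 by (auto simp: type_D2_def type_D_def)
  have closed: "M i \<in> carrier G" "N i \<in> carrier G" for i
    unfolding M_def N_def by (rule subsetD[OF sub(1) imageI[OF mod]], rule subsetD[OF sub(2) imageI[OF mod]])
  have rels: "conj_by G (M i) (M j) = M (2 * i - j)" "conj_by G (N i) (N j) = N (2 * i - j)"
    "conj_by G (M i) (N j) = N (2 * i - j)" "conj_by G (N i) (M j) = M (2 * i - j)" for i j
  proof -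
    have e: "(2 * (i mod int p) - j mod int p) mod int p = (2 * i - j) mod int p"
      by (metis mod_diff_left_eq mod_diff_right_eq mod_mult_right_eq)
    have D: "\<forall>i\<in>{0..<int p}. \<forall>j\<in>{0..<int p}. conj_by G (\<mu> i) (\<mu> j) = \<mu> ((2 * i - j) mod int p)"
      "\<forall>i\<in>{0..<int p}. \<forall>j\<in>{0..<int p}. conj_by G (\<nu> i) (\<nu> j) = \<nu> ((2 * i - j) mod int p)"
      "\<forall>i\<in>{0..<int p}. \<forall>j\<in>{0..<int p}. conj_by G (\<mu> i) (\<nu> j) = \<nu> ((2 * i - j) mod int p)"
      "\<forall>i\<in>{0..<int p}. \<forall>j\<in>{0..<int p}. conj_by G (\<nu> i) (\<mu> j) = \<mu> ((2 * i - j) mod int p)"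
      using H1 unfolding type_D2_def type_D_def by blast+
    show "conj_by G (M i) (M j) = M (2 * i - j)" "conj_by G (N i) (N j) = N (2 * i - j)"
      "conj_by G (M i) (N j) = N (2 * i - j)" "conj_by G (N i) (M j) = M (2 * i - j)"
      unfolding M_def N_def
      using D[THEN bspec, OF mod[of i], THEN bspec, OF mod[of j]] unfolding e by blast+
  qed
  have conjD: "x \<otimes>\<^bsub>G\<^esub> y = z \<otimes>\<^bsub>G\<^esub> x" if "conj_by G x y = z" "x \<in> carrier G" "y \<in> carrier G" for x y z
    using that by (auto simp: conj_by_def m_assoc)
  have "M i \<otimes>\<^bsub>G\<^esub> M j = M (2 * i - j) \<otimes>\<^bsub>G\<^esub> M i" "N i \<otimes>\<^bsub>G\<^esub> N j = N (2 * i - j) \<otimes>\<^bsub>G\<^esub> N i"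
    "M i \<otimes>\<^bsub>G\<^esub> N j = N (2 * i - j) \<otimes>\<^bsub>G\<^esub> M i" "N i \<otimes>\<^bsub>G\<^esub> M j = M (2 * i - j) \<otimes>\<^bsub>G\<^esub> N i" for i j
    by (rule conjD rels closed)+
  moreover have "M (i mod int p) = M i" "N (i mod int p) = N i" for i
    by (simp_all add: M_def N_def)
  ultimately have pair: "dihedral_pair G p M N"
    using closed assms(5) by unfold_locales
  have letters: "dihedral_letters p" using assms(5) p1 by unfold_locales
  have zero: "M 0 = \<mu> 0" "N 0 = \<nu> 0" by (simp_all add: M_def N_def)
  have "dihedral_yd G C (\<mu> 0) scale \<rho> g p M N g_inf v w"
  proof (intro dihedral_yd.intro dihedral_yd_axioms.intro yd pair letters)
    show "M i = M j \<Longrightarrow> i mod int p = j mod int p" "N i = N j \<Longrightarrow> i mod int p = j mod int p" for i j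
      unfolding M_def N_def by (rule inj_onD[OF inj(1) _ mod mod], assumption) (rule inj_onD[OF inj(2) _ mod mod])
    have "\<forall>i\<in>{0..<int p}. \<forall>j\<in>{0..<int p}. \<mu> i \<noteq> \<nu> j"
      using H1 unfolding type_D2_def by blast
    from this[THEN bspec, OF mod, THEN bspec, OF mod] show "M i \<noteq> N j" for i j unfolding M_def N_def .
    show "\<rho> (\<mu> 0) x = - x" for x using Y.rho_central_scalar[of x] by (simp add: H3)
    show "\<rho> (N 0) v = - v" using vw(4) by (simp only: zero)
    show "conj_by G g_inf (\<mu> 0) = N 0" using H2(4) by (simp only: zero)
  qed (fact zero(1) H2(3) vw)+
  then show ?thesis
    unfolding YD_nichols_algebra_def YD_nichols_scalars_def by (rule dihedral_yd.infinite_dimensional)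
qed

end
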